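(* Let $r\ge1$, $m_1,\dots,m_r\in\mathbb N$, $m=\sum_i m_i$, let $\gamma\in S_m$ have cycles $(1,\dots,m_1)\cdots(m_1+\cdots+m_{r-1}+1,\dots,m)$, let $X_N=\frac{1}{\sqrt N}(x_{i,j})$ be a complex Wigner matrix and $\alpha^{(N)}_{m_1,\dots,m_r}=N^{r-2}k_r(\mathrm{Tr}(X_N^{m_1}),\dots,\mathrm{Tr}(X_N^{m_r}))$. Then for any $N\ge m/2-r+2$, $$\alpha^{(N)}_{m_1,\dots,m_r}=\sum_{\substack{\pi\in\mathcal P(m)\\ \#(\pi)-m/2+r-2=0}}\ \sum_{\substack{\tau\in\mathcal P(m)\\ \tau\vee\gamma=1_m}}k_\tau\big(x_{i^\pi(1),i^\pi(\gamma(1))},\dots,x_{i^\pi(m),i^\pi(\gamma(m))}\big)+o(1)$$ as $N\to\infty$. Consequently the limit $\alpha_{m_1,\dots,m_r}=\lim_{N\to\infty}\alpha^{(N)}_{m_1,\dots,m_r}$ is $$\alpha_{m_1,\dots,m_r}=\sum_{\substack{\pi\in\mathcal P(m)\\ \#(\pi)-m/2+r-2=0}}\ \sum_{\substack{\tau\in\mathcal P(m)\\ \tau\vee\gamma=1_m}}k_\tau\big(x_{i^\pi(1),i^\pi(\gamma(1))},\dots,x_{i^\pi(m),i^\pi(\gamma(m))}\big).$$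
   Context: $k_n$ is the classical joint cumulant; for $\tau\in\mathcal P(m)$ (partitions of $[m]$), $k_\tau(y_1,\dots,y_m)=\prod_{B\in\tau}k_{|B|}((y_i)_{i\in B})$. $\mathrm{Tr}$ is the unnormalized trace. $\#(\pi)$ is the number of blocks, $\vee$ the join of partitions (a permutation being identified with the partition into its cycles), $1_m$ the one-block partition. For $\pi\in\mathcal P(m)$, $i^\pi:[m]\to\mathbb N$ is constant on the blocks of $\pi$ with value $k$ on the $k$-th block, the blocks being ordered by their minimal elements. A complex random variable $x$ is $R$-diagonal if all its joint classical cumulants in $x,\overline x$ vanish except $\beta_{2n}:=k_{2n}(x,\overline x,\dots,x,\overline x)$ ($n$ copies of each, $n\ge1$). A complex Wigner matrix is a self-adjoint $N\times N$ random matrix $X_N=\frac1{\sqrt N}(x_{i,j})$ with $x_{i,j}=\overline{x_{j,i}}$, $E(x_{i,j})=0$, $\{x_{i,j}\}_{i<j}\cup\{x_{i,i}\}_i$ independent, the $x_{i,j}$ ($i<j$) identically distributed $R$-diagonal with cumulant sequence $(\beta_n)_n$ (not depending on $N$), and the $x_{i,i}$ identically distributed $N(0,\beta_2)$. *)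

theory Defs
  imports
    "HOL-Probability.Probability"
    "HOL-Combinatorics.Combinatorics"
    "HOL-Library.Landau_Symbols"
    "Jordan_Normal_Form.Matrix"
begin

section \<open>Partitions\<close>

text \<open>
  \<^term>\<open>refines A P Q\<close> is the order on the partitions of \<^term>\<open>A\<close> in which
  \<^term>\<open>{A}\<close> is the largest element; the join is the least upper bound.
\<close>

definition is_partition_join :: "'a set \<Rightarrow> 'a set set \<Rightarrow> 'a set set \<Rightarrow> 'a set set \<Rightarrow> bool" where
  "is_partition_join A P Q S \<longleftrightarrow> refines A P S \<and> refines A Q S \<and>
     (\<forall>T. refines A P T \<and> refines A Q T \<longrightarrow> refines A S T)"

definition partition_join :: "'a set \<Rightarrow> 'a set set \<Rightarrow> 'a set set \<Rightarrow> 'a set set" where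
  "partition_join A P Q = (THE S. is_partition_join A P Q S)"

lemma is_partition_join_unique:
  "is_partition_join A P Q S \<Longrightarrow> is_partition_join A P Q T \<Longrightarrow> S = T"
  unfolding is_partition_join_def by (meson refines_asym)

lemma is_partition_join_exists:
  assumes P: "partition_on A P" and Q: "partition_on A Q"
  shows "\<exists>S. is_partition_join A P Q S"
proof -
  define U where "U = {T. refines A P T \<and> refines A Q T}"
  have top: "refines A R (if A = {} then {} else {A})" if "partition_on A R" for R
    using that by (auto simp: refines_def partition_on_def disjoint_def)
  have ne: "U \<noteq> {}"
    using top[OF P] top[OF Q] by (auto simp: U_def)
  have part: "partition_on A T" if "T \<in> U" for T
    using that by (auto simp: U_def refines_def)
  have part_S: "partition_on A (common_refinement U)"
    by (rule partition_on_common_refinement[OF part ne])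
  have upper: "refines A R (common_refinement U)"
    if R: "partition_on A R" and le: "\<And>T. T \<in> U \<Longrightarrow> refines A R T" for R
    unfolding refines_def
  proof (intro conjI ballI R part_S)
    fix X assume X: "X \<in> R"
    have "\<forall>T\<in>U. \<exists>Y\<in>T. X \<subseteq> Y"
      using le X by (auto simp: refines_def)
    then obtain F where F: "\<And>T. T \<in> U \<Longrightarrow> F T \<in> T \<and> X \<subseteq> F T"
      by metis
    have "X \<noteq> {}"
      using R X by (auto simp: partition_on_def)
    moreover have "X \<subseteq> \<Inter> (F ` U)"
      using F by auto
    ultimately have "\<Inter> (F ` U) \<in> common_refinement U"
      using F by (auto simp: common_refinement)
    with \<open>X \<subseteq> \<Inter> (F ` U)\<close> show "\<exists>Y\<in>common_refinement U. X \<subseteq> Y"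
      by blast
  qed
  have "refines A (common_refinement U) T" if "T \<in> U" for T
    unfolding refines_def using part_S part[OF that] common_refinement_exists[OF _ that]
    by auto
  with upper[OF P] upper[OF Q] have "is_partition_join A P Q (common_refinement U)"
    by (auto simp: is_partition_join_def U_def)
  then show ?thesis ..
qed

lemma is_partition_join_partition_join:
  assumes "partition_on A P" "partition_on A Q"
  shows "is_partition_join A P Q (partition_join A P Q)"
  unfolding partition_join_def
  by (rule theI') (use is_partition_join_exists[OF assms] is_partition_join_unique in blast)

definition cycle_partition :: "nat \<Rightarrow> (nat \<Rightarrow> nat) \<Rightarrow> nat set set" where
  "cycle_partition m \<sigma> = orbit \<sigma> ` {1..m}"

text \<open>
  The permutation with cycles
  \<open>(1, \<dots>, ms 1) (ms 1 + 1, \<dots>, ms 1 + ms 2) \<dots>\<close>,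
  \<open>r\<close> of them; it fixes every number that is not in one of these cycles.
\<close>

definition cycles_perm :: "nat \<Rightarrow> (nat \<Rightarrow> nat) \<Rightarrow> nat \<Rightarrow> nat" where
  "cycles_perm r ms =
     foldr (\<circ>) (map (\<lambda>k. cycle_of_list [Suc (\<Sum>i=1..<k. ms i) ..< Suc (\<Sum>i=1..k. ms i)]) [1..<Suc r]) id"

definition block_of :: "'a set set \<Rightarrow> 'a \<Rightarrow> 'a set" where
  "block_of \<pi> a = (THE B. B \<in> \<pi> \<and> a \<in> B)"

text \<open>
  The blocks are numbered from 1 in the order of their minimal elements: the number of a block is
  the number of blocks whose minimum is at most its own.
\<close>

definition block_index :: "nat set set \<Rightarrow> nat \<Rightarrow> nat" where
  "block_index \<pi> a = card {C \<in> \<pi>. Min C \<le> Min (block_of \<pi> a)}"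

section \<open>Classical cumulants\<close>

text \<open>
  The joint cumulant of the family \<open>(y\<^sub>i)\<close>, \<open>i \<in> B\<close>, for a finite nonempty \<open>B\<close>, by Moebius inversion
  of the moment-cumulant formula. Classical cumulants are symmetric, so no order on \<open>B\<close> is needed.
  The expectations are Bochner integrals, hence 0 if the product is not integrable.
\<close>

definition cumulant :: "'a measure \<Rightarrow> 'i set \<Rightarrow> ('i \<Rightarrow> 'a \<Rightarrow> complex) \<Rightarrow> complex" where
  "cumulant M B y =
     (\<Sum>\<pi> | partition_on B \<pi>.
        (-1) ^ (card \<pi> - 1) * fact (card \<pi> - 1) * (\<Prod>V\<in>\<pi>. \<integral>\<omega>. (\<Prod>i\<in>V. y i \<omega>) \<partial>M))"

definition cumulant_partition ::
    "'a measure \<Rightarrow> 'i set set \<Rightarrow> ('i \<Rightarrow> 'a \<Rightarrow> complex) \<Rightarrow> complex" where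
  "cumulant_partition M \<tau> y = (\<Prod>B\<in>\<tau>. cumulant M B y)"

text \<open>
  \<open>w\<close> selects the positions of the word that carry the conjugate. By symmetry of the cumulants,
  the ones that may survive are those with equally many factors of both kinds.
  That the cumulants exist means that all moments are finite.
\<close>

definition R_diagonal :: "'a measure \<Rightarrow> ('a \<Rightarrow> complex) \<Rightarrow> bool" where
  "R_diagonal M x \<longleftrightarrow>
     x \<in> borel_measurable M \<and>
     (\<forall>n. integrable M (\<lambda>\<omega>. norm (x \<omega>) ^ n)) \<and>
     (\<forall>(n::nat) w. card {i \<in> {1..n}. w i} \<noteq> card {i \<in> {1..n}. \<not> w i} \<longrightarrow>
        cumulant M {1..n} (\<lambda>i \<omega>. if w i then cnj (x \<omega>) else x \<omega>) = 0)"

definition alternating_cumulant :: "'a measure \<Rightarrow> ('a \<Rightarrow> complex) \<Rightarrow> nat \<Rightarrow> complex" where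
  "alternating_cumulant M x n = cumulant M {1..n} (\<lambda>i \<omega>. if odd i then x \<omega> else cnj (x \<omega>))"

section \<open>Complex Wigner matrices\<close>

text \<open>The normal law; for variance 0 it is the point mass, which \<^const>\<open>normal_density\<close> excludes.\<close>

definition normal_law :: "real \<Rightarrow> real \<Rightarrow> real measure" where
  "normal_law \<mu> v =
     (if v = 0 then return borel \<mu> else density lborel (\<lambda>t. ennreal (normal_density \<mu> (sqrt v) t)))"

text \<open>
  \<open>x i j\<close>, \<open>i, j \<in> {1..N}\<close>, are the entries before normalization. The cumulants \<open>\<beta> (2 * n)\<close> may be
  taken real since conjugation only permutes the arguments of the alternating cumulant; the values
  of \<open>\<beta>\<close> at odd numbers play no role. The diagonal entries are real by the symmetry condition.
\<close>

definition complex_wigner ::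
    "nat \<Rightarrow> (nat \<Rightarrow> real) \<Rightarrow> 'a measure \<Rightarrow> (nat \<Rightarrow> nat \<Rightarrow> 'a \<Rightarrow> complex) \<Rightarrow> bool" where
  "complex_wigner N \<beta> M x \<longleftrightarrow>
     prob_space M \<and>
     (\<forall>i\<in>{1..N}. \<forall>j\<in>{1..N}. \<forall>\<omega>\<in>space M. x i j \<omega> = cnj (x j i \<omega>)) \<and>
     (\<forall>i\<in>{1..N}. \<forall>j\<in>{1..N}. integrable M (x i j) \<and> (\<integral>\<omega>. x i j \<omega> \<partial>M) = 0) \<and>
     prob_space.indep_vars M (\<lambda>_. borel) (\<lambda>(i, j). x i j) {(i, j). 1 \<le> i \<and> i \<le> j \<and> j \<le> N} \<and>
     (\<forall>i j k l. 1 \<le> i \<and> i < j \<and> j \<le> N \<and> 1 \<le> k \<and> k < l \<and> l \<le> N \<longrightarrow>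
        distr M borel (x i j) = distr M borel (x k l)) \<and>
     (\<forall>i j. 1 \<le> i \<and> i < j \<and> j \<le> N \<longrightarrow>
        R_diagonal M (x i j) \<and>
        (\<forall>n\<ge>1. alternating_cumulant M (x i j) (2 * n) = complex_of_real (\<beta> (2 * n)))) \<and>
     (\<forall>i\<in>{1..N}. distr M borel (\<lambda>\<omega>. Re (x i i \<omega>)) = normal_law 0 (\<beta> 2))"

text \<open>Matrices of type \<^typ>\<open>complex mat\<close> are indexed from 0.\<close>

definition wigner_mat :: "nat \<Rightarrow> (nat \<Rightarrow> nat \<Rightarrow> 'a \<Rightarrow> complex) \<Rightarrow> 'a \<Rightarrow> complex mat" where
  "wigner_mat N x \<omega> = mat N N (\<lambda>(i, j). x (Suc i) (Suc j) \<omega> / complex_of_real (sqrt (real N)))"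

definition mat_trace :: "complex mat \<Rightarrow> complex" where
  "mat_trace A = (\<Sum>i<dim_row A. A $$ (i, i))"

definition scaled_trace_cumulant ::
    "nat \<Rightarrow> nat \<Rightarrow> (nat \<Rightarrow> nat) \<Rightarrow> 'a measure \<Rightarrow> (nat \<Rightarrow> nat \<Rightarrow> 'a \<Rightarrow> complex) \<Rightarrow> complex" where
  "scaled_trace_cumulant N r ms M x =
     of_nat N powi (int r - 2) *
     cumulant M {1..r} (\<lambda>i \<omega>. mat_trace (wigner_mat N x \<omega> ^\<^sub>m ms i))"

end

(*
  Expanding the traces turns the cumulant into a sum over index functions i on {1..m}, and the
  formula of Leonov and Shiryaev turns each summand into a sum over the partitions tau whose join
  with the cycles of gamma is the one-block partition. The cumulant of the entries over a block of
  tau is nonzero only if the block consists of edges between the same two vertices, equally many in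
  each direction, or of two loops. It depends on i only through its kernel pi, and there are
  N(N-1)...(N-#(pi)+1) index functions with kernel pi, so it remains to see that
  #(pi) <= m/2 - r + 2 whenever pi contributes. Pair off the edges in each block of tau with edges
  in the opposite direction, and glue the polygons given by the cycles of gamma along these pairs.
  If c is the number of components of the resulting surface, Euler's formula leaves at most
  m/2 - r + 2c vertices. The blocks of tau connect the components, and gluing two parallel edges,
  which are not loops, in different components identifies two pairs of vertices.
*)

theory Submission
  imports Defs
begin

section \<open>Cumulants of set functions\<close>

text \<open>Cumulants are formed for an arbitrary set function \<open>f\<close> in place of the
  moments, so that one inversion formula serves the entries, the traces and the normal law. Apart
  from multilinearity, they are accessed through a recursion: \<open>f B\<close> is the sum of
  \<open>set_cumulant f C * f (B - C)\<close> over all \<open>C\<close> between \<open>{b}\<close>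
  and \<open>B\<close>. It determines the cumulants, so the vanishing of mixed cumulants, the
  formula for products and the Gaussian cumulants each amount to checking it for a guess.

  The obstacle in counting vertices is the term 2c: each further component adds 2 to the bound, so
  every gluing that joins two components must remove two classes of vertices, not one. Loops would
  remove only one. Here the normal law of the diagonal enters: only its second cumulant can be
  nonzero, so a block of loops is a single pair and needs no further gluing.

  The weight of a kernel is expressed by \<open>\<beta>\<close> alone and is the same for every N;
  the cumulant of the traces is therefore a finite sum of constants times explicit functions of N.
  The threshold m/2 - r + 2 is the number of blocks of the leading partitions; from there on their
  block numbers are indices of actual entries.\<close>

definition set_cumulant :: "('i set \<Rightarrow> complex) \<Rightarrow> 'i set \<Rightarrow> complex" where
  "set_cumulant f B =
     (\<Sum>\<pi> | partition_on B \<pi>. (-1) ^ (card \<pi> - 1) * fact (card \<pi> - 1) * (\<Prod>V\<in>\<pi>. f V))"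

lemma cumulant_eq_set_cumulant:
  "cumulant M B y = set_cumulant (\<lambda>V. \<integral>\<omega>. (\<Prod>i\<in>V. y i \<omega>) \<partial>M) B"
  by (simp add: cumulant_def set_cumulant_def)

section \<open>Adding, removing and locating blocks of a partition\<close>

lemma partition_on_insert_block:
  assumes "partition_on (B - V) \<rho>" "V \<subseteq> B" "V \<noteq> {}"
  shows "partition_on B (insert V \<rho>)"
proof (rule partition_on_insert[THEN iffD2])
  show "disjnt V (\<Union>\<rho>)" using partition_onD1[OF assms(1)] by (auto simp: disjnt_iff)
qed (use assms in auto)

lemma partition_on_remove_block:
  assumes "partition_on B \<pi>" "V \<in> \<pi>" shows "partition_on (B - V) (\<pi> - {V})"
proof (rule partition_onI)
  show "{} \<notin> \<pi> - {V}" using partition_onD3[OF assms(1)] by auto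
  have "disjnt V p" if "p \<in> \<pi> - {V}" for p
    using that assms partition_onD2[OF assms(1)] by (auto simp: disjoint_def disjnt_def)
  then show "\<Union>(\<pi> - {V}) = B - V"
    using partition_onD1[OF assms(1)] assms(2) by (auto simp: disjnt_iff)
  show "disjnt p q" if "p \<in> \<pi> - {V}" "q \<in> \<pi> - {V}" "p \<noteq> q" for p q
    using that partition_onD2[OF assms(1)] by (auto simp: disjoint_def disjnt_def)
qed

lemma block_not_in_partition_of_complement:
  assumes "partition_on (B - V) \<rho>" "V \<noteq> {}" shows "V \<notin> \<rho>"
  using partition_onD1[OF assms(1)] assms(2) by auto

lemma partition_on_block_unique:
  assumes "partition_on B \<pi>" "V \<in> \<pi>" "W \<in> \<pi>" "b \<in> V" "b \<in> W" shows "V = W"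
  using partition_onD2[OF assms(1)] assms(2-) by (auto simp: disjoint_def)

lemma partition_on_block_ex:
  assumes "partition_on B \<pi>" "b \<in> B" shows "\<exists>V\<in>\<pi>. b \<in> V"
  using partition_onD1[OF assms(1)] assms(2) by auto

lemma partition_on_block_subset:
  assumes "partition_on B \<pi>" "V \<in> \<pi>" shows "V \<subseteq> B"
  using partition_onD1[OF assms(1)] assms(2) by auto

lemma block_of_eq:
  assumes "partition_on B \<pi>" "V \<in> \<pi>" "b \<in> V" shows "block_of \<pi> b = V"
  unfolding block_of_def
proof (rule the_equality)
  show "W = V" if "W \<in> \<pi> \<and> b \<in> W" for W
    using partition_on_block_unique[OF assms(1) _ assms(2) _ assms(3)] that by simp
qed (use assms in simp)

lemma block_of_mem:
  assumes "partition_on B \<pi>" "b \<in> B" shows "block_of \<pi> b \<in> \<pi>" "b \<in> block_of \<pi> b"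
proof -
  obtain V where "V \<in> \<pi>" "b \<in> V" using partition_on_block_ex[OF assms] by auto
  then show "block_of \<pi> b \<in> \<pi>" "b \<in> block_of \<pi> b" using block_of_eq[OF assms(1)] by simp_all
qed

text \<open>A partition is determined by the block \<open>C\<close> of a fixed point and a partition
  of the remaining points, which can be chosen freely.\<close>

lemma sum_partitions_block_of:
  fixes h :: "'i set set \<Rightarrow> 'c::comm_monoid_add"
  assumes B: "finite B" and b: "b \<in> B"
  shows "(\<Sum>\<pi> | partition_on B \<pi>. h \<pi>) =
    (\<Sum>C | b \<in> C \<and> C \<subseteq> B. \<Sum>\<rho> | partition_on (B - C) \<rho>. h (insert C \<rho>))"
proof -
  have fin: "finite {C. b \<in> C \<and> C \<subseteq> B}" using B by simp
  have "(\<Sum>C | b \<in> C \<and> C \<subseteq> B. \<Sum>\<rho> | partition_on (B - C) \<rho>. h (insert C \<rho>)) =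
    (\<Sum>(C, \<rho>) \<in> (SIGMA C:{C. b \<in> C \<and> C \<subseteq> B}. {\<rho>. partition_on (B - C) \<rho>}). h (insert C \<rho>))"
    by (rule sum.Sigma) (use fin B finitely_many_partition_on in auto)
  also have "\<dots> = (\<Sum>\<pi> | partition_on B \<pi>. h \<pi>)"
  proof (rule sum.reindex_bij_witness[where i="\<lambda>\<pi>. (block_of \<pi> b, \<pi> - {block_of \<pi> b})"
          and j="\<lambda>(C, \<rho>). insert C \<rho>"], goal_cases)
    case (1 a)
    obtain C \<rho> where a: "a = (C, \<rho>)" by force
    have C: "b \<in> C" "C \<subseteq> B" "C \<noteq> {}" "partition_on (B - C) \<rho>" using 1 a by auto
    have "block_of (insert C \<rho>) b = C"
      by (rule block_of_eq[OF partition_on_insert_block[OF C(4,2,3)]]) (use C in auto)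
    moreover have "C \<notin> \<rho>" using C block_not_in_partition_of_complement by blast
    ultimately show ?case using a by simp
  next
    case (2 a)
    then show ?case by (auto intro!: partition_on_insert_block)
  next
    case (3 \<pi>)
    then show ?case using block_of_mem[OF _ b, of \<pi>] by (simp add: insert_absorb)
  next
    case (4 \<pi>)
    then have "partition_on B \<pi>" by simp
    from block_of_mem[OF this b] this show ?case
      by (auto intro: partition_on_remove_block dest: partition_on_block_subset)
  qed auto
  finally show ?thesis by simp
qed

text \<open>Removing the marked block \<open>V\<close> leaves a partition of the proper subset
  \<open>C = B - V\<close>, which still contains \<open>b\<close>. Counting such pairs in two ways
  is the heart of the cumulant recursion.\<close>

lemma sum_partitions_other_block:
  fixes h :: "'i set set \<Rightarrow> 'i set \<Rightarrow> 'c::comm_monoid_add"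
  assumes B: "finite B" and b: "b \<in> B"
  shows "(\<Sum>\<pi> | partition_on B \<pi>. \<Sum>V | V \<in> \<pi> \<and> b \<notin> V. h \<pi> V) =
    (\<Sum>C | b \<in> C \<and> C \<subset> B. \<Sum>\<rho> | partition_on C \<rho>. h (insert (B - C) \<rho>) (B - C))"
proof -
  have fin: "finite {C. b \<in> C \<and> C \<subset> B}"
    by (rule finite_subset[of _ "Pow B"]) (use B in auto)
  have finC: "finite C" if "C \<subset> B" for C
    using finite_subset[OF psubset_imp_subset[OF that] B] .
  have finV: "finite \<pi>" if "partition_on B \<pi>" for \<pi>
    using finite_elements[OF B that] .
  have "(\<Sum>C | b \<in> C \<and> C \<subset> B. \<Sum>\<rho> | partition_on C \<rho>. h (insert (B - C) \<rho>) (B - C)) =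
    (\<Sum>(C, \<rho>) \<in> (SIGMA C:{C. b \<in> C \<and> C \<subset> B}. {\<rho>. partition_on C \<rho>}). h (insert (B - C) \<rho>) (B - C))"
    by (rule sum.Sigma) (use fin finC finitely_many_partition_on in auto)
  also have "\<dots> = (\<Sum>(\<pi>, V) \<in> (SIGMA \<pi>:{\<pi>. partition_on B \<pi>}. {V. V \<in> \<pi> \<and> b \<notin> V}). h \<pi> V)"
  proof (rule sum.reindex_bij_witness[where i="\<lambda>(\<pi>, V). (B - V, \<pi> - {V})"
          and j="\<lambda>(C, \<rho>). (insert (B - C) \<rho>, B - C)"], goal_cases)
    case (1 a)
    obtain C \<rho> where a: "a = (C, \<rho>)" by force
    have C: "C \<subset> B" "partition_on C \<rho>" using 1 a by auto
    have eq: "B - (B - C) = C" using C by auto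
    have "B - C \<notin> \<rho>"
      using block_not_in_partition_of_complement[of B "B - C" \<rho>] C eq by auto
    then show ?case using a eq by simp
  next
    case (2 a)
    obtain C \<rho> where a: "a = (C, \<rho>)" by force
    have C: "b \<in> C" "C \<subset> B" "partition_on C \<rho>" using 2 a by auto
    have "B - (B - C) = C" using C by auto
    then have "partition_on B (insert (B - C) \<rho>)"
      using C by (intro partition_on_insert_block) auto
    then show ?case using a C by simp
  next
    case (3 a)
    obtain \<pi> V where a: "a = (\<pi>, V)" by force
    have V: "V \<in> \<pi>" "V \<subseteq> B" using 3 a partition_on_block_subset by auto
    have "B - (B - V) = V" using V by auto
    then show ?case using a V by (simp add: insert_absorb)
  next
    case (4 a)
    obtain \<pi> V where a: "a = (\<pi>, V)" by force
    have V: "V \<in> \<pi>" "b \<notin> V" "partition_on B \<pi>" using 4 a by auto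
    have V': "V \<subseteq> B" "V \<noteq> {}"
      using V partition_on_block_subset partition_onD3 by blast+
    have "partition_on (B - V) (\<pi> - {V})" using V partition_on_remove_block by blast
    then show ?case using a V V' b by auto
  qed auto
  also have "\<dots> = (\<Sum>\<pi> | partition_on B \<pi>. \<Sum>V | V \<in> \<pi> \<and> b \<notin> V. h \<pi> V)"
    by (rule sum.Sigma[symmetric]) (use B finitely_many_partition_on finV in auto)
  finally show ?thesis by simp
qed

text \<open>In the terms with \<open>C \<noteq> B\<close>, a partition of \<open>C\<close> together
  with \<open>B - C\<close> is a partition \<open>\<pi>\<close> of \<open>B\<close> with a marked
  block that avoids \<open>b\<close>. There are \<open>card \<pi> - 1\<close> such marks, each with
  the coefficient of a partition with one block less; together they cancel the term of
  \<open>\<pi>\<close> in \<open>set_cumulant f B\<close>. Only \<open>\<pi> = {B}\<close>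
  survives.\<close>

lemma set_cumulant_recursion:
  assumes B: "finite B" and b: "b \<in> B" and f0: "f {} = 1"
  shows "f B = (\<Sum>C | b \<in> C \<and> C \<subseteq> B. set_cumulant f C * f (B - C))"
proof -
  define \<mu> :: "'a set set \<Rightarrow> complex" where
    "\<mu> \<pi> = (-1) ^ (card \<pi> - 1) * fact (card \<pi> - 1)" for \<pi>
  define F where "F \<pi> = (\<Prod>V\<in>\<pi>. f V)" for \<pi>
  have cum: "set_cumulant f C = (\<Sum>\<pi> | partition_on C \<pi>. \<mu> \<pi> * F \<pi>)" for C
    by (simp add: set_cumulant_def \<mu>_def F_def)
  have fin: "finite {C. b \<in> C \<and> C \<subset> B}"
    by (rule finite_subset[of _ "Pow B"]) (use B in auto)
  have split: "{C. b \<in> C \<and> C \<subseteq> B} = insert B {C. b \<in> C \<and> C \<subset> B}"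
    using b by auto
  have "(\<Sum>C | b \<in> C \<and> C \<subset> B. set_cumulant f C * f (B - C)) =
     (\<Sum>C | b \<in> C \<and> C \<subset> B. \<Sum>\<rho> | partition_on C \<rho>. \<mu> (insert (B - C) \<rho> - {B - C}) * F (insert (B - C) \<rho>))"
    unfolding cum sum_distrib_right
  proof (intro sum.cong refl, goal_cases)
    case (1 C \<rho>)
    then have C: "C \<subset> B" and \<rho>: "partition_on C \<rho>" by auto
    have eq: "B - (B - C) = C" using C by auto
    have ne: "B - C \<notin> \<rho>"
      using block_not_in_partition_of_complement[of B "B - C" \<rho>] \<rho> C eq by auto
    have "finite \<rho>" using finite_elements[OF finite_subset[OF psubset_imp_subset[OF C] B] \<rho>] .
    then show ?case using ne by (simp add: F_def mult_ac)
  qed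
  also have "\<dots> = (\<Sum>\<pi> | partition_on B \<pi>. \<Sum>V | V \<in> \<pi> \<and> b \<notin> V. \<mu> (\<pi> - {V}) * F \<pi>)"
    by (rule sum_partitions_other_block[OF B b, symmetric])
  also have "\<dots> = (\<Sum>\<pi> | partition_on B \<pi>. (if \<pi> = {B} then 0 else - \<mu> \<pi> * F \<pi>))"
  proof (intro sum.cong refl, goal_cases)
    case (1 \<pi>)
    then have \<pi>: "partition_on B \<pi>" by simp
    have fin\<pi>: "finite \<pi>" using finite_elements[OF B \<pi>] .
    note bl = block_of_mem[OF \<pi> b]
    have "b \<notin> V \<longleftrightarrow> V \<noteq> block_of \<pi> b" if "V \<in> \<pi>" for V
      using bl(2) partition_on_block_unique[OF \<pi> that bl(1) _ bl(2)] by metis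
    then have eq: "{V. V \<in> \<pi> \<and> b \<notin> V} = \<pi> - {block_of \<pi> b}" by auto
    have "(\<Sum>V | V \<in> \<pi> \<and> b \<notin> V. \<mu> (\<pi> - {V}) * F \<pi>) =
        (\<Sum>V | V \<in> \<pi> \<and> b \<notin> V. (-1) ^ (card \<pi> - 2) * fact (card \<pi> - 2) * F \<pi>)"
      by (intro sum.cong refl) (use fin\<pi> in \<open>simp add: \<mu>_def numeral_2_eq_2\<close>)
    also have "\<dots> = of_nat (card \<pi> - 1) * ((-1) ^ (card \<pi> - 2) * fact (card \<pi> - 2) * F \<pi>)"
      unfolding eq using bl fin\<pi> by simp
    \<comment> \<open>With n blocks, (n - 1) times (-1)^(n-2) (n-2)! is minus the Moebius
      coefficient of \<open>\<pi>\<close>. For n = 1 the exponent is truncated, but then the factor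
      n - 1 vanishes.\<close>
    also have "\<dots> = (if \<pi> = {B} then 0 else - \<mu> \<pi> * F \<pi>)"
    proof (cases "card \<pi> \<ge> 2")
      case True
      then obtain n where n: "card \<pi> = n + 2" by (metis le_add_diff_inverse2)
      have "\<pi> \<noteq> {B}" using True by auto
      then show ?thesis using n by (simp add: \<mu>_def)
    next
      case False
      have "card \<pi> = 1" using False bl fin\<pi> by (cases "card \<pi>") auto
      then obtain V where "\<pi> = {V}" by (auto simp: card_1_singleton_iff)
      then have "\<pi> = {B}" using \<pi> by (auto simp: partition_on_def)
      then show ?thesis by simp
    qed
    finally show ?case .
  qed
  finally have 1: "(\<Sum>C | b \<in> C \<and> C \<subset> B. set_cumulant f C * f (B - C)) =
    (\<Sum>\<pi> | partition_on B \<pi>. (if \<pi> = {B} then 0 else - \<mu> \<pi> * F \<pi>))" .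
  have "(\<Sum>C | b \<in> C \<and> C \<subseteq> B. set_cumulant f C * f (B - C)) =
      set_cumulant f B + (\<Sum>C | b \<in> C \<and> C \<subset> B. set_cumulant f C * f (B - C))"
    unfolding split using fin f0 by (subst sum.insert) auto
  also have "\<dots> = (\<Sum>\<pi> | partition_on B \<pi>. (if \<pi> = {B} then \<mu> \<pi> * F \<pi> else 0))"
    unfolding 1 unfolding cum sum.distrib[symmetric] by (intro sum.cong) auto
  also have "\<dots> = f B"
  proof -
    have "partition_on B {B}" using b by (intro partition_on_space) auto
    then show ?thesis
      using finitely_many_partition_on[OF B] by (subst sum.delta) (auto simp: \<mu>_def F_def)
  qed
  finally show ?thesis by simp
qed

text \<open>Since \<open>f {} = 1\<close>, the term \<open>C = B\<close> of the recursion is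
  \<open>k B\<close> itself and all others involve smaller sets, so induction applies. The point
  \<open>b\<close> may depend on \<open>B\<close>, because the recursion for
  \<open>set_cumulant\<close> holds at every point.\<close>

lemma set_cumulant_unique:
  assumes A: "finite A" and f0: "f {} = 1"
    and rec: "\<And>B. B \<subseteq> A \<Longrightarrow> B \<noteq> {} \<Longrightarrow>
      \<exists>b\<in>B. f B = (\<Sum>C | b \<in> C \<and> C \<subseteq> B. k C * f (B - C))"
    and B: "B \<subseteq> A" "B \<noteq> {}"
  shows "set_cumulant f B = k B"
  using finite_subset[OF B(1) A] B
proof (induction B rule: finite_psubset_induct)
  case (psubset B)
  obtain b where b: "b \<in> B" and fB: "f B = (\<Sum>C | b \<in> C \<and> C \<subseteq> B. k C * f (B - C))"
    using rec[OF psubset.prems] by auto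
  have fin: "finite {C. b \<in> C \<and> C \<subset> B}"
    by (rule finite_subset[of _ "Pow B"]) (use psubset.hyps in auto)
  have split: "{C. b \<in> C \<and> C \<subseteq> B} = insert B {C. b \<in> C \<and> C \<subset> B}"
    using b by auto
  have "set_cumulant f B + (\<Sum>C | b \<in> C \<and> C \<subset> B. set_cumulant f C * f (B - C)) = f B"
    using set_cumulant_recursion[OF psubset.hyps(1) b, of f, OF f0] fin f0 unfolding split
    by (subst (asm) sum.insert) auto
  also have "f B = k B + (\<Sum>C | b \<in> C \<and> C \<subset> B. k C * f (B - C))"
    using fB f0 fin unfolding split by (subst (asm) sum.insert) auto
  also have "(\<Sum>C | b \<in> C \<and> C \<subset> B. k C * f (B - C)) =
      (\<Sum>C | b \<in> C \<and> C \<subset> B. set_cumulant f C * f (B - C))"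
  proof (intro sum.cong refl, goal_cases)
    case (1 C)
    then have "C \<subset> B" "C \<subseteq> A" "C \<noteq> {}" using psubset.prems by auto
    from psubset.IH[OF this] show ?case by simp
  qed
  finally show ?case by simp
qed

text \<open>Splitting off the block of a fixed point turns the sum over partitions into the
  recursion, the moment of the complement being known by induction.\<close>

lemma moment_eq_sum_cumulants:
  assumes B: "finite B" and f0: "f {} = 1"
  shows "f B = (\<Sum>\<pi> | partition_on B \<pi>. \<Prod>V\<in>\<pi>. set_cumulant f V)"
  using B
proof (induction B rule: finite_psubset_induct)
  case (psubset B)
  show ?case
  proof (cases "B = {}")
    case True
    then show ?thesis by (simp add: partition_on_empty f0)
  next
    case False
    then obtain b where b: "b \<in> B" by auto
    have "f B = (\<Sum>C | b \<in> C \<and> C \<subseteq> B. set_cumulant f C * f (B - C))"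
      by (rule set_cumulant_recursion[OF psubset.hyps(1) b, of f, OF f0])
    also have "\<dots> = (\<Sum>C | b \<in> C \<and> C \<subseteq> B. \<Sum>\<rho> | partition_on (B - C) \<rho>. \<Prod>V\<in>insert C \<rho>. set_cumulant f V)"
    proof (intro sum.cong refl, goal_cases)
      case (1 C)
      then have C: "b \<in> C" "C \<subseteq> B" by auto
      then have "B - C \<subset> B" using b by auto
      note IH = psubset.IH[OF this]
      show ?case unfolding IH sum_distrib_left
      proof (intro sum.cong refl, goal_cases)
        case (1 \<rho>)
        then have "C \<notin> \<rho>" using C block_not_in_partition_of_complement by blast
        moreover have "finite \<rho>" using 1 psubset.hyps(1) by (auto intro: finite_elements)
        ultimately show ?case by simp
      qed
    qed
    also have "\<dots> = (\<Sum>\<pi> | partition_on B \<pi>. \<Prod>V\<in>\<pi>. set_cumulant f V)"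
      by (rule sum_partitions_block_of[OF psubset.hyps(1) b, symmetric])
    finally show ?thesis .
  qed
qed

text \<open>The guess \<open>k\<close> is 0 on sets that meet both \<open>S\<close> and its
  complement. In the recursion at \<open>b\<close> only sets on the side \<open>T\<close> of
  \<open>b\<close> contribute; the moment of the other side factors out, and what remains is the
  recursion for \<open>T\<close>.\<close>

lemma set_cumulant_mixed_eq_0:
  assumes A: "finite A" and f0: "f {} = 1"
    and mult: "\<And>V. V \<subseteq> A \<Longrightarrow> f V = f (V \<inter> S) * f (V - S)"
    and ne: "A \<inter> S \<noteq> {}" "A - S \<noteq> {}"
  shows "set_cumulant f A = 0"
proof -
  define k where "k D = (if D \<subseteq> S \<or> D \<inter> S = {} then set_cumulant f D else 0)" for D
  have "set_cumulant f A = k A"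
  proof (rule set_cumulant_unique[where A=A and f=f and k=k], goal_cases)
    case (3 B)
    have finB: "finite B" using finite_subset[OF 3(1) A] .
    obtain b where b: "b \<in> B" using 3 by auto
    define T where "T = (if b \<in> S then B \<inter> S else B - S)"
    have T: "b \<in> T" "T \<subseteq> B" using b by (auto simp: T_def)
    have fsplit: "f (B - D) = f (T - D) * f (B - T)" if "D \<subseteq> T" for D
    proof -
      have "f (B - D) = f ((B - D) \<inter> S) * f ((B - D) - S)"
        using 3 by (intro mult) auto
      also have "\<dots> = f (T - D) * f (B - T)"
      proof (cases "b \<in> S")
        case True
        then have "(B - D) \<inter> S = T - D" "(B - D) - S = B - T" using that by (auto simp: T_def)
        then show ?thesis by simp
      next
        case False
        then have "(B - D) \<inter> S = B - T" "(B - D) - S = T - D" using that by (auto simp: T_def)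
        then show ?thesis by simp
      qed
      finally show ?thesis .
    qed
    have fin: "finite {C. b \<in> C \<and> C \<subseteq> B}" using finB by auto
    have "(\<Sum>C | b \<in> C \<and> C \<subseteq> B. k C * f (B - C)) = (\<Sum>C | b \<in> C \<and> C \<subseteq> T. k C * f (B - C))"
      by (rule sum.mono_neutral_right[OF fin])
        (use T b in \<open>auto simp: k_def T_def split: if_splits\<close>)
    also have "\<dots> = (\<Sum>C | b \<in> C \<and> C \<subseteq> T. set_cumulant f C * f (T - C)) * f (B - T)"
      unfolding sum_distrib_right
    proof (intro sum.cong refl, goal_cases)
      case (1 C)
      then have C: "C \<subseteq> T" by simp
      then have "k C = set_cumulant f C" by (auto simp: k_def T_def split: if_splits)
      then show ?case using fsplit[OF C] by simp
    qed
    also have "\<dots> = f T * f (B - T)"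
      using set_cumulant_recursion[OF finite_subset[OF T(2) finB] T(1), of f, OF f0] by simp
    also have "\<dots> = f B" using fsplit[of "{}"] by simp
    finally show ?case using b by (intro bexI[of _ b]) auto
  qed (use A f0 ne in auto)
  also have "k A = 0" using ne by (auto simp: k_def)
  finally show ?thesis .
qed

lemma set_cumulant_cong:
  assumes "\<And>V. V \<subseteq> B \<Longrightarrow> f V = g V"
  shows "set_cumulant f B = set_cumulant g B"
  unfolding set_cumulant_def
proof (intro sum.cong refl arg_cong2[where f="(*)"] prod.cong, goal_cases)
  case (1 \<pi> V)
  then show ?case using assms partition_on_block_subset[of B \<pi> V] by simp
qed

text \<open>Uniqueness reduces this to transporting the subsets that contain \<open>b\<close>, so no
  bijection between the partitions of the two sets has to be constructed.\<close>

lemma set_cumulant_reindex: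
  assumes A: "finite A" and h: "inj_on h A" and f0: "f {} = 1" and ne: "A \<noteq> {}"
  shows "set_cumulant f (h ` A) = set_cumulant (\<lambda>V. f (h ` V)) A"
proof (rule sym, rule set_cumulant_unique[OF A _ _ order_refl ne, where k="\<lambda>V. set_cumulant f (h ` V)"], goal_cases)
  case 1
  then show ?case using f0 by simp
next
  case (2 B)
  then obtain b where b: "b \<in> B" by auto
  have inj: "inj_on h B" using inj_on_subset[OF h 2(1)] .
  have finB: "finite B" using finite_subset[OF 2(1) A] .
  have "f (h ` B) = (\<Sum>C | h b \<in> C \<and> C \<subseteq> h ` B. set_cumulant f C * f (h ` B - C))"
    by (rule set_cumulant_recursion) (use b finB f0 in auto)
  also have "\<dots> = (\<Sum>C | b \<in> C \<and> C \<subseteq> B. set_cumulant f (h ` C) * f (h ` (B - C)))"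
  proof (rule sum.reindex_bij_witness[where i="\<lambda>C. h ` C" and j="\<lambda>C. {x\<in>B. h x \<in> C}"], goal_cases)
    case (3 C)
    then show ?case using inj by (auto dest: inj_onD)
  next
    case (5 C)
    have "h ` {x \<in> B. h x \<in> C} = C" using 5 by auto
    moreover have "h ` (B - {x \<in> B. h x \<in> C}) = h ` B - C" by auto
    ultimately show ?case by simp
  qed (use b in auto)
  finally show ?case using b by blast
qed

section \<open>Products as entries of cumulants\<close>

text \<open>For a partition into the sets \<open>W k\<close>, this says that the join of \<open>\<tau>\<close> with it is the one-block partition.\<close>

definition links :: "('k \<Rightarrow> 'a set) \<Rightarrow> 'k set \<Rightarrow> 'a set set \<Rightarrow> bool" where
  "links W K \<tau> \<longleftrightarrow>
     (\<forall>T\<subseteq>K. (\<forall>B\<in>\<tau>. B \<subseteq> \<Union>(W ` T) \<or> B \<inter> \<Union>(W ` T) = {}) \<longrightarrow> T = {} \<or> T = K)"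

lemma partition_on_Un:
  assumes P: "partition_on A P" and Q: "partition_on B Q" and AB: "A \<inter> B = {}"
  shows "partition_on (A \<union> B) (P \<union> Q)"
proof (rule partition_onI)
  show "\<Union>(P \<union> Q) = A \<union> B" using partition_onD1[OF P] partition_onD1[OF Q] by simp
  show "{} \<notin> P \<union> Q" using partition_onD3[OF P] partition_onD3[OF Q] by simp
  have PQ: "disjnt p q" if "p \<in> P" "q \<in> Q" for p q
    using partition_on_block_subset[OF P that(1)] partition_on_block_subset[OF Q that(2)] AB
    unfolding disjnt_def by fast
  show "disjnt p q" if "p \<in> P \<union> Q" "q \<in> P \<union> Q" "p \<noteq> q" for p q
  proof -
    consider "p \<in> P" "q \<in> P" | "p \<in> Q" "q \<in> Q" | "p \<in> P" "q \<in> Q" | "q \<in> P" "p \<in> Q"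
      using \<open>p \<in> P \<union> Q\<close> \<open>q \<in> P \<union> Q\<close> by fast
    then show ?thesis
    proof cases
      case 1
      then show ?thesis using partition_onD2[OF P] \<open>p \<noteq> q\<close> by (simp add: disjoint_def disjnt_def)
    next
      case 2
      then show ?thesis using partition_onD2[OF Q] \<open>p \<noteq> q\<close> by (simp add: disjoint_def disjnt_def)
    qed (use PQ in \<open>simp_all add: disjnt_sym\<close>)
  qed
qed

lemma partition_on_Un_parts:
  assumes P: "partition_on A P" and Q: "partition_on B Q" and AB: "A \<inter> B = {}"
  shows "P \<inter> Q = {}" "{C \<in> P \<union> Q. C \<subseteq> A} = P" "{C \<in> P \<union> Q. \<not> C \<subseteq> A} = Q"
proof -
  have "C \<subseteq> A" if "C \<in> P" for C using partition_on_block_subset[OF P that] .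
  moreover have "\<not> C \<subseteq> A" if "C \<in> Q" for C
    using partition_on_block_subset[OF Q that] partition_onD3[OF Q] that AB by (metis Int_absorb1 Int_greatest subset_empty)
  ultimately show "P \<inter> Q = {}" "{C \<in> P \<union> Q. C \<subseteq> A} = P" "{C \<in> P \<union> Q. \<not> C \<subseteq> A} = Q"
    by fast+
qed

lemma partition_on_split:
  assumes \<tau>: "partition_on A \<tau>" and X: "X \<subseteq> A" and sat: "\<And>B. B \<in> \<tau> \<Longrightarrow> B \<subseteq> X \<or> B \<inter> X = {}"
  shows "partition_on X {B \<in> \<tau>. B \<subseteq> X}" "partition_on (A - X) {B \<in> \<tau>. \<not> B \<subseteq> X}"
proof -
  have d: "disjnt p q" if "p \<in> \<tau>" "q \<in> \<tau>" "p \<noteq> q" for p q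
    using partition_onD2[OF \<tau>] that by (simp add: disjoint_def disjnt_def)
  show "partition_on X {B \<in> \<tau>. B \<subseteq> X}"
  proof (rule partition_onI)
    have "\<exists>B\<in>\<tau>. B \<subseteq> X \<and> x \<in> B" if x: "x \<in> X" for x
    proof -
      obtain B where "B \<in> \<tau>" "x \<in> B" using partition_on_block_ex[OF \<tau>, of x] X x by auto
      then show ?thesis using sat[of B] x by auto
    qed
    then show "\<Union>{B \<in> \<tau>. B \<subseteq> X} = X" by auto
  qed (use d partition_onD3[OF \<tau>] in auto)
  show "partition_on (A - X) {B \<in> \<tau>. \<not> B \<subseteq> X}"
  proof (rule partition_onI)
    have "\<exists>B\<in>\<tau>. \<not> B \<subseteq> X \<and> x \<in> B" if x: "x \<in> A - X" for x
    proof -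
      obtain B where "B \<in> \<tau>" "x \<in> B" using partition_on_block_ex[OF \<tau>, of x] x by auto
      then show ?thesis using x by auto
    qed
    moreover have "B \<subseteq> A - X" if "B \<in> \<tau>" "\<not> B \<subseteq> X" for B
      using sat[OF that(1)] that partition_on_block_subset[OF \<tau> that(1)] by auto
    ultimately show "\<Union>{B \<in> \<tau>. \<not> B \<subseteq> X} = A - X" by fast
  qed (use d partition_onD3[OF \<tau>] in auto)
qed

text \<open>\<open>comp \<tau>\<close> is the connected component of \<open>b\<close> when the
  indices are joined by the blocks of \<open>\<tau>\<close>. The blocks inside its part form a
  linking partition, the others an arbitrary partition of the rest.\<close>

lemma sum_partitions_component:
  fixes h :: "'a set \<Rightarrow> complex"
  assumes S: "finite S" and W: "\<And>k. k \<in> S \<Longrightarrow> finite (W k)" and disj: "disjoint_family_on W S"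
    and b: "b \<in> S"
  shows "(\<Sum>\<tau> | partition_on (\<Union>(W ` S)) \<tau>. \<Prod>B\<in>\<tau>. h B) =
    (\<Sum>T | b \<in> T \<and> T \<subseteq> S. (\<Sum>\<tau> | partition_on (\<Union>(W ` T)) \<tau> \<and> links W T \<tau>. \<Prod>B\<in>\<tau>. h B) *
       (\<Sum>\<tau> | partition_on (\<Union>(W ` (S - T))) \<tau>. \<Prod>B\<in>\<tau>. h B))"
proof -
  define U where "U T = \<Union>(W ` T)" for T
  have finU: "finite (U T)" if "T \<subseteq> S" for T
    using that S W finite_subset[OF that S] by (auto simp: U_def)
  have U_Int: "U T \<inter> U T' = U (T \<inter> T')" if "T \<subseteq> S" "T' \<subseteq> S" for T T'
    using that disj unfolding U_def disjoint_family_on_def by fastforce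
  have U_diff: "U (S - T) = U S - U T" if "T \<subseteq> S" for T
    using that disj unfolding U_def disjoint_family_on_def by fastforce
  have U_sub: "U T \<subseteq> U S" if "T \<subseteq> S" for T using that by (auto simp: U_def)
  \<comment> \<open>No block of \<open>\<tau>\<close> crosses the boundary of the part indexed by
    \<open>T\<close>. Such sets \<open>T\<close> are closed under intersection and difference, so
    there is a least one containing \<open>b\<close>.\<close>
  define sat where "sat \<tau> T \<longleftrightarrow> (\<forall>B\<in>\<tau>. B \<subseteq> U T \<or> B \<inter> U T = {})" for \<tau> T
  define P where "P = {T. b \<in> T \<and> T \<subseteq> S}"
  define I where "I T = {\<tau>. partition_on (U T) \<tau> \<and> links W T \<tau>}" for T
  define J where "J T = {\<tau>. partition_on (U (S - T)) \<tau>}" for T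
  have finP: "finite P" using S by (auto simp: P_def)
  have finI: "finite (I T)" if "T \<subseteq> S" for T
    using finite_subset[OF _ finitely_many_partition_on[OF finU[OF that]], of "I T"] by (auto simp: I_def)
  have finJ: "finite (J T)" for T
    unfolding J_def by (intro finitely_many_partition_on finU) auto
  define comp where "comp \<tau> = \<Inter>{T. b \<in> T \<and> T \<subseteq> S \<and> sat \<tau> T}" for \<tau>
  have links_iff: "links W T \<tau> \<longleftrightarrow> (\<forall>T'\<subseteq>T. sat \<tau> T' \<longrightarrow> T' = {} \<or> T' = T)" for T \<tau>
    by (auto simp: links_def sat_def U_def)
  have satS: "sat \<tau> S" if "partition_on (U S) \<tau>" for \<tau>
    using partition_on_block_subset[OF that] by (auto simp: sat_def)
  have sat_Int: "sat \<tau> (T \<inter> T')" if "sat \<tau> T" "sat \<tau> T'" "T \<subseteq> S" "T' \<subseteq> S" for \<tau> T T'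
    using that(1,2) U_Int[OF that(3,4)] unfolding sat_def by blast
  have sat_Diff: "sat \<tau> (T - T')"
    if "sat \<tau> T" "sat \<tau> T'" "T \<subseteq> S" "T' \<subseteq> S" for \<tau> T T'
  proof -
    have "U (T - T') = U T - U T'"
      using that(3,4) disj unfolding U_def disjoint_family_on_def by fastforce
    then show ?thesis using that(1,2) unfolding sat_def by blast
  qed
  have comp: "b \<in> comp \<tau>" "comp \<tau> \<subseteq> S" "sat \<tau> (comp \<tau>)"
    "\<And>T. b \<in> T \<Longrightarrow> T \<subseteq> S \<Longrightarrow> sat \<tau> T \<Longrightarrow> comp \<tau> \<subseteq> T"
    if \<tau>: "partition_on (U S) \<tau>" for \<tau>
  proof -
    define F where "F = {T. b \<in> T \<and> T \<subseteq> S \<and> sat \<tau> T}"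
    have "finite F" using S by (auto simp: F_def)
    moreover have "F \<noteq> {}" using satS[OF \<tau>] b by (auto simp: F_def)
    moreover have "\<Inter>G \<in> F" if "finite G" "G \<noteq> {}" "G \<subseteq> F" for G
      using that
    proof (induction G rule: finite_ne_induct)
      case (insert T G)
      then show ?case using sat_Int[of \<tau> T "\<Inter>G"] by (auto simp: F_def)
    qed auto
    ultimately have "comp \<tau> \<in> F" unfolding comp_def F_def[symmetric] by blast
    then show "b \<in> comp \<tau>" "comp \<tau> \<subseteq> S" "sat \<tau> (comp \<tau>)" by (auto simp: F_def)
    show "\<And>T. b \<in> T \<Longrightarrow> T \<subseteq> S \<Longrightarrow> sat \<tau> T \<Longrightarrow> comp \<tau> \<subseteq> T" by (auto simp: comp_def)
  qed
  have un: "partition_on (U S) (\<tau>1 \<union> \<tau>2)" "comp (\<tau>1 \<union> \<tau>2) = T" "\<tau>1 \<inter> \<tau>2 = {}"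
    "{B \<in> \<tau>1 \<union> \<tau>2. B \<subseteq> U T} = \<tau>1" "{B \<in> \<tau>1 \<union> \<tau>2. \<not> B \<subseteq> U T} = \<tau>2"
    if T: "T \<in> P" and \<tau>1: "\<tau>1 \<in> I T" and \<tau>2: "\<tau>2 \<in> J T" for T \<tau>1 \<tau>2
  proof -
    have T': "b \<in> T" "T \<subseteq> S" using T by (auto simp: P_def)
    have p1: "partition_on (U T) \<tau>1" and l1: "links W T \<tau>1" using \<tau>1 by (auto simp: I_def)
    have p2: "partition_on (U S - U T) \<tau>2" using \<tau>2 U_diff[OF T'(2)] by (auto simp: J_def)
    have US: "U T \<union> (U S - U T) = U S" using U_sub[OF T'(2)] by auto
    show p: "partition_on (U S) (\<tau>1 \<union> \<tau>2)"
      using partition_on_Un[OF p1 p2] US by simp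
    show "\<tau>1 \<inter> \<tau>2 = {}" "{B \<in> \<tau>1 \<union> \<tau>2. B \<subseteq> U T} = \<tau>1" "{B \<in> \<tau>1 \<union> \<tau>2. \<not> B \<subseteq> U T} = \<tau>2"
      by (rule partition_on_Un_parts[OF p1 p2], simp)+
    have "B \<subseteq> U T \<or> B \<inter> U T = {}" if "B \<in> \<tau>1 \<union> \<tau>2" for B
    proof (cases "B \<in> \<tau>1")
      case True
      then show ?thesis using partition_on_block_subset[OF p1] by simp
    next
      case False
      then have "B \<subseteq> U S - U T" using partition_on_block_subset[OF p2] that by simp
      then show ?thesis by auto
    qed
    then have "sat (\<tau>1 \<union> \<tau>2) T" by (simp add: sat_def)
    then have sub: "comp (\<tau>1 \<union> \<tau>2) \<subseteq> T" using comp(4)[OF p T'] by simp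
    \<comment> \<open>The component is nonempty and also saturated for \<open>\<tau>1\<close>, which
      links \<open>T\<close>, so it cannot be a proper subset of \<open>T\<close>.\<close>
    have "sat \<tau>1 (comp (\<tau>1 \<union> \<tau>2))" using comp(3)[OF p] by (simp add: sat_def)
    then show "comp (\<tau>1 \<union> \<tau>2) = T" using l1 sub comp(1)[OF p] unfolding links_iff by (metis empty_iff)
  qed
  have parts: "comp \<tau> \<in> P" "{B \<in> \<tau>. B \<subseteq> U (comp \<tau>)} \<in> I (comp \<tau>)" "{B \<in> \<tau>. \<not> B \<subseteq> U (comp \<tau>)} \<in> J (comp \<tau>)"
    if \<tau>: "partition_on (U S) \<tau>" for \<tau>
  proof -
    note c = comp[OF \<tau>]
    show "comp \<tau> \<in> P" using c by (auto simp: P_def)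
    have cs: "B \<subseteq> U (comp \<tau>) \<or> B \<inter> U (comp \<tau>) = {}" if "B \<in> \<tau>" for B
      using c(3) that by (auto simp: sat_def)
    have p1: "partition_on (U (comp \<tau>)) {B \<in> \<tau>. B \<subseteq> U (comp \<tau>)}"
      by (rule partition_on_split[OF \<tau> U_sub[OF c(2)] cs])
    show "{B \<in> \<tau>. \<not> B \<subseteq> U (comp \<tau>)} \<in> J (comp \<tau>)"
      using partition_on_split(2)[OF \<tau> U_sub[OF c(2)] cs] U_diff[OF c(2)] by (simp add: J_def)
    have "T = {} \<or> T = comp \<tau>" if T: "T \<subseteq> comp \<tau>" "sat {B \<in> \<tau>. B \<subseteq> U (comp \<tau>)} T" for T
    proof -
      have UT: "U T \<subseteq> U (comp \<tau>)" using T by (auto simp: U_def)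
      have s: "sat \<tau> T" unfolding sat_def
      proof
        fix B assume "B \<in> \<tau>"
        then show "B \<subseteq> U T \<or> B \<inter> U T = {}" using T(2) UT cs[of B] unfolding sat_def by auto
      qed
      have TS: "T \<subseteq> S" using T c by auto
      show ?thesis
      proof (cases "b \<in> T")
        case True
        then show ?thesis using c(4)[OF True TS s] T by auto
      next
        case False
        \<comment> \<open>Without \<open>b\<close> in \<open>T\<close>, the difference is saturated
          and contains \<open>b\<close>. By minimality it is the whole component, hence
          \<open>T\<close> is empty.\<close>
        have "comp \<tau> \<subseteq> comp \<tau> - T"
          by (rule c(4)) (use False c sat_Diff[OF c(3) s c(2) TS] in auto)
        then show ?thesis using T by auto
      qed
    qed
    then show "{B \<in> \<tau>. B \<subseteq> U (comp \<tau>)} \<in> I (comp \<tau>)"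
      using p1 by (auto simp: I_def links_iff)
  qed
  have "(\<Sum>T\<in>P. (\<Sum>\<tau>\<in>I T. \<Prod>B\<in>\<tau>. h B) * (\<Sum>\<tau>\<in>J T. \<Prod>B\<in>\<tau>. h B)) =
     (\<Sum>T\<in>P. \<Sum>(\<tau>1, \<tau>2)\<in>I T \<times> J T. (\<Prod>B\<in>\<tau>1. h B) * (\<Prod>B\<in>\<tau>2. h B))"
    by (simp add: sum_product sum.cartesian_product)
  also have "\<dots> = (\<Sum>(T, \<tau>1, \<tau>2)\<in>(SIGMA T:P. I T \<times> J T). (\<Prod>B\<in>\<tau>1. h B) * (\<Prod>B\<in>\<tau>2. h B))"
    by (subst sum.Sigma) (use finP finI finJ in \<open>auto simp: P_def split_def\<close>)
  also have "\<dots> = (\<Sum>\<tau> | partition_on (U S) \<tau>. \<Prod>B\<in>\<tau>. h B)"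
  proof (rule sum.reindex_bij_witness[where
        i="\<lambda>\<tau>. (comp \<tau>, {B \<in> \<tau>. B \<subseteq> U (comp \<tau>)}, {B \<in> \<tau>. \<not> B \<subseteq> U (comp \<tau>)})"
        and j="\<lambda>(T, \<tau>1, \<tau>2). \<tau>1 \<union> \<tau>2"], goal_cases)
    case (1 a)
    then obtain T \<tau>1 \<tau>2 where a: "a = (T, \<tau>1, \<tau>2)" "T \<in> P" "\<tau>1 \<in> I T" "\<tau>2 \<in> J T" by auto
    show ?case unfolding a(1) prod.case un(2)[OF a(2-4)] un(4)[OF a(2-4)] un(5)[OF a(2-4)] ..
  next
    case (2 a)
    then obtain T \<tau>1 \<tau>2 where a: "a = (T, \<tau>1, \<tau>2)" "T \<in> P" "\<tau>1 \<in> I T" "\<tau>2 \<in> J T" by auto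
    show ?case using un(1)[OF a(2-4)] a(1) by simp
  next
    case (3 \<tau>)
    show ?case by auto
  next
    case (4 \<tau>)
    then show ?case using parts[of \<tau>] by simp
  next
    case (5 a)
    then obtain T \<tau>1 \<tau>2 where a: "a = (T, \<tau>1, \<tau>2)" "T \<in> P" "\<tau>1 \<in> I T" "\<tau>2 \<in> J T" by auto
    have "finite (\<tau>1 \<union> \<tau>2)" using finite_elements[OF finU[OF order_refl] un(1)[OF a(2-4)]] .
    then show ?case using un(3)[OF a(2-4)] a(1) by (simp add: prod.union_disjoint)
  qed
  finally show ?thesis by (simp add: P_def I_def J_def U_def)
qed

text \<open>The formula of Leonov and Shiryaev.\<close>

theorem set_cumulant_Union:
  assumes K: "finite K" "K \<noteq> {}" and W: "\<And>k. k \<in> K \<Longrightarrow> finite (W k)"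
    and disj: "disjoint_family_on W K" and f0: "f {} = 1"
  shows "set_cumulant (\<lambda>S. f (\<Union>(W ` S))) K =
    (\<Sum>\<tau> | partition_on (\<Union>(W ` K)) \<tau> \<and> links W K \<tau>. \<Prod>B\<in>\<tau>. set_cumulant f B)"
proof (rule set_cumulant_unique[OF K(1) _ _ order_refl K(2), where
    k = "\<lambda>S. \<Sum>\<tau> | partition_on (\<Union>(W ` S)) \<tau> \<and> links W S \<tau>. \<Prod>B\<in>\<tau>. set_cumulant f B"], goal_cases)
  case 1
  then show ?case using f0 by simp
next
  case (2 S)
  then obtain b where b: "b \<in> S" by auto
  have S: "finite S" using finite_subset[OF 2(1) K(1)] .
  have m: "f (\<Union>(W ` T)) = (\<Sum>\<tau> | partition_on (\<Union>(W ` T)) \<tau>. \<Prod>B\<in>\<tau>. set_cumulant f B)" if "T \<subseteq> S" for T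
    by (rule moment_eq_sum_cumulants) (use that 2 W f0 finite_subset[OF that S] in auto)
  have dS: "disjoint_family_on W S" using disj 2 by (auto simp: disjoint_family_on_def)
  show ?case
  proof (rule bexI[OF _ b])
    \<comment> \<open>The moment is expanded over all partitions, the component of \<open>b\<close>
      is split off, and the sum over partitions of the rest is folded back into a moment. This is
      the recursion for the claimed cumulants.\<close>
    have "f (\<Union>(W ` S)) = (\<Sum>T | b \<in> T \<and> T \<subseteq> S.
        (\<Sum>\<tau> | partition_on (\<Union>(W ` T)) \<tau> \<and> links W T \<tau>. \<Prod>B\<in>\<tau>. set_cumulant f B) *
        (\<Sum>\<tau> | partition_on (\<Union>(W ` (S - T))) \<tau>. \<Prod>B\<in>\<tau>. set_cumulant f B))"
      unfolding m[OF order_refl] by (rule sum_partitions_component[OF S _ dS b]) (use 2 W in auto)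
    also have "\<dots> = (\<Sum>T | b \<in> T \<and> T \<subseteq> S.
        (\<Sum>\<tau> | partition_on (\<Union>(W ` T)) \<tau> \<and> links W T \<tau>. \<Prod>B\<in>\<tau>. set_cumulant f B) *
        f (\<Union>(W ` (S - T))))"
      by (intro sum.cong refl) (simp add: m[OF Diff_subset])
    finally show "f (\<Union>(W ` S)) = \<dots>" .
  qed
qed

section \<open>Multilinearity of cumulants\<close>

lemma set_cumulant_scale:
  assumes K: "finite K"
  shows "set_cumulant (\<lambda>S. (\<Prod>k\<in>S. c k) * g S) K = (\<Prod>k\<in>K. c k) * set_cumulant g K"
  unfolding set_cumulant_def sum_distrib_left
proof (intro sum.cong refl, goal_cases)
  case (1 \<pi>)
  then have \<pi>: "partition_on K \<pi>" by simp
  have "(\<Prod>V\<in>\<pi>. \<Prod>k\<in>V. c k) = (\<Prod>k\<in>\<Union>\<pi>. c k)"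
  proof (rule prod.Union_disjoint[symmetric, unfolded o_def])
    show "\<forall>V\<in>\<pi>. finite V"
      using partition_on_block_subset[OF \<pi>] finite_subset[OF _ K] by simp
    show "\<forall>V\<in>\<pi>. \<forall>W\<in>\<pi>. V \<noteq> W \<longrightarrow> V \<inter> W = {}"
      using partition_onD2[OF \<pi>] by (simp add: disjoint_def)
  qed
  also have "\<Union>\<pi> = K" using partition_onD1[OF \<pi>] ..
  finally show ?case by (simp add: prod.distrib mult_ac)
qed

lemma sum_PiE_Un:
  fixes G H :: "('a \<Rightarrow> 'b) \<Rightarrow> 'c::comm_semiring_0"
  assumes AB: "A \<inter> B = {}"
    and G: "\<And>i j. (\<And>a. a \<in> A \<Longrightarrow> i a = j a) \<Longrightarrow> G i = G j"
    and H: "\<And>i j. (\<And>a. a \<in> B \<Longrightarrow> i a = j a) \<Longrightarrow> H i = H j"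
  shows "(\<Sum>i \<in> PiE (A \<union> B) (\<lambda>_. I). G i * H i) =
    (\<Sum>i \<in> PiE A (\<lambda>_. I). G i) * (\<Sum>i \<in> PiE B (\<lambda>_. I). H i)"
  unfolding sum_product sum.cartesian_product
proof (rule sum.reindex_bij_witness[where i="\<lambda>(i, j) a. if a \<in> A then i a else j a"
      and j="\<lambda>i. (restrict i A, restrict i B)"], goal_cases)
  case (1 i)
  show ?case
  proof
    fix a show "(case (restrict i A, restrict i B) of (i, j) \<Rightarrow> \<lambda>a. if a \<in> A then i a else j a) a = i a"
      using PiE_arb[OF 1, of a] by auto
  qed
next
  case (2 i)
  then show ?case by (auto simp: PiE_iff)
next
  case (3 p)
  obtain i j where p: "p = (i, j)" by force
  then have "i \<in> PiE A (\<lambda>_. I)" "j \<in> PiE B (\<lambda>_. I)" using 3 by auto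
  then have "restrict (\<lambda>a. if a \<in> A then i a else j a) A = i"
    "restrict (\<lambda>a. if a \<in> A then i a else j a) B = j"
    using AB PiE_arb[of i A] PiE_arb[of j B] by (auto simp: restrict_def fun_eq_iff)
  then show ?case using p by simp
next
  case (4 p)
  then show ?case using AB by (auto simp: PiE_iff extensional_def)
next
  case (5 i)
  have "G (restrict i A) = G i" "H (restrict i B) = H i" by (rule G H; simp)+
  then show ?case by simp
qed

lemma prod_sum_PiE_disjoint:
  fixes F :: "'k \<Rightarrow> ('a \<Rightarrow> 'b) \<Rightarrow> 'c::comm_semiring_1"
  assumes "finite P" "disjoint_family_on D P"
    and F: "\<And>V i j. V \<in> P \<Longrightarrow> (\<And>a. a \<in> D V \<Longrightarrow> i a = j a) \<Longrightarrow> F V i = F V j"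
  shows "(\<Prod>V\<in>P. \<Sum>i \<in> PiE (D V) (\<lambda>_. I). F V i) = (\<Sum>i \<in> PiE (\<Union>V\<in>P. D V) (\<lambda>_. I). \<Prod>V\<in>P. F V i)"
  using assms
proof (induction P rule: finite_induct)
  case empty
  then show ?case by simp
next
  case (insert W P)
  have dP: "disjoint_family_on D P" using insert.prems(1) by (auto simp: disjoint_family_on_def)
  have "D W \<inter> D V = {}" if "V \<in> P" for V
    using insert.prems(1) insert.hyps(2) that by (auto simp: disjoint_family_on_def)
  then have dW: "D W \<inter> (\<Union>V\<in>P. D V) = {}" by auto
  have "(\<Prod>V\<in>insert W P. \<Sum>i \<in> PiE (D V) (\<lambda>_. I). F V i) =
      (\<Sum>i \<in> PiE (D W) (\<lambda>_. I). F W i) * (\<Sum>i \<in> PiE (\<Union>V\<in>P. D V) (\<lambda>_. I). \<Prod>V\<in>P. F V i)"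
    using insert.hyps insert.IH[OF dP insert.prems(2)] by simp
  also have "\<dots> = (\<Sum>i \<in> PiE (D W \<union> (\<Union>V\<in>P. D V)) (\<lambda>_. I). F W i * (\<Prod>V\<in>P. F V i))"
  proof (rule sum_PiE_Un[OF dW, symmetric])
    show "F W i = F W j" if "\<And>a. a \<in> D W \<Longrightarrow> i a = j a" for i j
      by (rule insert.prems(2)[OF insertI1 that])
    show "(\<Prod>V\<in>P. F V i) = (\<Prod>V\<in>P. F V j)" if "\<And>a. a \<in> (\<Union>V\<in>P. D V) \<Longrightarrow> i a = j a" for i j
    proof (rule prod.cong)
      fix V assume "V \<in> P"
      then show "F V i = F V j" by (intro insert.prems(2) that) auto
    qed simp
  qed
  finally show ?case using insert.hyps by simp
qed

text \<open>The blocks of a partition of \<open>K\<close> involve disjoint sets of positions. A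
  product over the blocks of sums over index functions is therefore one sum over index functions on
  all positions, and it can be pulled out.\<close>

lemma set_cumulant_sum_PiE:
  fixes F :: "'a set \<Rightarrow> ('a \<Rightarrow> 'b) \<Rightarrow> complex"
  assumes K: "finite K" and disj: "disjoint_family_on W K"
    and F: "\<And>S i j. S \<subseteq> K \<Longrightarrow> (\<And>a. a \<in> \<Union>(W ` S) \<Longrightarrow> i a = j a) \<Longrightarrow>
      F (\<Union>(W ` S)) i = F (\<Union>(W ` S)) j"
  shows "set_cumulant (\<lambda>S. \<Sum>i \<in> PiE (\<Union>(W ` S)) (\<lambda>_. I). F (\<Union>(W ` S)) i) K =
    (\<Sum>i \<in> PiE (\<Union>(W ` K)) (\<lambda>_. I). set_cumulant (\<lambda>S. F (\<Union>(W ` S)) i) K)"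
proof -
  have *: "(\<Prod>S\<in>\<pi>. \<Sum>i \<in> PiE (\<Union>(W ` S)) (\<lambda>_. I). F (\<Union>(W ` S)) i) =
      (\<Sum>i \<in> PiE (\<Union>(W ` K)) (\<lambda>_. I). \<Prod>S\<in>\<pi>. F (\<Union>(W ` S)) i)"
    if \<pi>: "partition_on K \<pi>" for \<pi>
  proof -
    have "disjoint_family_on (\<lambda>S. \<Union>(W ` S)) \<pi>"
    proof (unfold disjoint_family_on_def, intro ballI impI)
      fix S T assume ST: "S \<in> \<pi>" "T \<in> \<pi>" "S \<noteq> T"
      have "W s \<inter> W t = {}" if "s \<in> S" "t \<in> T" for s t
      proof -
        have "s \<noteq> t" using partition_on_block_unique[OF \<pi> ST(1,2)] ST(3) that by metis
        moreover have "s \<in> K" "t \<in> K"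
          using partition_on_block_subset[OF \<pi>] ST that by auto
        ultimately show ?thesis using disj by (simp add: disjoint_family_on_def)
      qed
      then show "\<Union>(W ` S) \<inter> \<Union>(W ` T) = {}" by auto
    qed
    from prod_sum_PiE_disjoint[where F="\<lambda>S. F (\<Union>(W ` S))", OF finite_elements[OF K \<pi>] this
        F[OF partition_on_block_subset[OF \<pi>]]]
    have "(\<Prod>S\<in>\<pi>. \<Sum>i \<in> PiE (\<Union>(W ` S)) (\<lambda>_. I). F (\<Union>(W ` S)) i) =
      (\<Sum>i \<in> PiE (\<Union>S\<in>\<pi>. \<Union>(W ` S)) (\<lambda>_. I). \<Prod>S\<in>\<pi>. F (\<Union>(W ` S)) i)" .
    also have "(\<Union>S\<in>\<pi>. \<Union>(W ` S)) = \<Union>(W ` K)" using partition_onD1[OF \<pi>] by auto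
    finally show ?thesis .
  qed
  have "set_cumulant (\<lambda>S. \<Sum>i \<in> PiE (\<Union>(W ` S)) (\<lambda>_. I). F (\<Union>(W ` S)) i) K =
    (\<Sum>\<pi> | partition_on K \<pi>. \<Sum>i \<in> PiE (\<Union>(W ` K)) (\<lambda>_. I).
       (-1) ^ (card \<pi> - 1) * fact (card \<pi> - 1) * (\<Prod>S\<in>\<pi>. F (\<Union>(W ` S)) i))"
    unfolding set_cumulant_def by (intro sum.cong refl) (simp add: * sum_distrib_left)
  also have "\<dots> = (\<Sum>i \<in> PiE (\<Union>(W ` K)) (\<lambda>_. I). set_cumulant (\<lambda>S. F (\<Union>(W ` S)) i) K)"
    unfolding set_cumulant_def by (rule sum.swap)
  finally show ?thesis .
qed

section \<open>Counting connected components\<close>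

text \<open>The closure is taken over the whole type, so points without edges are classes of their
  own and no carrier has to be kept; only the counting of classes refers to a set.\<close>

definition conn :: "('a \<times> 'a) set \<Rightarrow> ('a \<times> 'a) set" where
  "conn E = (E \<union> E\<inverse>)\<^sup>*"

definition graph_of :: "('a \<Rightarrow> 'a) \<Rightarrow> ('a \<times> 'a) set" where
  "graph_of f = {(a, f a) | a. True}"

lemma graph_ofI: "(a, f a) \<in> graph_of f"
  by (auto simp: graph_of_def)

lemma conn_refl: "(a, a) \<in> conn E"
  by (simp add: conn_def)

lemma conn_incl: "e \<in> E \<Longrightarrow> e \<in> conn E"
  by (auto simp: conn_def)

lemma conn_sym: "(a, b) \<in> conn E \<Longrightarrow> (b, a) \<in> conn E"
proof -
  have "sym ((E \<union> E\<inverse>)\<^sup>*)" by (intro sym_rtrancl sym_Un_converse)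
  then show "(a, b) \<in> conn E \<Longrightarrow> (b, a) \<in> conn E" by (simp add: conn_def sym_def)
qed

lemma conn_trans: "(a, b) \<in> conn E \<Longrightarrow> (b, c) \<in> conn E \<Longrightarrow> (a, c) \<in> conn E"
  unfolding conn_def by (rule rtrancl_trans)

lemma conn_least:
  assumes "E \<subseteq> r" "\<And>a. (a, a) \<in> r" "\<And>a b. (a, b) \<in> r \<Longrightarrow> (b, a) \<in> r"
    "\<And>a b c. (a, b) \<in> r \<Longrightarrow> (b, c) \<in> r \<Longrightarrow> (a, c) \<in> r"
  shows "conn E \<subseteq> r"
proof
  fix e assume e: "e \<in> conn E"
  obtain x y where xy: "e = (x, y)" by force
  have "(x, y) \<in> (E \<union> E\<inverse>)\<^sup>*" using e xy by (simp add: conn_def)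
  then have "(x, y) \<in> r"
  proof (induction rule: rtrancl_induct)
    case base
    show ?case by (rule assms(2))
  next
    case (step y z)
    have "(y, z) \<in> r" using step.hyps(2) assms(1,3) by auto
    with step.IH show ?case by (rule assms(4))
  qed
  then show "e \<in> r" using xy by simp
qed

lemma conn_subset_conn: "E \<subseteq> conn E' \<Longrightarrow> conn E \<subseteq> conn E'"
  by (rule conn_least) (auto intro: conn_refl conn_sym conn_trans)

lemma conn_mono: "E \<subseteq> E' \<Longrightarrow> conn E \<subseteq> conn E'"
  by (rule conn_subset_conn) (auto intro: conn_incl)

lemma conn_eqI: "E \<subseteq> conn E' \<Longrightarrow> E' \<subseteq> conn E \<Longrightarrow> conn E = conn E'"
  by (intro equalityI conn_subset_conn)

lemma conn_insert_absorb: "(a, b) \<in> conn E \<Longrightarrow> conn (insert (a, b) E) = conn E"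
  by (rule conn_eqI) (auto intro: conn_incl)

text \<open>A walk can be shortened until it uses the new edge at most once; formally, the
  right-hand side is already an equivalence relation that contains all edges.\<close>

lemma conn_insertD:
  assumes "(x, y) \<in> conn (insert (a, b) E)"
  shows "(x, y) \<in> conn E \<or> (x, a) \<in> conn E \<and> (b, y) \<in> conn E \<or> (x, b) \<in> conn E \<and> (a, y) \<in> conn E"
proof -
  let ?r = "conn E"
  let ?s = "{(x, y). (x, y) \<in> ?r \<or> (x, a) \<in> ?r \<and> (b, y) \<in> ?r \<or> (x, b) \<in> ?r \<and> (a, y) \<in> ?r}"
  have "conn (insert (a, b) E) \<subseteq> ?s"
  proof (rule conn_least)
    show "insert (a, b) E \<subseteq> ?s" by (auto intro: conn_incl conn_refl)
    show "(x, x) \<in> ?s" for x by (simp add: conn_refl)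
    show "(y, x) \<in> ?s" if "(x, y) \<in> ?s" for x y using that conn_sym[of _ _ E] by blast
    show "(x, z) \<in> ?s" if xy: "(x, y) \<in> ?s" and yz: "(y, z) \<in> ?s" for x y z
    proof -
      note t = conn_trans[of _ _ E] and s = conn_sym[of _ _ E]
      consider "(x, y) \<in> ?r" | "(x, a) \<in> ?r" "(b, y) \<in> ?r" | "(x, b) \<in> ?r" "(a, y) \<in> ?r"
        using xy by auto
      then show ?thesis
      proof cases
        case 1
        then show ?thesis using yz t[OF 1] by auto
      next
        case 2
        then consider "(b, z) \<in> ?r" | "(b, a) \<in> ?r" "(b, z) \<in> ?r" | "(a, z) \<in> ?r"
          using yz t[OF 2(2)] by auto
        then show ?thesis using 2 t[OF 2(1)] by cases auto
      next
        case 3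
        then consider "(a, z) \<in> ?r" | "(a, b) \<in> ?r" "(a, z) \<in> ?r" | "(b, z) \<in> ?r"
          using yz t[OF 3(2)] by auto
        then show ?thesis using 3 t[OF 3(1)] by cases auto
      qed
    qed
  qed
  then show ?thesis using assms by auto
qed

lemma conn_class_eq_iff: "conn E `` {x} = conn E `` {y} \<longleftrightarrow> (x, y) \<in> conn E"
proof
  assume "conn E `` {x} = conn E `` {y}"
  then have "y \<in> conn E `` {x}" using conn_refl[of y E] by auto
  then show "(x, y) \<in> conn E" by simp
next
  assume "(x, y) \<in> conn E"
  then have "(x, z) \<in> conn E \<longleftrightarrow> (y, z) \<in> conn E" for z
    using conn_trans[of x y E z] conn_trans[OF conn_sym, of x y E z] by auto
  then show "conn E `` {x} = conn E `` {y}" by auto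
qed

text \<open>The number of components that meet \<open>A\<close>.\<close>

definition ncomp :: "'a set \<Rightarrow> ('a \<times> 'a) set \<Rightarrow> nat" where
  "ncomp A E = card (A // conn E)"

lemma quotient_eq_image: "A // r = (\<lambda>x. r `` {x}) ` A"
  by (auto simp: quotient_def)

lemma ncomp_cong: "conn E = conn E' \<Longrightarrow> ncomp A E = ncomp A E'"
  by (simp add: ncomp_def)

text \<open>Saturating a class of the finer relation gives a class of the coarser one, and all arise
  this way.\<close>

lemma ncomp_anti:
  assumes A: "finite A" and sub: "conn E \<subseteq> conn E'"
  shows "ncomp A E' \<le> ncomp A E"
proof -
  have "conn E' `` (conn E `` {x}) = conn E' `` {x}" for x
  proof
    show "conn E' `` (conn E `` {x}) \<subseteq> conn E' `` {x}"
      using sub conn_trans[of _ _ E'] by blast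
    show "conn E' `` {x} \<subseteq> conn E' `` (conn E `` {x})" using conn_refl[of x E] by blast
  qed
  then have "A // conn E' = (\<lambda>X. conn E' `` X) ` (A // conn E)"
    by (simp add: quotient_eq_image image_image)
  then show ?thesis unfolding ncomp_def
    using card_image_le[of "A // conn E"] A by (simp add: quotient_eq_image)
qed

text \<open>The classes of \<open>a\<close> and \<open>b\<close> are replaced by their union, and
  every other class is unchanged.\<close>

lemma ncomp_insert:
  assumes A: "finite A" and ab: "a \<in> A" "b \<in> A" and new: "(a, b) \<notin> conn E"
  shows "ncomp A (insert (a, b) E) + 1 = ncomp A E"
proof -
  let ?r = "conn E" and ?s = "conn (insert (a, b) E)"
  let ?a = "?r `` {a}" and ?b = "?r `` {b}"
  have sub: "?r \<subseteq> ?s" by (rule conn_mono) auto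
  have abs: "(a, b) \<in> ?s" by (rule conn_incl) simp
  have cl: "?s `` {x} = (if x \<in> ?a \<union> ?b then ?a \<union> ?b else ?r `` {x})" for x
  proof (cases "x \<in> ?a \<union> ?b")
    case True
    have "(x, a) \<in> ?s"
      using True
    proof
      assume "x \<in> ?a" then show ?thesis using sub conn_sym[of a x] by auto
    next
      assume "x \<in> ?b"
      then have "(x, b) \<in> ?s" using sub conn_sym[of b x] by auto
      then show ?thesis using conn_sym[OF abs] conn_trans by metis
    qed
    then have "?s `` {x} = ?s `` {a}" by (simp add: conn_class_eq_iff)
    also have "\<dots> = ?a \<union> ?b"
    proof
      show "?s `` {a} \<subseteq> ?a \<union> ?b" using conn_insertD[of a _ a b E] by auto
      have "y \<in> ?s `` {a}" if "y \<in> ?b" for y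
        using that sub abs conn_trans[OF abs, of y] by auto
      then show "?a \<union> ?b \<subseteq> ?s `` {a}" using sub by auto
    qed
    finally show ?thesis using True by simp
  next
    case False
    have "(x, y) \<in> ?r" if "(x, y) \<in> ?s" for y
      using conn_insertD[OF that] False conn_sym[of x a E] conn_sym[of x b E] by auto
    then have "?s `` {x} = ?r `` {x}" using sub by auto
    then show ?thesis using False by simp
  qed
  have ne: "?a \<noteq> ?b" using new by (simp add: conn_class_eq_iff)
  have q: "A // ?s = insert (?a \<union> ?b) (A // ?r - {?a, ?b})"
  proof (intro equalityI subsetI)
    fix X assume "X \<in> A // ?s"
    then obtain x where x: "x \<in> A" "X = ?s `` {x}" by (auto simp: quotient_def)
    show "X \<in> insert (?a \<union> ?b) (A // ?r - {?a, ?b})"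
    proof (cases "x \<in> ?a \<union> ?b")
      case True
      then show ?thesis using x(2) cl[of x] by simp
    next
      case False
      then have "X = ?r `` {x}" using x(2) cl[of x] by simp
      moreover have "?r `` {x} \<noteq> ?a" "?r `` {x} \<noteq> ?b"
        using False conn_sym[of x a E] conn_sym[of x b E] by (auto simp: conn_class_eq_iff)
      ultimately show ?thesis using x(1) by (simp add: quotient_eq_image)
    qed
  next
    fix X assume "X \<in> insert (?a \<union> ?b) (A // ?r - {?a, ?b})"
    then show "X \<in> A // ?s"
    proof
      assume X: "X = ?a \<union> ?b"
      have "?s `` {a} = ?a \<union> ?b" using cl[of a] conn_refl[of a E] by simp
      then show ?thesis using X ab by (auto simp: quotient_eq_image)
    next
      assume "X \<in> A // ?r - {?a, ?b}"
      then obtain x where x: "x \<in> A" "X = ?r `` {x}" "X \<noteq> ?a" "X \<noteq> ?b"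
        by (auto simp: quotient_eq_image)
      then have "x \<notin> ?a \<union> ?b" using conn_class_eq_iff[of E] conn_sym[of _ _ E] by (metis ImageE Un_iff singletonD)
      then have "?s `` {x} = X" using x cl[of x] by simp
      then show ?thesis using x(1) by (auto simp: quotient_eq_image)
    qed
  qed
  have fin: "finite (A // ?r)" using A by (simp add: quotient_eq_image)
  have "?a \<union> ?b \<notin> A // ?r"
  proof
    assume "?a \<union> ?b \<in> A // ?r"
    then obtain x where x: "?a \<union> ?b = ?r `` {x}" by (auto simp: quotient_eq_image)
    have "a \<in> ?r `` {x}" "b \<in> ?r `` {x}" using x conn_refl[of a E] conn_refl[of b E] by auto
    then show False using new conn_sym[of x a E] conn_trans[of a x E b] by simp
  qed
  then have "ncomp A (insert (a, b) E) = Suc (card (A // ?r - {?a, ?b}))"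
    unfolding ncomp_def q using fin by simp
  moreover have "card (A // ?r - {?a, ?b}) = card (A // ?r) - 2"
    using ab ne fin by (subst card_Diff_subset) (auto simp: quotient_eq_image)
  moreover have "card {?a, ?b} \<le> card (A // ?r)"
    by (rule card_mono[OF fin]) (use ab in \<open>auto simp: quotient_eq_image\<close>)
  ultimately show ?thesis using ne by (simp add: ncomp_def)
qed

lemma ncomp_insert_le:
  assumes A: "finite A" and ab: "a \<in> A" "b \<in> A"
  shows "ncomp A E \<le> ncomp A (insert (a, b) E) + 1"
  using ncomp_insert[OF A ab, of E] conn_insert_absorb[of a b E] ncomp_cong[of "insert (a, b) E" E A]
  by (cases "(a, b) \<in> conn E") auto

section \<open>Cycle counts under multiplication by a transposition\<close>

lemma graph_of_transpose_subset:
  "graph_of (\<sigma> \<circ> Transposition.transpose a b) \<subseteq> conn (insert (a, b) (graph_of \<sigma>))"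
proof
  fix e assume "e \<in> graph_of (\<sigma> \<circ> Transposition.transpose a b)"
  then obtain x where e: "e = (x, \<sigma> (Transposition.transpose a b x))" by (auto simp: graph_of_def)
  let ?r = "conn (insert (a, b) (graph_of \<sigma>))"
  have g: "(y, \<sigma> y) \<in> ?r" for y using graph_ofI[of y \<sigma>] by (intro conn_incl) simp
  have ab: "(a, b) \<in> ?r" by (intro conn_incl) simp
  have "(x, Transposition.transpose a b x) \<in> ?r"
    using ab conn_sym[OF ab] conn_refl[of x] by (simp add: Transposition.transpose_def)
  then show "e \<in> ?r" unfolding e by (rule conn_trans[OF _ g])
qed

text \<open>Once \<open>a\<close> and \<open>b\<close> are joined, it makes no difference whether
  they are swapped before \<open>\<sigma>\<close> is applied. The enlarged graph is the common
  reference for the cycle counts of the two permutations.\<close>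

lemma conn_transpose:
  "conn (insert (a, b) (graph_of (\<sigma> \<circ> Transposition.transpose a b))) = conn (insert (a, b) (graph_of \<sigma>))"
proof (rule conn_eqI)
  show "insert (a, b) (graph_of (\<sigma> \<circ> Transposition.transpose a b)) \<subseteq> conn (insert (a, b) (graph_of \<sigma>))"
    using graph_of_transpose_subset[of \<sigma> a b] by (auto intro: conn_incl)
  have "\<sigma> \<circ> Transposition.transpose a b \<circ> Transposition.transpose a b = \<sigma>"
    by (simp add: fun_eq_iff)
  then show "insert (a, b) (graph_of \<sigma>) \<subseteq> conn (insert (a, b) (graph_of (\<sigma> \<circ> Transposition.transpose a b)))"
    using graph_of_transpose_subset[of "\<sigma> \<circ> Transposition.transpose a b" a b] by (auto intro: conn_incl)
qed

text \<open>Adding the edge between \<open>a\<close> and \<open>b\<close> to the new graph costs at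
  most one component, and the components of the result are unions of cycles of
  \<open>\<sigma>\<close>.\<close>

lemma ncomp_transpose_le:
  assumes A: "finite A" and ab: "a \<in> A" "b \<in> A"
  shows "ncomp A (graph_of (\<sigma> \<circ> Transposition.transpose a b)) \<le> ncomp A (graph_of \<sigma>) + 1"
proof -
  have "ncomp A (graph_of (\<sigma> \<circ> Transposition.transpose a b)) \<le>
      ncomp A (insert (a, b) (graph_of (\<sigma> \<circ> Transposition.transpose a b))) + 1"
    by (rule ncomp_insert_le[OF A ab])
  also have "\<dots> = ncomp A (insert (a, b) (graph_of \<sigma>)) + 1"
    by (simp add: ncomp_cong[OF conn_transpose])
  also have "\<dots> \<le> ncomp A (graph_of \<sigma>) + 1"
    using ncomp_anti[OF A conn_mono[OF subset_insertI]] by simp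
  finally show ?thesis .
qed

text \<open>The new permutation \<open>t\<close> leads from \<open>a\<close> to
  \<open>\<sigma> b\<close> and on along the old cycle of \<open>b\<close> until it reaches
  \<open>b\<close>, so the two cycles become one.\<close>

lemma ncomp_transpose_merge:
  assumes A: "finite A" and \<sigma>: "\<sigma> permutes A" and ab: "a \<in> A" "b \<in> A"
    and new: "(a, b) \<notin> conn (graph_of \<sigma>)"
  shows "ncomp A (graph_of (\<sigma> \<circ> Transposition.transpose a b)) + 1 = ncomp A (graph_of \<sigma>)"
proof -
  define t where "t = \<sigma> \<circ> Transposition.transpose a b"
  let ?r = "conn (graph_of t)"
  have gt: "(y, t y) \<in> ?r" for y by (intro conn_incl graph_ofI)
  have g: "(y, \<sigma> y) \<in> conn (graph_of \<sigma>)" for y by (intro conn_incl graph_ofI)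
  have "permutation \<sigma>" using A \<sigma> permutation_permutes by metis
  then have "b \<in> orbit \<sigma> b" by (rule permutation_self_in_orbit)
  \<comment> \<open>On the cycle of \<open>b\<close>, \<open>t\<close> differs from
    \<open>\<sigma>\<close> only at \<open>b\<close>; the alternative \<open>(a, b) \<in> ?r\<close>
    carries the induction past that point. The last conjunct keeps \<open>y\<close> away from
    \<open>a\<close>.\<close>
  moreover have "((a, y) \<in> ?r \<or> (a, b) \<in> ?r) \<and> (b, y) \<in> conn (graph_of \<sigma>)" if "y \<in> orbit \<sigma> b" for y
    using that
  proof (induction rule: orbit.induct)
    case base
    have "t a = \<sigma> b" by (simp add: t_def)
    then show ?case using gt[of a] g[of b] by simp
  next
    case (step y)
    have by': "(b, \<sigma> y) \<in> conn (graph_of \<sigma>)"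
      using step.IH conn_trans[OF _ g] by metis
    have "y \<noteq> a" using new step.IH conn_sym[of b a "graph_of \<sigma>"] by auto
    show ?case
    proof (cases "y = b")
      case True
      then show ?thesis using step.IH by' by simp
    next
      case False
      then have "t y = \<sigma> y" using \<open>y \<noteq> a\<close> by (simp add: t_def Transposition.transpose_def)
      then have "(y, \<sigma> y) \<in> ?r" using gt[of y] by simp
      then show ?thesis using step.IH by' conn_trans[of a y "graph_of t" "\<sigma> y"] by auto
    qed
  qed
  ultimately have "(a, b) \<in> ?r" by auto
  then have "ncomp A (graph_of t) = ncomp A (insert (a, b) (graph_of t))"
    by (intro ncomp_cong) (simp add: conn_insert_absorb)
  also have "\<dots> = ncomp A (insert (a, b) (graph_of \<sigma>))"
    unfolding t_def by (rule ncomp_cong[OF conn_transpose])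
  finally show ?thesis using ncomp_insert[OF A ab new] by (simp add: t_def)
qed

text \<open>The Euler characteristic of the surface obtained by gluing polygons along their edges.\<close>

lemma genus_bound:
  assumes A: "finite A" and \<gamma>: "\<gamma> permutes A"
    and p: "p permutes A" and inv: "\<And>a. p (p a) = a"
  shows "2 * ncomp A (graph_of (\<gamma> \<circ> p)) + 2 * ncomp A (graph_of \<gamma>) \<le>
    card {a. p a \<noteq> a} + 4 * ncomp A (graph_of \<gamma> \<union> graph_of p)"
  \<comment> \<open>The faces are the cycles of \<open>\<gamma>\<close>, the edges the 2-cycles of
    \<open>p\<close>, the vertices the cycles of \<open>\<gamma> \<circ> p\<close>; doubling turns
    the number of edges into the number of points moved by \<open>p\<close>. The induction removes
    one 2-cycle at a time; for \<open>p = id\<close> both sides are four times the number of cycles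
    of \<open>\<gamma>\<close>.\<close>
  using p inv
proof (induction "card {a. p a \<noteq> a}" arbitrary: p rule: less_induct)
  case less
  have supp: "{a. p a \<noteq> a} \<subseteq> A" using permutes_not_in[OF less.prems(1)] by auto
  have fin: "finite {a. p a \<noteq> a}" by (rule finite_subset[OF supp A])
  show ?case
  proof (cases "\<exists>a. p a \<noteq> a")
    case False
    then have "p = id" by (simp add: fun_eq_iff)
    moreover have "conn (graph_of \<gamma> \<union> graph_of id) = conn (graph_of \<gamma>)"
      by (rule conn_eqI) (auto simp: graph_of_def intro: conn_refl conn_incl)
    ultimately show ?thesis by (simp add: ncomp_def)
  next
    case True
    then obtain a where pa: "p a \<noteq> a" by auto
    define b where "b = p a"
    have ab: "a \<noteq> b" "p b = a" "p a = b" using pa less.prems(2)[of a] by (auto simp: b_def)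
    have aA: "a \<in> A" "b \<in> A" using supp ab by auto
    let ?t = "Transposition.transpose a b"
    define q where "q = p \<circ> ?t"
    have q: "q x = (if x = a \<or> x = b then x else p x)" for x
      using ab by (simp add: q_def Transposition.transpose_def)
    have pt: "p = q \<circ> ?t" by (simp add: q_def fun_eq_iff)
    have qperm: "q permutes A"
      unfolding q_def by (rule permutes_compose[OF permutes_swap_id[OF aA] less.prems(1)])
    have qinv: "q (q x) = x" for x
    proof (cases "x = a \<or> x = b")
      case True
      then show ?thesis by (auto simp: q)
    next
      case False
      have "p x \<noteq> a" "p x \<noteq> b" using False less.prems(2)[of x] ab by auto
      then show ?thesis using False less.prems(2)[of x] by (simp add: q)
    qed
    have "{x. q x \<noteq> x} = {x. p x \<noteq> x} - {a, b}" using ab by (auto simp: q)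
    moreover have "{a, b} \<subseteq> {x. p x \<noteq> x}" using ab by auto
    ultimately have suppq: "card {x. q x \<noteq> x} + 2 = card {x. p x \<noteq> x}"
      using ab(1) card_mono[OF fin, of "{a, b}"] by (simp add: card_Diff_subset)
    define Q where "Q = graph_of \<gamma> \<union> graph_of q"
    have IH: "2 * ncomp A (graph_of (\<gamma> \<circ> q)) + 2 * ncomp A (graph_of \<gamma>) \<le>
        card {a. q a \<noteq> a} + 4 * ncomp A Q"
      unfolding Q_def by (rule less.hyps[OF _ qperm qinv]) (use suppq in simp)
    have QQ: "conn (graph_of \<gamma> \<union> graph_of p) = conn (insert (a, b) Q)"
    proof (rule conn_eqI)
      have "(x, p x) \<in> conn (insert (a, b) Q)" for x
      proof -
        have ab': "(a, b) \<in> conn (insert (a, b) Q)" by (rule conn_incl) simp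
        consider "x = a" | "x = b" | "x \<noteq> a" "x \<noteq> b" by auto
        then show ?thesis
        proof cases
          case 3
          have "(x, q x) \<in> insert (a, b) Q" using graph_ofI[of x q] by (simp add: Q_def)
          then show ?thesis using 3 conn_incl[of "(x, q x)"] by (simp add: q)
        qed (use ab ab' conn_sym[OF ab'] in simp_all)
      qed
      then show "graph_of \<gamma> \<union> graph_of p \<subseteq> conn (insert (a, b) Q)"
        by (auto simp: graph_of_def Q_def intro: conn_incl)
      have "(x, q x) \<in> conn (graph_of \<gamma> \<union> graph_of p)" for x
        using conn_refl[of x] conn_incl[of "(x, p x)" "graph_of \<gamma> \<union> graph_of p"] graph_ofI[of x p]
        by (simp add: q)
      moreover have "(a, b) \<in> conn (graph_of \<gamma> \<union> graph_of p)"
        using conn_incl[of "(a, p a)" "graph_of \<gamma> \<union> graph_of p"] graph_ofI[of a p] ab by simp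
      ultimately show "insert (a, b) Q \<subseteq> conn (graph_of \<gamma> \<union> graph_of p)"
        unfolding Q_def by (auto simp: graph_of_def intro: conn_incl)
    qed
    have \<gamma>p: "\<gamma> \<circ> p = (\<gamma> \<circ> q) \<circ> ?t" using pt by (simp add: comp_assoc)
    have \<gamma>q: "\<gamma> \<circ> q permutes A" by (rule permutes_compose[OF qperm \<gamma>])
    have sub: "conn (graph_of (\<gamma> \<circ> q)) \<subseteq> conn Q"
    proof (rule conn_subset_conn)
      have "(x, \<gamma> (q x)) \<in> conn Q" for x
        using conn_trans[of x "q x" Q "\<gamma> (q x)"] conn_incl[of _ Q] graph_ofI[of x q] graph_ofI[of "q x" \<gamma>]
        by (simp add: Q_def)
      then show "graph_of (\<gamma> \<circ> q) \<subseteq> conn Q" by (auto simp: graph_of_def)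
    qed
    have nQ: "ncomp A (graph_of \<gamma> \<union> graph_of p) = ncomp A (insert (a, b) Q)"
      by (rule ncomp_cong[OF QQ])
    \<comment> \<open>Restoring the 2-cycle adds 2 moved points on the right. If \<open>a\<close>
      and \<open>b\<close> were already connected, at most one vertex is gained, which adds at most
      2 on the left. Otherwise one vertex and one component are lost, so the left changes by -2 and
      the right by 2 - 4.\<close>
    show ?thesis
    proof (cases "(a, b) \<in> conn Q")
      case True
      then have "ncomp A (insert (a, b) Q) = ncomp A Q" by (intro ncomp_cong conn_insert_absorb)
      moreover have "ncomp A (graph_of (\<gamma> \<circ> p)) \<le> ncomp A (graph_of (\<gamma> \<circ> q)) + 1"
        unfolding \<gamma>p by (rule ncomp_transpose_le[OF A aA])
      ultimately show ?thesis using IH suppq nQ by simp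
    next
      case False
      then have "ncomp A (insert (a, b) Q) + 1 = ncomp A Q" by (intro ncomp_insert A aA)
      moreover have "ncomp A (graph_of (\<gamma> \<circ> p)) + 1 = ncomp A (graph_of (\<gamma> \<circ> q))"
        unfolding \<gamma>p by (rule ncomp_transpose_merge[OF A \<gamma>q aA]) (use False sub in auto)
      ultimately show ?thesis using IH suppq nQ by simp
    qed
  qed
qed

text \<open>
  Gluing two parallel edges that lie in different components identifies two pairs of vertices,
  since the edges are not loops.
\<close>

lemma glue_parallel_edges:
  fixes i :: "'a \<Rightarrow> 'v"
  assumes A: "finite A" and \<gamma>: "\<gamma> permutes A"
    and p: "p permutes A" and inv: "\<And>a. p (p a) = a" and supp: "{a. p a \<noteq> a} = A"
    and ip: "\<And>a. a \<in> A \<Longrightarrow> i (\<gamma> (p a)) = i a"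
    and P: "finite P" "\<And>a b. (a, b) \<in> P \<Longrightarrow> a \<in> A \<and> b \<in> A \<and> i a = i b \<and> i (\<gamma> a) = i (\<gamma> b) \<and> i a \<noteq> i (\<gamma> a)"
  defines "R \<equiv> \<lambda>P. graph_of (\<gamma> \<circ> p) \<union> P \<union> {(\<gamma> a, \<gamma> b) | a b. (a, b) \<in> P}"
    and "Q \<equiv> \<lambda>P. graph_of \<gamma> \<union> graph_of p \<union> P"
  shows "2 * ncomp A (R P) + 2 * ncomp A (graph_of \<gamma>) \<le> card A + 4 * ncomp A (Q P)"
    and "conn (R P) \<subseteq> {(a, b). i a = i b}"
proof -
  have i\<gamma>p: "i (\<gamma> (p a)) = i a" for a
  proof (cases "a \<in> A")
    case False
    then show ?thesis using permutes_not_in[OF p False] permutes_not_in[OF \<gamma> False] by simp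
  qed (rule ip)
  \<comment> \<open>Every generator of \<open>R P\<close> relates positions with the same starting
    vertex. This is stated for all \<open>P\<close>, because the induction below uses it for the
    smaller set.\<close>
  have ker: "conn (R P) \<subseteq> {(a, b). i a = i b}"
    if P: "\<And>a b. (a, b) \<in> P \<Longrightarrow> a \<in> A \<and> b \<in> A \<and> i a = i b \<and> i (\<gamma> a) = i (\<gamma> b) \<and> i a \<noteq> i (\<gamma> a)" for P
  proof (rule conn_least)
    show "R P \<subseteq> {(a, b). i a = i b}"
      using i\<gamma>p P by (auto simp: R_def graph_of_def)
  qed auto
  have RQ: "conn (R P) \<subseteq> conn (Q P)" for P
  proof (rule conn_subset_conn)
    have g: "(a, \<gamma> a) \<in> conn (Q P)" for a using conn_incl[of "(a, \<gamma> a)" "Q P"] graph_ofI[of a \<gamma>] by (simp add: Q_def)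
    have h: "(a, p a) \<in> conn (Q P)" for a using conn_incl[of "(a, p a)" "Q P"] graph_ofI[of a p] by (simp add: Q_def)
    have "(a, \<gamma> (p a)) \<in> conn (Q P)" for a by (rule conn_trans[OF h g])
    moreover have PQ: "(a, b) \<in> conn (Q P)" if "(a, b) \<in> P" for a b
      using that by (intro conn_incl) (simp add: Q_def)
    moreover have "(\<gamma> a, \<gamma> b) \<in> conn (Q P)" if "(a, b) \<in> P" for a b
      by (rule conn_trans[OF conn_sym[OF g] conn_trans[OF PQ[OF that] g]])
    ultimately show "R P \<subseteq> conn (Q P)" by (auto simp: R_def graph_of_def)
  qed
  show "conn (R P) \<subseteq> {(a, b). i a = i b}" by (rule ker) (rule P(2))
  show "2 * ncomp A (R P) + 2 * ncomp A (graph_of \<gamma>) \<le> card A + 4 * ncomp A (Q P)"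
    using P
  proof (induction P rule: finite_induct)
    case empty
    then show ?case using genus_bound[OF A \<gamma> p inv] by (simp add: R_def Q_def supp)
  next
    case (insert e P)
    obtain a b where e: "e = (a, b)" by force
    have ab: "a \<in> A" "b \<in> A" "i a = i b" "i (\<gamma> a) = i (\<gamma> b)" "i a \<noteq> i (\<gamma> a)"
      using insert.prems[of a b] e by auto
    have \<gamma>ab: "\<gamma> a \<in> A" "\<gamma> b \<in> A" using ab permutes_in_image[OF \<gamma>] by auto
    have prems: "\<And>a b. (a, b) \<in> P \<Longrightarrow> a \<in> A \<and> b \<in> A \<and> i a = i b \<and> i (\<gamma> a) = i (\<gamma> b) \<and> i a \<noteq> i (\<gamma> a)"
      using insert.prems by auto
    note IH = insert.IH[OF prems]
    have RI: "R (insert e P) = insert (\<gamma> a, \<gamma> b) (insert (a, b) (R P))"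
      by (auto simp: R_def e)
    have QI: "Q (insert e P) = insert (a, b) (Q P)" by (auto simp: Q_def e)
    \<comment> \<open>If the new pair is already connected in \<open>Q P\<close>, only the left side
      can shrink. Otherwise the right side loses 4, and both new identifications are required to
      make the left side lose 4 as well.\<close>
    show ?case
    proof (cases "(a, b) \<in> conn (Q P)")
      case True
      then have "ncomp A (Q (insert e P)) = ncomp A (Q P)"
        unfolding QI by (intro ncomp_cong conn_insert_absorb)
      moreover have "ncomp A (R (insert e P)) \<le> ncomp A (R P)"
        unfolding RI by (rule ncomp_anti[OF A conn_mono]) auto
      ultimately show ?thesis using IH by simp
    next
      case False
      have 1: "ncomp A (Q (insert e P)) + 1 = ncomp A (Q P)"
        unfolding QI by (rule ncomp_insert[OF A ab(1,2) False])
      have "(a, b) \<notin> conn (R P)" using False RQ[of P] by auto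
      then have 2: "ncomp A (insert (a, b) (R P)) + 1 = ncomp A (R P)"
        by (rule ncomp_insert[OF A ab(1,2)])
      have g: "(c, \<gamma> c) \<in> conn (Q P)" for c
        using conn_incl[of "(c, \<gamma> c)" "Q P"] graph_ofI[of c \<gamma>] by (simp add: Q_def)
      \<comment> \<open>A walk between these end points either avoids the new edge or leads from
        \<open>\<gamma> a\<close> to \<open>b\<close>, both of which would connect \<open>a\<close>
        and \<open>b\<close> in \<open>Q P\<close>, or it leads from \<open>\<gamma> a\<close> to
        \<open>a\<close>, which \<open>i\<close> forbids because the edge is not a loop.\<close>
      have "(\<gamma> a, \<gamma> b) \<notin> conn (insert (a, b) (R P))"
      proof
        assume "(\<gamma> a, \<gamma> b) \<in> conn (insert (a, b) (R P))"
        from conn_insertD[OF this] consider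
          "(\<gamma> a, \<gamma> b) \<in> conn (R P)" | "(\<gamma> a, a) \<in> conn (R P)" | "(\<gamma> a, b) \<in> conn (R P)"
          by auto
        then show False
        proof cases
          case 1
          then have "(\<gamma> a, \<gamma> b) \<in> conn (Q P)" using RQ[of P] by auto
          then have "(a, b) \<in> conn (Q P)"
            using conn_trans[OF g conn_trans[OF _ conn_sym[OF g]]] by metis
          then show False using False by simp
        next
          case 2
          moreover have "conn (R P) \<subseteq> {(a, b). i a = i b}" by (rule ker) (rule prems)
          ultimately show False using ab(5) by auto
        next
          case 3
          then have "(a, b) \<in> conn (Q P)" using RQ[of P] conn_trans[OF g] by auto
          then show False using False by simp
        qed
      qed
      then have "ncomp A (R (insert e P)) + 1 = ncomp A (insert (a, b) (R P))"
        unfolding RI by (rule ncomp_insert[OF A \<gamma>ab])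
      then show ?thesis using IH 1 2 by simp
    qed
  qed
qed

section \<open>Pairing opposite edges inside the blocks\<close>

lemma balanced_block_involution:
  fixes s t :: "'a \<Rightarrow> 'v"
  assumes FG: "F \<inter> G = {}" "finite F" "finite G" "card F = card G"
  shows "\<exists>q. (\<forall>a\<in>F. q a \<in> G) \<and> (\<forall>a\<in>G. q a \<in> F) \<and> (\<forall>a\<in>F \<union> G. q (q a) = a)"
proof -
  obtain f where f: "bij_betw f F G" using finite_same_card_bij FG by metis
  define q where "q a = (if a \<in> F then f a else inv_into F f a)" for a
  have 1: "q a \<in> G" if "a \<in> F" for a using that f by (auto simp: q_def dest: bij_betwE)
  have 2: "q a \<in> F" "f (q a) = a" if "a \<in> G" for a
  proof -
    have aF: "a \<in> f ` F" "a \<notin> F" using that f FG(1) by (auto simp: bij_betw_def)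
    then show "q a \<in> F" "f (q a) = a" using inv_into_into[OF aF(1)] f_inv_into_f[OF aF(1)] by (simp_all add: q_def)
  qed
  have "q (q a) = a" if "a \<in> F" for a
  proof -
    have "q a \<in> G" "q a = f a" using 1[OF that] that by (auto simp: q_def)
    moreover have "q a \<notin> F" using calculation(1) FG(1) by auto
    ultimately have "q (q a) = inv_into F f (f a)" by (simp add: q_def)
    also have "\<dots> = a" using inv_into_f_f[of f F a] f that by (simp add: bij_betw_def)
    finally show ?thesis .
  qed
  moreover have "q (q a) = a" if "a \<in> G" for a
    using 2[OF that] by (simp add: q_def)
  ultimately show ?thesis using 1 2 by (intro exI[of _ q]) auto
qed

text \<open>
  Position \<open>l\<close> stands for a directed edge from \<open>i l\<close> to \<open>i (\<gamma> l)\<close>. In a balanced block,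
  the edges run between two vertices, equally often in both directions, and loops come in pairs.
\<close>

definition balanced_block :: "('a \<Rightarrow> 'a) \<Rightarrow> ('a \<Rightarrow> 'v) \<Rightarrow> 'a set \<Rightarrow> bool" where
  "balanced_block \<gamma> i C \<longleftrightarrow> (\<exists>F G u v. F \<inter> G = {} \<and> F \<union> G = C \<and> card F = card G \<and>
     (\<forall>l\<in>F. i l = u \<and> i (\<gamma> l) = v) \<and> (\<forall>l\<in>G. i l = v \<and> i (\<gamma> l) = u) \<and> (u = v \<longrightarrow> card C = 2))"

text \<open>\<open>i (\<gamma> (q a)) = i a\<close> says that the partner of \<open>a\<close> ends
  where \<open>a\<close> starts, which keeps \<open>i\<close> constant along
  \<open>\<gamma> \<circ> q\<close>. \<open>F\<close> contains an edge of each pair, so gluing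
  \<open>F\<close> together connects the whole block. The last clause excludes loops only if
  \<open>F\<close> has at least two elements.\<close>

definition paired :: "('a \<Rightarrow> 'a) \<Rightarrow> ('a \<Rightarrow> 'v) \<Rightarrow> 'a set \<Rightarrow> ('a \<Rightarrow> 'a) \<Rightarrow> 'a set \<Rightarrow> bool" where
  "paired \<gamma> i C q F \<longleftrightarrow> F \<subseteq> C \<and>
     (\<forall>a\<in>C. q a \<in> C \<and> q (q a) = a \<and> q a \<noteq> a \<and> i (\<gamma> (q a)) = i a \<and> (a \<in> F \<or> q a \<in> F)) \<and>
     (\<forall>a\<in>F. \<forall>b\<in>F. a \<noteq> b \<longrightarrow> i a = i b \<and> i (\<gamma> a) = i (\<gamma> b) \<and> i a \<noteq> i (\<gamma> a))"

text \<open>\<open>F\<close> is the half of the block with edges from \<open>u\<close> to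
  \<open>v\<close>. If \<open>u = v\<close>, the block has two elements and \<open>F\<close> has
  one, so two distinct edges in \<open>F\<close> are never loops.\<close>

lemma balanced_block_paired:
  assumes C: "finite C" and bal: "balanced_block \<gamma> i C"
  shows "\<exists>q F. paired \<gamma> i C q F"
proof -
  obtain F G u v where FG: "F \<inter> G = {}" "F \<union> G = C" "card F = card G"
    and F: "\<And>l. l \<in> F \<Longrightarrow> i l = u \<and> i (\<gamma> l) = v" and G: "\<And>l. l \<in> G \<Longrightarrow> i l = v \<and> i (\<gamma> l) = u"
    and uv: "u = v \<Longrightarrow> card C = 2"
    using bal unfolding balanced_block_def by metis
  have fin: "finite F" "finite G" using C FG(2) by auto
  obtain q where q: "\<And>a. a \<in> F \<Longrightarrow> q a \<in> G" "\<And>a. a \<in> G \<Longrightarrow> q a \<in> F" "\<And>a. a \<in> F \<union> G \<Longrightarrow> q (q a) = a"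
    using balanced_block_involution[OF FG(1) fin FG(3)] by metis
  have pairs: "q a \<in> C \<and> q (q a) = a \<and> q a \<noteq> a \<and> i (\<gamma> (q a)) = i a \<and> (a \<in> F \<or> q a \<in> F)" if "a \<in> C" for a
  proof (cases "a \<in> F")
    case True
    have "q a \<in> G" by (rule q(1)[OF True])
    moreover have "a \<notin> G" using True FG(1) by auto
    ultimately have "q a \<noteq> a" by auto
    then show ?thesis using True \<open>q a \<in> G\<close> q(3)[of a] F[of a] G[of "q a"] FG(2) by auto
  next
    case False
    then have aG: "a \<in> G" using that FG(2) by auto
    have "q a \<in> F" by (rule q(2)[OF aG])
    then have "q a \<noteq> a" using False by auto
    then show ?thesis using aG \<open>q a \<in> F\<close> q(3)[of a] G[of a] F[of "q a"] FG(2) by auto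
  qed
  have parallel: "i a = i b \<and> i (\<gamma> a) = i (\<gamma> b) \<and> i a \<noteq> i (\<gamma> a)" if "a \<in> F" "b \<in> F" "a \<noteq> b" for a b
  proof -
    have "u \<noteq> v"
    proof
      assume "u = v"
      then have "card C = 2" by (rule uv)
      then have "card F + card G = 2" using card_Un_disjoint[OF fin FG(1)] FG(2) by simp
      then have "card F = 1" using FG(3) by simp
      then show False using that by (auto simp: card_1_singleton_iff)
    qed
    then show ?thesis using F that by auto
  qed
  have "paired \<gamma> i C q F" unfolding paired_def
    by (intro conjI ballI impI pairs[THEN conjunct1] pairs[THEN conjunct2, THEN conjunct1]
        pairs[THEN conjunct2, THEN conjunct2, THEN conjunct1]
        pairs[THEN conjunct2, THEN conjunct2, THEN conjunct2, THEN conjunct1]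
        pairs[THEN conjunct2, THEN conjunct2, THEN conjunct2, THEN conjunct2]
        parallel[THEN conjunct1] parallel[THEN conjunct2, THEN conjunct1]
        parallel[THEN conjunct2, THEN conjunct2])
      (use FG(2) in auto)
  then show ?thesis by blast
qed

text \<open>\<open>i\<close> is constant on the classes of \<open>R\<close>, whose number therefore
  bounds that of the vertices. The constant 4 on the right comes from \<open>Q\<close> having at
  most one component, and moving all of \<open>A\<close> by \<open>p\<close> turns the support into
  \<open>card A\<close>.\<close>

theorem card_vertices_le:
  fixes i :: "'a \<Rightarrow> 'v"
  assumes A: "finite A" and \<gamma>: "\<gamma> permutes A" and \<tau>: "partition_on A \<tau>"
    and bal: "\<And>C. C \<in> \<tau> \<Longrightarrow> balanced_block \<gamma> i C"
    and connected: "\<And>a b. a \<in> A \<Longrightarrow> b \<in> A \<Longrightarrow>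
      (a, b) \<in> conn (graph_of \<gamma> \<union> {(a, b). \<exists>C\<in>\<tau>. a \<in> C \<and> b \<in> C})"
  shows "2 * card (i ` A) + 2 * ncomp A (graph_of \<gamma>) \<le> card A + 4"
proof -
  have sub: "C \<subseteq> A" if "C \<in> \<tau>" for C using partition_onD1[OF \<tau>] that by auto
  have "\<forall>C\<in>\<tau>. \<exists>q F. paired \<gamma> i C q F"
    by (intro ballI balanced_block_paired[OF finite_subset[OF sub A] bal])
  then obtain q F where qF: "\<And>C. C \<in> \<tau> \<Longrightarrow> paired \<gamma> i C (q C) (F C)" by metis
  have q: "q C a \<in> C \<and> q C (q C a) = a \<and> q C a \<noteq> a \<and> i (\<gamma> (q C a)) = i a \<and> (a \<in> F C \<or> q C a \<in> F C)"
    if "C \<in> \<tau>" "a \<in> C" for C a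
    using qF[OF that(1)] that(2) unfolding paired_def by blast
  have F: "C \<in> \<tau> \<Longrightarrow> F C \<subseteq> C"
      "C \<in> \<tau> \<Longrightarrow> a \<in> F C \<Longrightarrow> b \<in> F C \<Longrightarrow> a \<noteq> b \<Longrightarrow> i a = i b \<and> i (\<gamma> a) = i (\<gamma> b) \<and> i a \<noteq> i (\<gamma> a)" for C a b
    using qF[of C] unfolding paired_def by blast+
  have "\<forall>a\<in>A. \<exists>C\<in>\<tau>. a \<in> C" using partition_onD1[OF \<tau>] by auto
  then obtain bl where bl: "\<And>a. a \<in> A \<Longrightarrow> bl a \<in> \<tau> \<and> a \<in> bl a" by metis
  have bl_eq: "bl a = C" if "C \<in> \<tau>" "a \<in> C" for a C
  proof -
    have "a \<in> A" using sub that by auto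
    then have "bl a \<in> \<tau>" "a \<in> bl a" using bl by auto
    then show ?thesis using partition_onD2[OF \<tau>] that by (auto simp: disjoint_def)
  qed
  \<comment> \<open>The involutions of the blocks are combined; since each preserves its block, the
    result is an involution as well.\<close>
  define p where "p a = (if a \<in> A then q (bl a) a else a)" for a
  have pA: "p a \<in> bl a" "p a \<in> A" "p (p a) = a" "p a \<noteq> a" "i (\<gamma> (p a)) = i a" if a: "a \<in> A" for a
  proof -
    note q' = q[of "bl a" a] bl[OF a]
    show "p a \<in> bl a" using q' a by (simp add: p_def)
    then show "p a \<in> A" using sub bl[OF a] by auto
    have "bl (p a) = bl a" using bl_eq[of "bl a" "p a"] \<open>p a \<in> bl a\<close> q' by simp
    then show "p (p a) = a" using q' a \<open>p a \<in> A\<close> by (simp add: p_def)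
    show "p a \<noteq> a" "i (\<gamma> (p a)) = i a" using q' a by (simp_all add: p_def)
  qed
  have pp: "p (p a) = a" for a using pA(3) by (cases "a \<in> A") (simp_all add: p_def)
  have perm: "p permutes A"
  proof (rule bij_imp_permutes)
    show "bij_betw p A A" by (rule bij_betw_byWitness[where f'=p]) (use pA in auto)
    show "p x = x" if "x \<notin> A" for x using that by (simp add: p_def)
  qed
  have supp: "{a. p a \<noteq> a} = A" using pA(4) by (auto simp: p_def)
  \<comment> \<open>It suffices to glue the selected edges \<open>F C\<close> to each other, because
    \<open>p\<close> connects every other edge of the block to one of them.\<close>
  define P where "P = {(a, b). \<exists>C\<in>\<tau>. a \<in> F C \<and> b \<in> F C \<and> a \<noteq> b}"
  have Pi: "a \<in> A \<and> b \<in> A \<and> i a = i b \<and> i (\<gamma> a) = i (\<gamma> b) \<and> i a \<noteq> i (\<gamma> a)" if ab: "(a, b) \<in> P" for a b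
  proof -
    obtain C where C: "C \<in> \<tau>" "a \<in> F C" "b \<in> F C" "a \<noteq> b" using ab by (auto simp: P_def)
    then have "a \<in> A" "b \<in> A" using F(1)[OF C(1)] sub[OF C(1)] by auto
    then show ?thesis using F(2)[OF C] by blast
  qed
  have finP: "finite P" 
  proof (rule finite_subset)
    show "P \<subseteq> A \<times> A" by (rule subrelI) (use Pi in blast)
  qed (use A in simp)
  define R where "R = graph_of (\<gamma> \<circ> p) \<union> P \<union> {(\<gamma> a, \<gamma> b) | a b. (a, b) \<in> P}"
  define Q where "Q = graph_of \<gamma> \<union> graph_of p \<union> P"
  have main: "2 * ncomp A R + 2 * ncomp A (graph_of \<gamma>) \<le> card A + 4 * ncomp A Q"
    and ker: "conn R \<subseteq> {(a, b). i a = i b}"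
    unfolding R_def Q_def
    by (rule glue_parallel_edges[OF A \<gamma> perm pp supp pA(5) finP Pi]; assumption)+
  have block: "(a, b) \<in> conn Q" if C: "C \<in> \<tau>" "a \<in> C" "b \<in> C" for a b C
  proof -
    have r: "\<exists>c\<in>F C. (d, c) \<in> conn Q" if d: "d \<in> C" for d
    proof (cases "d \<in> F C")
      case True
      then show ?thesis using conn_refl[of d Q] by auto
    next
      case False
      have "p d = q C d" using bl_eq[OF C(1) d] sub[OF C(1)] d by (auto simp: p_def)
      moreover have "q C d \<in> F C" using q[OF C(1) d] False by simp
      moreover have "(d, p d) \<in> conn Q"
        using graph_ofI[of d p] conn_incl[of "(d, p d)" Q] by (simp add: Q_def)
      ultimately show ?thesis by auto
    qed
    obtain c d where c: "c \<in> F C" "(a, c) \<in> conn Q" and d: "d \<in> F C" "(b, d) \<in> conn Q"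
      using r C by metis
    have "(c, d) \<in> conn Q"
    proof (cases "c = d")
      case True
      then show ?thesis using conn_refl by simp
    next
      case False
      then have "(c, d) \<in> P" using c d C(1) by (auto simp: P_def)
      then show ?thesis by (intro conn_incl) (simp add: Q_def)
    qed
    then show ?thesis using c(2) conn_sym[OF d(2)] conn_trans by metis
  qed
  have "conn (graph_of \<gamma> \<union> {(a, b). \<exists>C\<in>\<tau>. a \<in> C \<and> b \<in> C}) \<subseteq> conn Q"
  proof (rule conn_subset_conn)
    have "graph_of \<gamma> \<subseteq> conn Q" using conn_incl[of _ Q] by (auto simp: Q_def)
    then show "graph_of \<gamma> \<union> {(a, b). \<exists>C\<in>\<tau>. a \<in> C \<and> b \<in> C} \<subseteq> conn Q"
      using block by auto
  qed
  then have full: "(a, b) \<in> conn Q" if "a \<in> A" "b \<in> A" for a b using connected[OF that] by auto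
  have nQ: "ncomp A Q \<le> 1"
  proof (cases "A = {}")
    case True
    then show ?thesis by (simp add: ncomp_def quotient_eq_image)
  next
    case False
    then obtain a where a: "a \<in> A" by auto
    have "A // conn Q \<subseteq> {conn Q `` {a}}"
      unfolding quotient_eq_image
    proof (rule image_subsetI)
      fix b assume "b \<in> A"
      then show "conn Q `` {b} \<in> {conn Q `` {a}}" using conn_class_eq_iff[of Q b a] full a by simp
    qed
    then show ?thesis unfolding ncomp_def using card_mono[of "{conn Q `` {a}}"] by simp
  qed
  have "card (i ` A) \<le> ncomp A R"
  proof -
    define rep where "rep v = (SOME a. a \<in> A \<and> i a = v)" for v
    have rep: "rep v \<in> A" "i (rep v) = v" if "v \<in> i ` A" for v
      using someI_ex[of "\<lambda>a. a \<in> A \<and> i a = v"] that by (auto simp: rep_def)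
    have "inj_on (\<lambda>v. conn R `` {rep v}) (i ` A)"
    proof (rule inj_onI)
      fix v w assume vw: "v \<in> i ` A" "w \<in> i ` A" "conn R `` {rep v} = conn R `` {rep w}"
      then have "(rep v, rep w) \<in> conn R" by (simp add: conn_class_eq_iff)
      then have "i (rep v) = i (rep w)" using ker by auto
      then show "v = w" unfolding rep(2)[OF vw(1)] rep(2)[OF vw(2)] .
    qed
    moreover have "(\<lambda>v. conn R `` {rep v}) ` (i ` A) \<subseteq> A // conn R"
      unfolding quotient_eq_image by (rule image_subsetI) (rule imageI[OF rep(1)])
    moreover have "finite (A // conn R)" using A by (simp add: quotient_eq_image)
    ultimately show ?thesis unfolding ncomp_def by (rule card_inj_on_le)
  qed
  then show ?thesis using main nQ by simp
qed

section \<open>Gaussian moments and cumulants\<close>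

text \<open>For positive variance the recursion compares the explicit even and odd moments. The
  point mass satisfies it too, as its moments of positive order vanish together with
  \<open>v\<close>.\<close>

lemma normal_law_moments:
  assumes v: "v \<ge> 0"
  shows normal_law_integrable_power: "integrable (normal_law 0 v) (\<lambda>x. x ^ n)"
    and normal_law_moment_1: "(\<integral>x. x \<partial>normal_law 0 v) = 0"
    and normal_law_moment_Suc_Suc:
      "(\<integral>x. x ^ (n + 2) \<partial>normal_law 0 v) = real (n + 1) * v * (\<integral>x. x ^ n \<partial>normal_law 0 v)"
proof -
  have *: "integrable (normal_law 0 v) (\<lambda>x. x ^ n) \<and> (\<integral>x. x \<partial>normal_law 0 v) = 0 \<and>
    (\<integral>x. x ^ (n + 2) \<partial>normal_law 0 v) = real (n + 1) * v * (\<integral>x. x ^ n \<partial>normal_law 0 v)" for n :: nat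
  proof (cases "v = 0")
    case True
    interpret P: prob_space "return borel (0::real)" by (rule prob_space_return) simp
    have "integrable (return borel (0::real)) (\<lambda>x. x ^ n)"
    proof (rule P.integrable_const_bound[where B="0 ^ n"])
      show "AE x in return borel (0::real). norm (x ^ n) \<le> 0 ^ n"
        by (subst AE_return) (auto simp: norm_power)
    qed simp
    then show ?thesis using True by (simp add: normal_law_def integral_return)
  next
    case False
    define s where "s = sqrt v"
    have s: "s > 0" "s\<^sup>2 = v" using v False by (auto simp: s_def)
    have law: "normal_law 0 v = density lborel (\<lambda>x. ennreal (normal_density 0 s x))"
      using False by (simp add: normal_law_def s_def)
    have int: "(\<integral>x. x ^ k \<partial>normal_law 0 v) = (\<integral>x. normal_density 0 s x * x ^ k \<partial>lborel)" for k
      unfolding law by (subst integral_density) auto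
    have "integrable (normal_law 0 v) (\<lambda>x. x ^ n)"
      unfolding law using integrable_normal_moment[OF s(1), of 0 n]
      by (subst integrable_density) auto
    moreover have "(\<integral>x. x \<partial>normal_law 0 v) = 0"
      using int[of 1] integral_normal_moment_odd[OF s(1), of 0 0] by simp
    moreover have "(\<integral>x. x ^ (n + 2) \<partial>normal_law 0 v) = real (n + 1) * v * (\<integral>x. x ^ n \<partial>normal_law 0 v)"
    proof (cases "even n")
      case True
      then obtain k where k: "n = 2 * k" by (elim evenE)
      have "(\<integral>x. x ^ (n + 2) \<partial>normal_law 0 v) = fact (2 * (k + 1)) / ((2 / v) ^ (k + 1) * fact (k + 1))"
        using int[of "2 * (k + 1)"] integral_normal_moment_even[OF s(1), of 0 "k + 1"] k s by simp
      also have "\<dots> = real (n + 1) * v * (fact (2 * k) / ((2 / v) ^ k * fact k))"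
        using False k by (simp add: field_simps del: of_nat_Suc) (simp add: field_simps)
      also have "fact (2 * k) / ((2 / v) ^ k * fact k) = (\<integral>x. x ^ n \<partial>normal_law 0 v)"
        using int[of "2 * k"] integral_normal_moment_even[OF s(1), of 0 k] k s by simp
      finally show ?thesis .
    next
      case False
      then obtain k where k: "n = 2 * k + 1" by (elim oddE)
      have "(\<integral>x. x ^ n \<partial>normal_law 0 v) = 0" "(\<integral>x. x ^ (n + 2) \<partial>normal_law 0 v) = 0"
        using int[of "2 * k + 1"] integral_normal_moment_odd[OF s(1), of 0 k]
          int[of "2 * (k + 1) + 1"] integral_normal_moment_odd[OF s(1), of 0 "k + 1"] k by simp_all
      then show ?thesis by simp
    qed
    ultimately show ?thesis by simp
  qed
  show "integrable (normal_law 0 v) (\<lambda>x. x ^ n)" "(\<integral>x. x \<partial>normal_law 0 v) = 0"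
    "(\<integral>x. x ^ (n + 2) \<partial>normal_law 0 v) = real (n + 1) * v * (\<integral>x. x ^ n \<partial>normal_law 0 v)"
    using * by blast+
qed

text \<open>Wick's formula: in the recursion at \<open>b\<close> only the pairs
  \<open>{b, c}\<close> contribute. There are \<open>card B - 1\<close> of them and each leaves a
  moment of order \<open>card B - 2\<close>, which is exactly the recursion for \<open>g\<close>;
  the case of a singleton is \<open>g 1 = 0\<close>.\<close>

lemma set_cumulant_gaussian:
  fixes g :: "nat \<Rightarrow> complex"
  assumes g: "g 0 = 1" "g 1 = 0" "\<And>n. g (n + 2) = of_nat (n + 1) * v * g n"
    and C: "finite C" "C \<noteq> {}"
  shows "set_cumulant (\<lambda>V. g (card V)) C = (if card C = 2 then v else 0)"
proof (rule set_cumulant_unique[where A=C and k="\<lambda>C. if card C = 2 then v else 0"])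
  fix B assume B: "B \<subseteq> C" "B \<noteq> {}"
  then obtain b where b: "b \<in> B" by auto
  have finB: "finite B" using finite_subset[OF B(1) C(1)] .
  have fin: "finite {D. b \<in> D \<and> D \<subseteq> B}" using finB by auto
  have "(\<Sum>D | b \<in> D \<and> D \<subseteq> B. (if card D = 2 then v else 0) * g (card (B - D))) =
      (\<Sum>D \<in> (\<lambda>c. {b, c}) ` (B - {b}). (if card D = 2 then v else 0) * g (card (B - D)))"
  proof (rule sum.mono_neutral_right[OF fin])
    show "(\<lambda>c. {b, c}) ` (B - {b}) \<subseteq> {D. b \<in> D \<and> D \<subseteq> B}" using b by auto
    show "\<forall>D \<in> {D. b \<in> D \<and> D \<subseteq> B} - (\<lambda>c. {b, c}) ` (B - {b}). (if card D = 2 then v else 0) * g (card (B - D)) = 0"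
    proof
      fix D assume D: "D \<in> {D. b \<in> D \<and> D \<subseteq> B} - (\<lambda>c. {b, c}) ` (B - {b})"
      have "card D \<noteq> 2"
      proof
        assume "card D = 2"
        then obtain x y where xy: "D = {x, y}" "x \<noteq> y" by (auto simp: card_2_iff)
        then have "D = {b, x} \<and> x \<noteq> b \<or> D = {b, y} \<and> y \<noteq> b" using D by auto
        then show False using D xy by auto
      qed
      then show "(if card D = 2 then v else 0) * g (card (B - D)) = 0" by simp
    qed
  qed
  also have "\<dots> = (\<Sum>c \<in> B - {b}. v * g (card B - 2))"
  proof (subst sum.reindex)
    show "inj_on (\<lambda>c. {b, c}) (B - {b})" by (rule inj_onI) (auto simp: doubleton_eq_iff)
    show "sum ((\<lambda>D. (if card D = 2 then v else 0) * g (card (B - D))) \<circ> (\<lambda>c. {b, c})) (B - {b}) =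
      (\<Sum>c \<in> B - {b}. v * g (card B - 2))"
    proof (rule sum.cong[OF refl])
      fix c assume c: "c \<in> B - {b}"
      then have "card {b, c} = 2" "card (B - {b, c}) = card B - 2"
        using b finB by (auto simp: card_Diff_subset)
      then show "((\<lambda>D. (if card D = 2 then v else 0) * g (card (B - D))) \<circ> (\<lambda>c. {b, c})) c = v * g (card B - 2)"
        by simp
    qed
  qed
  also have "\<dots> = of_nat (card B - 1) * (v * g (card B - 2))"
    using b finB by simp
  also have "\<dots> = g (card B)"
  proof (cases "card B \<ge> 2")
    case True
    then obtain n where "card B = n + 2" by (metis le_add_diff_inverse2)
    then show ?thesis using g(3)[of n] by (simp add: mult_ac)
  next
    case False
    moreover have "card B > 0" using b finB by (auto simp: card_gt_0_iff)
    ultimately have "card B = 1" by simp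
    then show ?thesis using g(2) by simp
  qed
  finally show "\<exists>b\<in>B. g (card B) = (\<Sum>D | b \<in> D \<and> D \<subseteq> B. (if card D = 2 then v else 0) * g (card (B - D)))"
    using b by (intro bexI[of _ b]) simp_all
qed (use C g in auto)

section \<open>Cumulants of the entries of a complex Wigner matrix\<close>

text \<open>In the recursion at 1, the term with \<open>C = {1}\<close> carries the mean of
  \<open>y 2\<close>, which is 0.\<close>

lemma cumulant_pair:
  assumes "prob_space M" and "(\<integral>\<omega>. y (2::nat) \<omega> \<partial>M) = 0"
  shows "cumulant M {1..2} y = (\<integral>\<omega>. y 1 \<omega> * y 2 \<omega> \<partial>M)"
proof -
  interpret prob_space M by (rule assms)
  define f where "f V = (\<integral>\<omega>. (\<Prod>i\<in>V. y i \<omega>) \<partial>M)" for V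
  have f0: "f {} = 1" by (simp add: f_def prob_space)
  have sets: "{C. (1::nat) \<in> C \<and> C \<subseteq> {1, 2}} = {{1}, {1, 2}}" by auto
  have eq: "{1..2} = {1, 2::nat}" by auto
  have "f {1, 2} = set_cumulant f {1, 2}"
    using set_cumulant_recursion[of "{1, 2}" 1 f, OF _ _ f0] assms(2) f0
    unfolding sets by (simp add: f_def insert_Diff_if prob_space)
  then show ?thesis
    unfolding cumulant_eq_set_cumulant eq by (simp add: f_def[abs_def])
qed

text \<open>Moves a block of positions to the standard index set used in \<open>R_diagonal\<close>
  and \<open>alternating_cumulant\<close>. The variables are compared on \<open>space M\<close>
  only, because the matrix is assumed self-adjoint only there.\<close>

lemma cumulant_reindex:
  assumes M: "prob_space M" and h: "bij_betw h {1..n::nat} C" and n: "n > 0"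
    and y: "\<And>k \<omega>. k \<in> {1..n} \<Longrightarrow> \<omega> \<in> space M \<Longrightarrow> y (h k) \<omega> = z k \<omega>"
  shows "cumulant M C y = cumulant M {1..n} z"
proof -
  interpret prob_space M by (rule M)
  define f where "f V = (\<integral>\<omega>. (\<Prod>i\<in>V. y i \<omega>) \<partial>M)" for V
  have f0: "f {} = 1" by (simp add: f_def prob_space)
  have inj: "inj_on h {1..n}" and img: "h ` {1..n} = C" using h by (auto simp: bij_betw_def)
  have "cumulant M C y = set_cumulant f (h ` {1..n})"
    unfolding img by (simp add: cumulant_eq_set_cumulant f_def[abs_def])
  also have "\<dots> = set_cumulant (\<lambda>V. f (h ` V)) {1..n}"
    by (rule set_cumulant_reindex[where f=f]) (use n inj f0 in auto)
  also have "\<dots> = cumulant M {1..n} z"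
    unfolding cumulant_eq_set_cumulant
  proof (rule set_cumulant_cong)
    fix V assume V: "V \<subseteq> {1..n}"
    show "f (h ` V) = (\<integral>\<omega>. (\<Prod>i\<in>V. z i \<omega>) \<partial>M)"
      unfolding f_def
    proof (rule Bochner_Integration.integral_cong[OF refl])
      fix \<omega> assume \<omega>: "\<omega> \<in> space M"
      have "(\<Prod>i\<in>h ` V. y i \<omega>) = (\<Prod>k\<in>V. y (h k) \<omega>)"
        using prod.reindex[OF inj_on_subset[OF inj V], of "\<lambda>i. y i \<omega>"] by simp
      also have "\<dots> = (\<Prod>k\<in>V. z k \<omega>)" by (rule prod.cong[OF refl]) (use y V \<omega> in auto)
      finally show "(\<Prod>i\<in>h ` V. y i \<omega>) = (\<Prod>k\<in>V. z k \<omega>)" .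
    qed
  qed
  finally show ?thesis .
qed

locale complex_wigner_matrix =
  fixes N :: nat and \<beta> :: "nat \<Rightarrow> real" and M :: "'a measure" and x :: "nat \<Rightarrow> nat \<Rightarrow> 'a \<Rightarrow> complex"
  assumes wigner: "complex_wigner N \<beta> M x"
begin

sublocale prob_space M
  by (rule wigner[unfolded complex_wigner_def, THEN conjunct1])

lemmas entry_cnj =
  wigner[unfolded complex_wigner_def, THEN conjunct2, THEN conjunct1, rule_format]

lemmas entry_integrable =
  wigner[unfolded complex_wigner_def, THEN conjunct2, THEN conjunct2, THEN conjunct1, rule_format, THEN conjunct1]

lemmas entry_mean =
  wigner[unfolded complex_wigner_def, THEN conjunct2, THEN conjunct2, THEN conjunct1, rule_format, THEN conjunct2]

lemmas entry_measurable = borel_measurable_integrable[OF entry_integrable]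

lemmas indep_entries =
  wigner[unfolded complex_wigner_def, THEN conjunct2, THEN conjunct2, THEN conjunct2, THEN conjunct1]

lemma entry_R_diagonal: "1 \<le> i \<Longrightarrow> i < j \<Longrightarrow> j \<le> N \<Longrightarrow> R_diagonal M (x i j)"
  using wigner[unfolded complex_wigner_def, THEN conjunct2, THEN conjunct2, THEN conjunct2, THEN conjunct2, THEN conjunct2, THEN conjunct1, rule_format, of i j] by simp

lemma entry_alternating:
  "1 \<le> i \<Longrightarrow> i < j \<Longrightarrow> j \<le> N \<Longrightarrow> n \<ge> 1 \<Longrightarrow> alternating_cumulant M (x i j) (2 * n) = complex_of_real (\<beta> (2 * n))"
  using wigner[unfolded complex_wigner_def, THEN conjunct2, THEN conjunct2, THEN conjunct2, THEN conjunct2, THEN conjunct2, THEN conjunct1, rule_format, of i j] by simp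

lemmas entry_diagonal_law =
  wigner[unfolded complex_wigner_def, THEN conjunct2, THEN conjunct2, THEN conjunct2, THEN conjunct2, THEN conjunct2, THEN conjunct2, rule_format]

text \<open>\<open>\<beta> 2\<close> is the second absolute moment of an off-diagonal entry, and
  such an entry requires \<open>N \<ge> 2\<close>. Since \<open>\<beta>\<close> is common to all
  sizes, the inequality is then available for N = 1 too.\<close>

lemma \<beta>_2_nonneg:
  assumes "N \<ge> 2"
  shows "\<beta> 2 \<ge> 0"
proof -
  define y where "y k \<omega> = (if odd k then x 1 2 \<omega> else cnj (x 1 2 \<omega>))" for k :: nat and \<omega>
  have "(\<integral>\<omega>. cnj (x 1 2 \<omega>) \<partial>M) = 0"
    using entry_mean[of 1 2] assms by simp
  then have "(\<integral>\<omega>. y 2 \<omega> \<partial>M) = 0" by (simp add: y_def)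
  from cumulant_pair[where y=y, OF prob_space_axioms this]
  have "alternating_cumulant M (x 1 2) 2 = (\<integral>\<omega>. x 1 2 \<omega> * cnj (x 1 2 \<omega>) \<partial>M)"
    unfolding alternating_cumulant_def y_def[abs_def] by simp
  moreover have "complex_of_real (\<beta> 2) = alternating_cumulant M (x 1 2) 2"
    using entry_alternating[of 1 2 1] assms by simp
  ultimately have "complex_of_real (\<beta> 2) = (\<integral>\<omega>. x 1 2 \<omega> * cnj (x 1 2 \<omega>) \<partial>M)" by simp
  also have "\<dots> = (\<integral>\<omega>. complex_of_real ((cmod (x 1 2 \<omega>))\<^sup>2) \<partial>M)"
    by (simp only: complex_norm_square)
  also have "\<dots> = complex_of_real (\<integral>\<omega>. (cmod (x 1 2 \<omega>))\<^sup>2 \<partial>M)"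
    by (rule integral_complex_of_real)
  finally have "\<beta> 2 = (\<integral>\<omega>. (cmod (x 1 2 \<omega>))\<^sup>2 \<partial>M)"
    by (simp only: of_real_eq_iff)
  then show ?thesis by simp
qed

lemma entry_diagonal_Im:
  assumes "i \<in> {1..N}" "\<omega> \<in> space M"
  shows "Im (x i i \<omega>) = 0"
  using arg_cong[OF entry_cnj[OF assms(1) assms], of Im] by simp

text \<open>Above the diagonal this is part of \<open>R_diagonal\<close>, below it follows by
  conjugation, and on it from the moments of the normal law, whose variance is
  \<open>\<beta> 2\<close>.\<close>

lemma entry_integrable_power:
  assumes \<beta>: "\<beta> 2 \<ge> 0" and ij: "i \<in> {1..N}" "j \<in> {1..N}"
  shows "integrable M (\<lambda>\<omega>. norm (x i j \<omega>) ^ n)"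
proof (cases i j rule: linorder_cases)
  case less
  then show ?thesis using entry_R_diagonal[of i j] ij by (simp add: R_diagonal_def)
next
  case greater
  have "integrable M (\<lambda>\<omega>. norm (x j i \<omega>) ^ n)"
    using entry_R_diagonal[of j i] ij greater by (simp add: R_diagonal_def)
  moreover have "norm (x j i \<omega>) = norm (x i j \<omega>)" if "\<omega> \<in> space M" for \<omega>
    using entry_cnj[OF ij that] by simp
  ultimately show ?thesis
    using Bochner_Integration.integrable_cong[of M M "\<lambda>\<omega>. norm (x j i \<omega>) ^ n" "\<lambda>\<omega>. norm (x i j \<omega>) ^ n"] by simp
next
  case equal
  have m: "(\<lambda>\<omega>. Re (x i i \<omega>)) \<in> borel_measurable M" using entry_measurable[OF ij(1) ij(1)] by measurable
  have "integrable (distr M borel (\<lambda>\<omega>. Re (x i i \<omega>))) (\<lambda>t. t ^ n)"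
    unfolding entry_diagonal_law[OF ij(1)] by (rule normal_law_integrable_power[OF \<beta>])
  then have "integrable M (\<lambda>\<omega>. Re (x i i \<omega>) ^ n)"
    by (subst (asm) integrable_distr_eq[OF m]) auto
  then have "integrable M (\<lambda>\<omega>. norm (Re (x i i \<omega>) ^ n))" by (rule integrable_norm)
  moreover have "norm (Re (x i i \<omega>) ^ n) = norm (x i j \<omega>) ^ n" if "\<omega> \<in> space M" for \<omega>
    using entry_diagonal_Im[OF ij(1) that] equal by (simp add: power_abs cmod_eq_Re)
  ultimately show ?thesis
    using Bochner_Integration.integrable_cong[of M M "\<lambda>\<omega>. norm (Re (x i i \<omega>) ^ n)" "\<lambda>\<omega>. norm (x i j \<omega>) ^ n"] by simp
qed

text \<open>Names the independent entry, on or above the diagonal, of which the entry at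
  \<open>u\<close>, \<open>v\<close> is a copy or the conjugate.\<close>

definition entry_key :: "nat \<Rightarrow> nat \<Rightarrow> nat \<times> nat" where
  "entry_key u v = (min u v, max u v)"

lemma entry_via_key:
  assumes "u \<in> {1..N}" "v \<in> {1..N}" "\<omega> \<in> space M"
  shows "x u v \<omega> = (if u \<le> v then case_prod x (entry_key u v) \<omega> else cnj (case_prod x (entry_key u v) \<omega>))"
proof (cases "u \<le> v")
  case False
  then show ?thesis using entry_cnj[OF assms] by (simp add: entry_key_def min_def max_def)
qed (simp add: entry_key_def min_def max_def)

text \<open>Factors with the same key are functions of one entry, so the product regroups into
  independent factors \<open>H k\<close>. These are integrable because the modulus of
  \<open>H k z\<close> is a power of the modulus of \<open>z\<close>.\<close>

lemma moment_prod_keys: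
  assumes \<beta>: "\<beta> 2 \<ge> 0" and V: "finite V" and uv: "\<And>l. l \<in> V \<Longrightarrow> u l \<in> {1..N} \<and> v l \<in> {1..N}"
  defines "key \<equiv> \<lambda>l. entry_key (u l) (v l)"
  shows "(\<integral>\<omega>. (\<Prod>l\<in>V. x (u l) (v l) \<omega>) \<partial>M) =
      (\<Prod>k\<in>key ` V. \<integral>\<omega>. (\<Prod>l | l \<in> V \<and> key l = k. x (u l) (v l) \<omega>) \<partial>M)" (is ?eq)
    and "integrable M (\<lambda>\<omega>. \<Prod>l\<in>V. x (u l) (v l) \<omega>)" (is ?int)
proof -
  define H :: "nat \<times> nat \<Rightarrow> complex \<Rightarrow> complex" where
    "H k z = (\<Prod>l | l \<in> V \<and> key l = k. if u l \<le> v l then z else cnj z)" for k z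
  have fin: "finite {l. l \<in> V \<and> key l = k}" for k using V by simp
  have H_meas: "H k \<in> borel_measurable borel" for k
    unfolding H_def
  proof (rule borel_measurable_prod)
    fix l
    show "(\<lambda>z. if u l \<le> v l then z else cnj z) \<in> borel_measurable borel"
      by (cases "u l \<le> v l") (auto intro!: borel_measurable_continuous_onI continuous_intros)
  qed
  have H_norm: "norm (H k z) = norm z ^ card {l. l \<in> V \<and> key l = k}" for k z
    unfolding H_def prod_norm[symmetric] by (simp add: if_distrib cong: if_cong)
  have H_x: "(\<Prod>l | l \<in> V \<and> key l = k. x (u l) (v l) \<omega>) = H k (case_prod x k \<omega>)" if "\<omega> \<in> space M" for k \<omega>
    unfolding H_def
  proof (rule prod.cong[OF refl])
    fix l assume l: "l \<in> {l. l \<in> V \<and> key l = k}"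
    then have "entry_key (u l) (v l) = k" "u l \<in> {1..N}" "v l \<in> {1..N}" using uv by (auto simp: key_def)
    then show "x (u l) (v l) \<omega> = (if u l \<le> v l then case_prod x k \<omega> else cnj (case_prod x k \<omega>))"
      using entry_via_key[of "u l" "v l" \<omega>] that by simp
  qed
  have keys: "key ` V \<subseteq> {(i, j). 1 \<le> i \<and> i \<le> j \<and> j \<le> N}"
  proof
    fix k assume "k \<in> key ` V"
    then obtain l where l: "l \<in> V" "k = key l" by auto
    show "k \<in> {(i, j). 1 \<le> i \<and> i \<le> j \<and> j \<le> N}" using uv[OF l(1)] l(2) by (auto simp: key_def entry_key_def)
  qed
  have ind: "indep_vars (\<lambda>_. borel) (\<lambda>k \<omega>. H k (case_prod x k \<omega>)) (key ` V)"
    by (rule indep_vars_compose2[OF indep_vars_subset[OF indep_entries keys]]) (rule H_meas)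
  have int: "integrable M (\<lambda>\<omega>. H k (case_prod x k \<omega>))" if k: "k \<in> key ` V" for k
  proof -
    obtain i j where ij: "k = (i, j)" by force
    then have "i \<in> {1..N}" "j \<in> {1..N}" using k keys by auto
    note e = entry_integrable_power[OF \<beta> this, of "card {l. l \<in> V \<and> key l = k}"] entry_measurable[OF this]
    show ?thesis
      by (rule Bochner_Integration.integrable_bound[OF e(1)])
        (use ij in \<open>auto simp: H_norm intro!: measurable_compose[OF e(2) H_meas]\<close>)
  qed
  have prod: "(\<Prod>l\<in>V. x (u l) (v l) \<omega>) = (\<Prod>k\<in>key ` V. H k (case_prod x k \<omega>))" if "\<omega> \<in> space M" for \<omega>
    using prod.group[of V "key ` V" key "\<lambda>l. x (u l) (v l) \<omega>"] V H_x[OF that] by simp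
  have "(\<integral>\<omega>. (\<Prod>l\<in>V. x (u l) (v l) \<omega>) \<partial>M) = (\<integral>\<omega>. (\<Prod>k\<in>key ` V. H k (case_prod x k \<omega>)) \<partial>M)"
    by (rule Bochner_Integration.integral_cong[OF refl prod])
  also have "\<dots> = (\<Prod>k\<in>key ` V. \<integral>\<omega>. H k (case_prod x k \<omega>) \<partial>M)"
    by (rule indep_vars_lebesgue_integral[OF _ ind int]) (use V in simp)
  also have "\<dots> = (\<Prod>k\<in>key ` V. \<integral>\<omega>. (\<Prod>l | l \<in> V \<and> key l = k. x (u l) (v l) \<omega>) \<partial>M)"
    by (rule prod.cong[OF refl], rule Bochner_Integration.integral_cong[OF refl H_x[symmetric]])
  finally show ?eq .
  have "integrable M (\<lambda>\<omega>. \<Prod>k\<in>key ` V. H k (case_prod x k \<omega>))"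
    by (rule indep_vars_integrable[OF _ ind int]) (use V in simp)
  then show ?int
    using Bochner_Integration.integrable_cong[OF refl prod, of M] by simp
qed

end

lemma balanced_block_singleton_edge:
  assumes "finite C" "\<And>l. l \<in> C \<Longrightarrow> i l = a \<and> i (\<gamma> l) = a" "C \<noteq> {}"
  shows "balanced_block \<gamma> i C \<longleftrightarrow> card C = 2"
proof
  assume "balanced_block \<gamma> i C"
  then obtain F G u v where FG: "F \<union> G = C" "card F = card G" "F \<inter> G = {}"
    and e: "\<And>l. l \<in> F \<Longrightarrow> i l = u \<and> i (\<gamma> l) = v" "\<And>l. l \<in> G \<Longrightarrow> i l = v \<and> i (\<gamma> l) = u"
    and uv: "u = v \<longrightarrow> card C = 2"
    unfolding balanced_block_def by metis
  obtain l where "l \<in> C" using assms(3) by auto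
  then have "u = v" using FG(1) e[of l] assms(2)[of l] by auto
  then show "card C = 2" using uv by simp
next
  assume "card C = 2"
  then obtain k l where kl: "C = {k, l}" "k \<noteq> l" by (auto simp: card_2_iff)
  show "balanced_block \<gamma> i C"
    unfolding balanced_block_def
    by (rule exI[of _ "{k}"], rule exI[of _ "{l}"], rule exI[of _ a], rule exI[of _ a])
      (use kl assms(2) in auto)
qed

text \<open>The two halves of a balanced block can only be the edges starting at \<open>a\<close>
  and those starting at \<open>b\<close>.\<close>

lemma balanced_block_edge:
  assumes C: "finite C" "C \<noteq> {}" and ab: "a \<noteq> b"
    and e: "\<And>l. l \<in> C \<Longrightarrow> (i l, i (\<gamma> l)) = (a, b) \<or> (i l, i (\<gamma> l)) = (b, a)"
  shows "balanced_block \<gamma> i C \<longleftrightarrow> card {l \<in> C. i l = a} = card {l \<in> C. i l = b}"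
proof
  assume "balanced_block \<gamma> i C"
  then obtain F G u v where FG: "F \<union> G = C" "card F = card G" "F \<inter> G = {}"
    and F: "\<And>l. l \<in> F \<Longrightarrow> i l = u \<and> i (\<gamma> l) = v" and G: "\<And>l. l \<in> G \<Longrightarrow> i l = v \<and> i (\<gamma> l) = u"
    unfolding balanced_block_def by metis
  obtain l where l: "l \<in> C" using C(2) by auto
  have "u = a \<and> v = b \<or> u = b \<and> v = a"
    using l FG(1) F[of l] G[of l] e[OF l] by auto
  moreover from this have "u \<noteq> v" using ab by auto
  then have "{l \<in> C. i l = u} = F" "{l \<in> C. i l = v} = G"
    unfolding FG(1)[symmetric] by (auto dest: F G)
  ultimately show "card {l \<in> C. i l = a} = card {l \<in> C. i l = b}" using FG(2) by auto
next
  assume "card {l \<in> C. i l = a} = card {l \<in> C. i l = b}"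
  then show "balanced_block \<gamma> i C"
    unfolding balanced_block_def
  proof (intro exI conjI)
    show "{l \<in> C. i l = a} \<inter> {l \<in> C. i l = b} = {}" using ab by auto
    show "{l \<in> C. i l = a} \<union> {l \<in> C. i l = b} = C" using e by auto
    show "\<forall>l\<in>{l \<in> C. i l = a}. i l = a \<and> i (\<gamma> l) = b" using e ab by auto
    show "\<forall>l\<in>{l \<in> C. i l = b}. i l = b \<and> i (\<gamma> l) = a" using e ab by auto
  qed (use ab in auto)
qed

lemma bij_betw_restrict:
  assumes h: "bij_betw h A C" and D: "D \<subseteq> C"
  shows "bij_betw h {a \<in> A. h a \<in> D} D"
proof (rule bij_betw_subset[OF h])
  show "h ` {a \<in> A. h a \<in> D} = D"
  proof (intro equalityI subsetI)
    fix y assume y: "y \<in> D"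
    then have "y \<in> h ` A" using D h by (auto simp: bij_betw_def)
    then show "y \<in> h ` {a \<in> A. h a \<in> D}" using y by auto
  qed auto
qed auto

context complex_wigner_matrix
begin

text \<open>\<open>S\<close> collects the positions with the key of \<open>k\<close>. Moments factor
  over keys, hence over \<open>S\<close> and its complement, and \<open>l\<close> lies outside
  \<open>S\<close>.\<close>

lemma cumulant_entries_mixed:
  assumes \<beta>: "\<beta> 2 \<ge> 0" and C: "finite C" and uv: "\<And>l. l \<in> C \<Longrightarrow> u l \<in> {1..N} \<and> v l \<in> {1..N}"
    and kl: "k \<in> C" "l \<in> C" "entry_key (u k) (v k) \<noteq> entry_key (u l) (v l)"
  shows "cumulant M C (\<lambda>l. x (u l) (v l)) = 0"
proof -
  define key where "key l = entry_key (u l) (v l)" for l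
  define f where "f V = (\<integral>\<omega>. (\<Prod>l\<in>V. x (u l) (v l) \<omega>) \<partial>M)" for V
  define S where "S = {l. key l = key k}"
  have f_keys: "f V = (\<Prod>q\<in>key ` V. f {l. l \<in> V \<and> key l = q})" if V: "V \<subseteq> C" for V
    unfolding f_def key_def
    by (rule moment_prod_keys(1)[OF \<beta> finite_subset[OF V C]]) (use uv V in auto)
  have "set_cumulant f C = 0"
  proof (rule set_cumulant_mixed_eq_0[OF C])
    show "f {} = 1" by (simp add: f_def prob_space)
    show "C \<inter> S \<noteq> {}" "C - S \<noteq> {}" using kl by (auto simp: S_def key_def)
    fix V assume V: "V \<subseteq> C"
    have fin: "finite V" using finite_subset[OF V C] .
    have V': "V \<inter> S \<subseteq> C" "V - S \<subseteq> C" using V by auto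
    have "key ` V = key ` (V \<inter> S) \<union> key ` (V - S)" by auto
    then have "f V = (\<Prod>q\<in>key ` (V \<inter> S) \<union> key ` (V - S). f {l. l \<in> V \<and> key l = q})"
      using f_keys[OF V] by simp
    also have "\<dots> = (\<Prod>q\<in>key ` (V \<inter> S). f {l. l \<in> V \<and> key l = q}) * (\<Prod>q\<in>key ` (V - S). f {l. l \<in> V \<and> key l = q})"
      by (rule prod.union_disjoint) (use fin in \<open>auto simp: S_def\<close>)
    also have "(\<Prod>q\<in>key ` (V \<inter> S). f {l. l \<in> V \<and> key l = q}) = (\<Prod>q\<in>key ` (V \<inter> S). f {l. l \<in> V \<inter> S \<and> key l = q})"
      by (intro prod.cong refl arg_cong[where f=f]) (auto simp: S_def)
    also have "\<dots> = f (V \<inter> S)" by (rule f_keys[OF V'(1), symmetric])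
    also have "(\<Prod>q\<in>key ` (V - S). f {l. l \<in> V \<and> key l = q}) = (\<Prod>q\<in>key ` (V - S). f {l. l \<in> V - S \<and> key l = q})"
      by (intro prod.cong refl arg_cong[where f=f]) (auto simp: S_def)
    also have "\<dots> = f (V - S)" by (rule f_keys[OF V'(2), symmetric])
    finally show "f V = f (V \<inter> S) * f (V - S)" .
  qed
  then show ?thesis by (simp add: cumulant_eq_set_cumulant f_def[abs_def])
qed

lemma cumulant_entries_diagonal:
  assumes \<beta>: "\<beta> 2 \<ge> 0" and C: "finite C" "C \<noteq> {}" and a: "a \<in> {1..N}"
  shows "cumulant M C (\<lambda>l. x a a) = (if card C = 2 then complex_of_real (\<beta> 2) else 0)"
proof -
  define g where "g n = complex_of_real (\<integral>t. t ^ n \<partial>normal_law 0 (\<beta> 2))" for n :: nat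
  have m: "(\<lambda>\<omega>. Re (x a a \<omega>)) \<in> borel_measurable M" using entry_measurable[OF a a] by measurable
  have mom: "(\<integral>\<omega>. x a a \<omega> ^ n \<partial>M) = g n" for n
  proof -
    have "(\<integral>\<omega>. x a a \<omega> ^ n \<partial>M) = (\<integral>\<omega>. complex_of_real (Re (x a a \<omega>) ^ n) \<partial>M)"
    proof (rule Bochner_Integration.integral_cong[OF refl])
      fix \<omega> assume "\<omega> \<in> space M"
      then have "complex_of_real (Re (x a a \<omega>)) = x a a \<omega>"
        using entry_diagonal_Im[OF a] by (simp add: complex_eq_iff)
      then show "x a a \<omega> ^ n = complex_of_real (Re (x a a \<omega>) ^ n)" by simp
    qed
    also have "\<dots> = complex_of_real (\<integral>\<omega>. Re (x a a \<omega>) ^ n \<partial>M)" by (rule integral_complex_of_real)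
    also have "(\<integral>\<omega>. Re (x a a \<omega>) ^ n \<partial>M) = (\<integral>t. t ^ n \<partial>distr M borel (\<lambda>\<omega>. Re (x a a \<omega>)))"
      by (rule integral_distr[OF m, symmetric]) simp
    also have "\<dots> = (\<integral>t. t ^ n \<partial>normal_law 0 (\<beta> 2))" by (simp only: entry_diagonal_law[OF a])
    finally show ?thesis by (simp add: g_def)
  qed
  have "set_cumulant (\<lambda>V. g (card V)) C = (if card C = 2 then complex_of_real (\<beta> 2) else 0)"
  proof (rule set_cumulant_gaussian[OF _ _ _ C])
    show "g 0 = 1" using mom[of 0] by (simp add: prob_space)
    show "g 1 = 0" using normal_law_moment_1[OF \<beta>] by (simp add: g_def)
    show "g (n + 2) = of_nat (n + 1) * complex_of_real (\<beta> 2) * g n" for n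
      unfolding g_def normal_law_moment_Suc_Suc[OF \<beta>] by simp
  qed
  then show ?thesis by (simp add: cumulant_eq_set_cumulant mom)
qed

text \<open>Every variable is \<open>x a b\<close> or its conjugate, the latter at the positions in
  \<open>G\<close>. If both kinds are equally frequent, symmetry of the cumulant allows an
  alternating order; otherwise R-diagonality gives 0.\<close>

lemma cumulant_entries_off_diagonal:
  assumes C: "finite C" "C \<noteq> {}" and ab: "1 \<le> a" "a < b" "b \<le> N"
    and e: "\<And>l. l \<in> C \<Longrightarrow> (u l, v l) = (a, b) \<or> (u l, v l) = (b, a)"
  shows "cumulant M C (\<lambda>l. x (u l) (v l)) =
    (if card {l \<in> C. u l = a} = card {l \<in> C. u l = b} then complex_of_real (\<beta> (card C)) else 0)"
proof -
  define F where "F = {l \<in> C. u l = a}"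
  define G where "G = {l \<in> C. u l = b}"
  have FG: "F \<union> G = C" "F \<inter> G = {}" using e ab by (auto simp: F_def G_def)
  have fin: "finite F" "finite G" using C by (auto simp: F_def G_def)
  have cardC: "card C = card F + card G" using card_Un_disjoint[OF fin FG(2)] FG(1) by simp
  have n: "card C > 0" using C by (simp add: card_gt_0_iff)
  have aN: "a \<in> {1..N}" "b \<in> {1..N}" using ab by auto
  have val: "x (u l) (v l) \<omega> = (if l \<in> G then cnj (x a b \<omega>) else x a b \<omega>)"
    if "l \<in> C" "\<omega> \<in> space M" for l \<omega>
  proof (cases "l \<in> G")
    case True
    then have "u l = b" "v l = a" using e[OF that(1)] ab by (auto simp: G_def)
    then show ?thesis using True entry_cnj[OF aN(2,1) that(2)] by simp
  next
    case False
    then have "u l = a" "v l = b" using e[OF that(1)] ab that(1) by (auto simp: G_def)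
    then show ?thesis using False by simp
  qed
  show ?thesis
  proof (cases "card F = card G")
    case True
    define k where "k = card F"
    have cC: "card C = 2 * k" and k: "k \<ge> 1" using cardC True n by (auto simp: k_def)
    have "card ((\<lambda>j. 2 * j - 1) ` {1..k}) = k" by (subst card_image) (auto simp: inj_on_def)
    moreover have "{j \<in> {1..2 * k}. odd j} = (\<lambda>j. 2 * j - 1) ` {1..k}"
    proof (intro equalityI subsetI)
      fix j assume "j \<in> {j \<in> {1..2 * k}. odd j}"
      then obtain t where "j = 2 * t + 1" "j \<le> 2 * k" by (auto elim: oddE)
      then show "j \<in> (\<lambda>j. 2 * j - 1) ` {1..k}" by (intro image_eqI[of _ _ "t + 1"]) auto
    qed auto
    moreover have "card ((\<lambda>j. 2 * j) ` {1..k}) = k" by (subst card_image) (auto simp: inj_on_def)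
    moreover have "{j \<in> {1..2 * k}. even j} = (\<lambda>j. 2 * j) ` {1..k}"
      by (auto elim!: evenE)
    ultimately have odds: "card {j \<in> {1..2 * k}. odd j} = card F"
      and evens: "card {j \<in> {1..2 * k}. even j} = card G" using True by (simp_all add: k_def)
    obtain f where f: "bij_betw f {j \<in> {1..2 * k}. odd j} F"
      using finite_same_card_bij[OF _ fin(1) odds] by auto
    obtain g where g: "bij_betw g {j \<in> {1..2 * k}. even j} G"
      using finite_same_card_bij[OF _ fin(2) evens] by auto
    \<comment> \<open>\<open>F\<close> is placed at the odd and \<open>G\<close> at the even
      positions, since \<open>alternating_cumulant\<close> starts with the variable that is not
      conjugated.\<close>
    define h where "h j = (if odd j then f j else g j)" for j
    have hf: "bij_betw h {j \<in> {1..2 * k}. odd j} F"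
      using f by (subst bij_betw_cong[of _ h f]) (auto simp: h_def)
    have hg: "bij_betw h {j \<in> {1..2 * k}. even j} G"
      using g by (subst bij_betw_cong[of _ h g]) (auto simp: h_def)
    have "bij_betw h ({j \<in> {1..2 * k}. odd j} \<union> {j \<in> {1..2 * k}. even j}) (F \<union> G)"
      by (rule bij_betw_combine[OF hf hg FG(2)])
    moreover have "{j \<in> {1..2 * k}. odd j} \<union> {j \<in> {1..2 * k}. even j} = {1..2 * k}" by auto
    ultimately have h: "bij_betw h {1..2 * k} C" using FG(1) by simp
    have "cumulant M C (\<lambda>l. x (u l) (v l)) =
        cumulant M {1..2 * k} (\<lambda>j \<omega>. if odd j then x a b \<omega> else cnj (x a b \<omega>))"
    proof (rule cumulant_reindex[OF prob_space_axioms h])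
      fix j \<omega> assume j: "j \<in> {1..2 * k}" "\<omega> \<in> space M"
      have "h j \<in> C" using h j by (auto dest: bij_betwE)
      moreover have "h j \<in> G \<longleftrightarrow> even j"
      proof (cases "odd j")
        case True
        then have "h j \<in> F" using hf j by (auto dest: bij_betwE)
        then show ?thesis using True FG(2) by auto
      next
        case False
        then show ?thesis using hg j by (auto dest: bij_betwE)
      qed
      ultimately show "x (u (h j)) (v (h j)) \<omega> = (if odd j then x a b \<omega> else cnj (x a b \<omega>))"
        using val[of "h j" \<omega>] j by simp
    qed (use k in simp)
    also have "\<dots> = complex_of_real (\<beta> (2 * k))"
      using entry_alternating[OF ab k] by (simp add: alternating_cumulant_def)
    finally show ?thesis using True cC by (simp add: F_def G_def)
  next
    case False
    obtain h where h: "bij_betw h {1..card C} C"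
      using finite_same_card_bij[of "{1..card C}" C] C(1) by auto
    define w where "w j \<longleftrightarrow> h j \<in> G" for j
    have hG: "bij_betw h {j \<in> {1..card C}. w j} G"
      unfolding w_def by (rule bij_betw_restrict[OF h]) (use FG in auto)
    have "bij_betw h {j \<in> {1..card C}. h j \<in> F} F"
      by (rule bij_betw_restrict[OF h]) (use FG in auto)
    moreover have "h j \<in> F \<longleftrightarrow> \<not> w j" if "j \<in> {1..card C}" for j
    proof -
      have "h j \<in> C" using h that by (auto dest: bij_betwE)
      then show ?thesis using FG by (auto simp: w_def)
    qed
    then have "{j \<in> {1..card C}. h j \<in> F} = {j \<in> {1..card C}. \<not> w j}" by auto
    ultimately have hF: "bij_betw h {j \<in> {1..card C}. \<not> w j} F" by simp
    have "cumulant M C (\<lambda>l. x (u l) (v l)) =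
        cumulant M {1..card C} (\<lambda>j \<omega>. if w j then cnj (x a b \<omega>) else x a b \<omega>)"
    proof (rule cumulant_reindex[OF prob_space_axioms h n])
      fix j \<omega> assume j: "j \<in> {1..card C}" "\<omega> \<in> space M"
      have "h j \<in> C" using h j by (auto dest: bij_betwE)
      then show "x (u (h j)) (v (h j)) \<omega> = (if w j then cnj (x a b \<omega>) else x a b \<omega>)"
        using val[of "h j" \<omega>] j by (simp add: w_def)
    qed
    also have "\<dots> = 0"
    proof -
      have "card {j \<in> {1..card C}. w j} \<noteq> card {j \<in> {1..card C}. \<not> w j}"
        using False bij_betw_same_card[OF hG] bij_betw_same_card[OF hF] by simp
      then show ?thesis using entry_R_diagonal[OF ab] unfolding R_diagonal_def by blast
    qed
    finally show ?thesis using False by (simp add: F_def G_def)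
  qed
qed

text \<open>Either two keys differ, and both sides are 0, or all edges have the same end points a
  and b with a at most b. The case a = b is that of the normal law, the other one that of
  R-diagonality.\<close>

theorem cumulant_entries:
  assumes \<beta>: "\<beta> 2 \<ge> 0" and C: "finite C" "C \<noteq> {}"
    and i: "\<And>l. l \<in> C \<Longrightarrow> i l \<in> {1..N} \<and> i (\<gamma> l) \<in> {1..N}"
  shows "cumulant M C (\<lambda>l. x (i l) (i (\<gamma> l))) =
    (if balanced_block \<gamma> i C then complex_of_real (\<beta> (card C)) else 0)"
proof (cases "\<exists>k\<in>C. \<exists>l\<in>C. entry_key (i k) (i (\<gamma> k)) \<noteq> entry_key (i l) (i (\<gamma> l))")
  case True
  then obtain k l where kl: "k \<in> C" "l \<in> C" "entry_key (i k) (i (\<gamma> k)) \<noteq> entry_key (i l) (i (\<gamma> l))"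
    by auto
  have "\<not> balanced_block \<gamma> i C"
  proof
    assume "balanced_block \<gamma> i C"
    then obtain F G u v where FG: "F \<union> G = C"
      and F: "\<And>l. l \<in> F \<Longrightarrow> i l = u \<and> i (\<gamma> l) = v" and G: "\<And>l. l \<in> G \<Longrightarrow> i l = v \<and> i (\<gamma> l) = u"
      unfolding balanced_block_def by metis
    have "entry_key (i l) (i (\<gamma> l)) = entry_key u v" if "l \<in> C" for l
    proof (cases "l \<in> F")
      case True
      then show ?thesis using F by simp
    next
      case False
      then have "i l = v \<and> i (\<gamma> l) = u" using G that FG by auto
      then show ?thesis by (simp add: entry_key_def min.commute max.commute)
    qed
    then show False using kl by simp
  qed
  then show ?thesis using cumulant_entries_mixed[where u=i and v="\<lambda>l. i (\<gamma> l)", OF \<beta> C(1) _ kl] i by simp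
next
  case False
  obtain k where k: "k \<in> C" using C by auto
  define a where "a = min (i k) (i (\<gamma> k))"
  define b where "b = max (i k) (i (\<gamma> k))"
  have ab: "a \<in> {1..N}" "b \<in> {1..N}" "a \<le> b" using i[OF k] by (auto simp: a_def b_def)
  have e: "(i l, i (\<gamma> l)) = (a, b) \<or> (i l, i (\<gamma> l)) = (b, a)" if l: "l \<in> C" for l
  proof -
    have "entry_key (i l) (i (\<gamma> l)) = entry_key (i k) (i (\<gamma> k))" using False l k by blast
    then have "entry_key (i l) (i (\<gamma> l)) = (a, b)" by (simp add: entry_key_def a_def b_def)
    then show ?thesis by (auto simp: entry_key_def min_def max_def split: if_splits)
  qed
  show ?thesis
  proof (cases "a = b")
    case True
    have e': "i l = a \<and> i (\<gamma> l) = a" if "l \<in> C" for l using e[OF that] True by simp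
    have "cumulant M C (\<lambda>l. x (i l) (i (\<gamma> l))) = cumulant M C (\<lambda>l. x a a)"
      unfolding cumulant_eq_set_cumulant
    proof (rule set_cumulant_cong)
      fix V assume V: "V \<subseteq> C"
      have "(\<Prod>l\<in>V. x (i l) (i (\<gamma> l)) \<omega>) = (\<Prod>l\<in>V. x a a \<omega>)" for \<omega>
      proof (rule prod.cong[OF refl])
        fix l assume "l \<in> V"
        then have "l \<in> C" using V by auto
        from e'[OF this] show "x (i l) (i (\<gamma> l)) \<omega> = x a a \<omega>" by simp
      qed
      then show "(\<integral>\<omega>. (\<Prod>l\<in>V. x (i l) (i (\<gamma> l)) \<omega>) \<partial>M) = (\<integral>\<omega>. (\<Prod>l\<in>V. x a a \<omega>) \<partial>M)" by (simp only:)
    qed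
    also have "\<dots> = (if card C = 2 then complex_of_real (\<beta> 2) else 0)"
      by (rule cumulant_entries_diagonal[OF \<beta> C ab(1)])
    finally show ?thesis using balanced_block_singleton_edge[where i=i and \<gamma>=\<gamma> and a=a, OF C(1) e' C(2)] by auto
  next
    case False
    have "cumulant M C (\<lambda>l. x (i l) (i (\<gamma> l))) =
        (if card {l \<in> C. i l = a} = card {l \<in> C. i l = b} then complex_of_real (\<beta> (card C)) else 0)"
      by (rule cumulant_entries_off_diagonal[where u=i and v="\<lambda>l. i (\<gamma> l)", OF C _ _ _ e])
        (use ab False in auto)
    then show ?thesis using balanced_block_edge[where i=i and \<gamma>=\<gamma> and a=a and b=b, OF C False e] by simp
  qed
qed

end

section \<open>The permutation \<open>\<gamma>\<close> and its cycles\<close>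

text \<open>The number of points before the \<open>k\<close>-th cycle, with \<open>k\<close> counted
  from 1; this cycle occupies the points after \<open>offset ms k\<close> up to and including the
  next offset.\<close>

definition offset :: "(nat \<Rightarrow> nat) \<Rightarrow> nat \<Rightarrow> nat" where
  "offset ms k = (\<Sum>i=1..<k. ms i)"

definition cycle_block :: "(nat \<Rightarrow> nat) \<Rightarrow> nat \<Rightarrow> nat set" where
  "cycle_block ms k = {offset ms k <.. offset ms (Suc k)}"

lemma offset_Suc: "k \<ge> 1 \<Longrightarrow> offset ms (Suc k) = offset ms k + ms k"
  by (simp add: offset_def)

lemma offset_Suc': "offset ms (Suc k) = (\<Sum>i=1..k. ms i)"
  unfolding offset_def by (rule sum.cong) auto

lemma offset_mono: "j \<le> k \<Longrightarrow> offset ms j \<le> offset ms k"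
  unfolding offset_def by (rule sum_mono2) auto

lemma finite_cycle_block: "finite (cycle_block ms k)"
  by (simp add: cycle_block_def)

lemma card_cycle_block: "k \<ge> 1 \<Longrightarrow> card (cycle_block ms k) = ms k"
  by (simp add: cycle_block_def offset_Suc)

lemma disjoint_cycle_blocks: "disjoint_family_on (cycle_block ms) K"
proof -
  have "cycle_block ms j \<inter> cycle_block ms k = {}" if "j < k" for j k
    using offset_mono[of "Suc j" k ms] that by (auto simp: cycle_block_def)
  then show ?thesis unfolding disjoint_family_on_def
    by (metis inf_commute nat_neq_iff)
qed

lemma Union_cycle_blocks: "\<Union>(cycle_block ms ` {1..r}) = {1..offset ms (Suc r)}"
proof (induction r)
  case (Suc r)
  have "\<Union>(cycle_block ms ` {1..Suc r}) = cycle_block ms (Suc r) \<union> {1..offset ms (Suc r)}"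
    using Suc by (simp add: atLeastAtMostSuc_conv)
  also have "\<dots> = {1..offset ms (Suc (Suc r))}"
    using offset_mono[of "Suc r" "Suc (Suc r)" ms] by (auto simp: cycle_block_def)
  finally show ?case .
qed (simp add: offset_def)

text \<open>\<open>cycle_of_list\<close> maps each element to its successor in the list, so only the
  last one wraps around.\<close>

lemma cycle_of_list_upt:
  assumes "l \<in> {a<..b}"
  shows "cycle_of_list [Suc a..<Suc b] l = (if l = b then Suc a else Suc l)"
proof -
  let ?cs = "[Suc a..<Suc b]"
  have len: "length ?cs = b - a" by (simp del: upt_Suc)
  define j where "j = l - Suc a"
  have j: "j < b - a" "l = Suc a + j" using assms by (auto simp: j_def)
  have "map (cycle_of_list ?cs) ?cs = rotate 1 ?cs"
    using cyclic_rotation[of ?cs 1] by simp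
  then have "cycle_of_list ?cs (?cs ! j) = rotate 1 ?cs ! j"
    using j len by (metis nth_map)
  also have "\<dots> = ?cs ! ((1 + j) mod length ?cs)"
    by (rule nth_rotate) (use j len in simp)
  finally have "cycle_of_list ?cs l = ?cs ! ((1 + j) mod (b - a))"
    using j by (simp add: len del: upt_Suc)
  also have "\<dots> = (if l = b then Suc a else Suc l)"
  proof (cases "l = b")
    case True
    then have "1 + j = b - a" using j by simp
    then show ?thesis using True j by (simp del: upt_Suc)
  next
    case False
    then have "1 + j < b - a" using j by simp
    then show ?thesis using False j by (simp del: upt_Suc)
  qed
  finally show ?thesis .
qed

lemma foldr_comp_Cons:
  "foldr (\<circ>) (map c (k # ks)) id l = c k (foldr (\<circ>) (map c ks) id l)"
  unfolding list.map foldr.simps comp_apply ..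

lemma foldr_comp_Nil: "foldr (\<circ>) (map c []) id = id"
  unfolding list.map foldr.simps id_apply ..

lemma foldr_comp_fixed:
  "(\<And>k. k \<in> set ks \<Longrightarrow> c k l = l) \<Longrightarrow> foldr (\<circ>) (map c ks) id l = l"
proof (induction ks)
  case Nil
  show ?case unfolding foldr_comp_Nil by (rule id_apply)
next
  case (Cons k ks)
  have "foldr (\<circ>) (map c ks) id l = l" by (rule Cons.IH) (use Cons.prems in auto)
  then show ?case unfolding foldr_comp_Cons using Cons.prems[of k] by (simp only: list.set_intros)
qed

text \<open>Only the factor of \<open>k\<close> can move \<open>l\<close>, and the others also fix
  its image, so they act trivially both before and after it.\<close>

lemma foldr_comp_unique:
  assumes "distinct ks" "k \<in> set ks" "\<And>k'. k' \<in> set ks \<Longrightarrow> k' \<noteq> k \<Longrightarrow> c k' l = l \<and> c k' (c k l) = c k l"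
  shows "foldr (\<circ>) (map c ks) id l = c k l"
  using assms
proof (induction ks)
  case (Cons k' ks)
  show ?case
  proof (cases "k' = k")
    case True
    then have "foldr (\<circ>) (map c ks) id l = l"
      using Cons.prems by (intro foldr_comp_fixed) auto
    then show ?thesis unfolding foldr_comp_Cons True by (simp only:)
  next
    case False
    have "foldr (\<circ>) (map c ks) id l = c k l"
      by (rule Cons.IH) (use False Cons.prems in auto)
    moreover have "c k' (c k l) = c k l" using False Cons.prems(3)[of k'] by simp
    ultimately show ?thesis unfolding foldr_comp_Cons by (simp only:)
  qed
qed simp

lemma cycles_perm_eq:
  assumes k: "k \<in> {1..r}" and l: "l \<in> cycle_block ms k"
  shows "cycles_perm r ms l = (if l = offset ms (Suc k) then Suc (offset ms k) else Suc l)"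
proof -
  define c where "c k = cycle_of_list [Suc (offset ms k)..<Suc (offset ms (Suc k))]" for k
  have c_out: "c k' l = l" if "l \<notin> cycle_block ms k'" for k' l
    unfolding c_def by (rule id_outside_supp) (use that in \<open>auto simp: cycle_block_def\<close>)
  have c_in: "c k l = (if l = offset ms (Suc k) then Suc (offset ms k) else Suc l)"
    unfolding c_def by (rule cycle_of_list_upt) (use l in \<open>simp add: cycle_block_def\<close>)
  have ckl: "c k l \<in> cycle_block ms k" using c_in l by (auto simp: cycle_block_def)
  have eq: "cycles_perm r ms = foldr (\<circ>) (map c [1..<Suc r]) id"
    unfolding cycles_perm_def c_def offset_Suc' by (simp only: offset_def)
  have "foldr (\<circ>) (map c [1..<Suc r]) id l = c k l"
  proof (rule foldr_comp_unique)
    fix k' assume k': "k' \<noteq> k"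
    have "l \<notin> cycle_block ms k'" "c k l \<notin> cycle_block ms k'"
      using k' l ckl disjoint_cycle_blocks[of ms UNIV] by (auto simp: disjoint_family_on_def)
    then show "c k' l = l \<and> c k' (c k l) = c k l" using c_out by simp
  qed (use k in auto)
  then show ?thesis unfolding eq[symmetric] c_in .
qed

lemma cycles_perm_in_block:
  "k \<in> {1..r} \<Longrightarrow> l \<in> cycle_block ms k \<Longrightarrow> cycles_perm r ms l \<in> cycle_block ms k"
  by (auto simp: cycles_perm_eq cycle_block_def)

lemma cycles_perm_permutes: "cycles_perm r ms permutes {1..offset ms (Suc r)}"
proof -
  define c where "c k = cycle_of_list [Suc (offset ms k)..<Suc (offset ms (Suc k))]" for k
  have *: "foldr (\<circ>) (map c ks) id permutes {1..offset ms (Suc r)}" if "set ks \<subseteq> {1..r}" for ks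
    using that
  proof (induction ks)
    case Nil
    show ?case unfolding foldr_comp_Nil by (rule permutes_id)
  next
    case (Cons k ks)
    have "c k permutes set [Suc (offset ms k)..<Suc (offset ms (Suc k))]"
      unfolding c_def by (rule cycle_permutes)
    then have "c k permutes {1..offset ms (Suc r)}"
      by (rule permutes_subset) (use Cons.prems offset_mono[of "Suc k" "Suc r" ms] in auto)
    moreover have "foldr (\<circ>) (map c ks) id permutes {1..offset ms (Suc r)}"
      by (rule Cons.IH) (use Cons.prems in auto)
    moreover have "foldr (\<circ>) (map c (k # ks)) id = c k \<circ> foldr (\<circ>) (map c ks) id"
      by (rule ext) (simp only: foldr_comp_Cons comp_apply)
    ultimately show ?case using permutes_compose by (simp only:)
  qed
  have "cycles_perm r ms = foldr (\<circ>) (map c [1..<Suc r]) id"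
    unfolding cycles_perm_def c_def offset_Suc' by (simp only: offset_def)
  moreover have "set [1..<Suc r] \<subseteq> {1..r}" by auto
  ultimately show ?thesis using * by (simp only:)
qed

lemma conn_cycles_perm_block:
  assumes k: "k \<in> {1..r}" and ab: "a \<in> cycle_block ms k" "b \<in> cycle_block ms k"
  shows "(a, b) \<in> conn (graph_of (cycles_perm r ms))"
proof -
  let ?E = "graph_of (cycles_perm r ms)"
  have *: "(Suc (offset ms k), Suc (offset ms k + j)) \<in> conn ?E" if "offset ms k + j < offset ms (Suc k)" for j
    using that
  proof (induction j)
    case 0
    then show ?case by (simp add: conn_refl)
  next
    case (Suc j)
    then have "Suc (offset ms k + j) \<in> cycle_block ms k" by (simp add: cycle_block_def)
    then have "cycles_perm r ms (Suc (offset ms k + j)) = Suc (offset ms k + Suc j)"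
      using cycles_perm_eq[OF k] Suc.prems by simp
    then have "(Suc (offset ms k + j), Suc (offset ms k + Suc j)) \<in> conn ?E"
      using conn_incl[OF graph_ofI[of "Suc (offset ms k + j)" "cycles_perm r ms"]] by simp
    with Suc show ?case using conn_trans by (metis Suc_lessD add_Suc_right)
  qed
  have "(Suc (offset ms k), a) \<in> conn ?E" if a: "a \<in> cycle_block ms k" for a
  proof -
    obtain j where "a = Suc (offset ms k + j)"
      using a less_imp_Suc_add[of "offset ms k" a] by (auto simp: cycle_block_def)
    then show ?thesis using *[of j] a by (simp add: cycle_block_def)
  qed
  then show ?thesis using ab conn_sym conn_trans by metis
qed

lemma conn_cycles_perm_class:
  assumes k: "k \<in> {1..r}" and a: "a \<in> cycle_block ms k"
  shows "conn (graph_of (cycles_perm r ms)) `` {a} = cycle_block ms k"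
proof
  show "cycle_block ms k \<subseteq> conn (graph_of (cycles_perm r ms)) `` {a}"
    using conn_cycles_perm_block[OF k a] by auto
  let ?r = "{(a, b). a \<in> cycle_block ms k \<longleftrightarrow> b \<in> cycle_block ms k}"
  have "l \<in> cycle_block ms k \<longleftrightarrow> cycles_perm r ms l \<in> cycle_block ms k" for l
  proof (cases "l \<in> {1..offset ms (Suc r)}")
    case True
    then obtain k' where k': "k' \<in> {1..r}" "l \<in> cycle_block ms k'"
      unfolding Union_cycle_blocks[symmetric] by auto
    have d: "cycle_block ms k \<inter> cycle_block ms k' = {}" if "k \<noteq> k'"
      using disjoint_cycle_blocks[of ms UNIV] that by (auto simp: disjoint_family_on_def)
    have "cycles_perm r ms l \<in> cycle_block ms k'" using cycles_perm_in_block[OF k'] .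
    then show ?thesis using k'(2) d by (cases "k = k'") auto
  next
    case False
    then show ?thesis using permutes_not_in[OF cycles_perm_permutes False] by simp
  qed
  then have "conn (graph_of (cycles_perm r ms)) \<subseteq> ?r"
    by (intro conn_least) (auto simp: graph_of_def)
  then show "conn (graph_of (cycles_perm r ms)) `` {a} \<subseteq> cycle_block ms k" using a by auto
qed

lemma inj_on_cycle_block:
  assumes "\<And>k. k \<in> K \<Longrightarrow> cycle_block ms k \<noteq> {}"
  shows "inj_on (cycle_block ms) K"
proof (rule inj_onI)
  fix j k assume jk: "j \<in> K" "k \<in> K" "cycle_block ms j = cycle_block ms k"
  show "j = k"
  proof (rule ccontr)
    assume "j \<noteq> k"
    then have "cycle_block ms j \<inter> cycle_block ms k = {}"
      using disjoint_cycle_blocks[of ms UNIV] by (simp add: disjoint_family_on_def)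
    then show False using jk assms[of j] by simp
  qed
qed

lemma cycle_block_nonempty: "k \<ge> 1 \<Longrightarrow> ms k \<ge> 1 \<Longrightarrow> cycle_block ms k \<noteq> {}"
  by (auto simp: cycle_block_def offset_Suc)

text \<open>Evaluates the number of faces. Lengths of at least 1 make the blocks nonempty and hence
  distinct, so none is lost in the count.\<close>

lemma ncomp_cycles_perm:
  assumes "\<And>k. k \<in> {1..r} \<Longrightarrow> ms k \<ge> 1"
  shows "ncomp {1..offset ms (Suc r)} (graph_of (cycles_perm r ms)) = r"
proof -
  have ne: "cycle_block ms k \<noteq> {}" if "k \<in> {1..r}" for k
    using cycle_block_nonempty assms that by simp
  have "{1..offset ms (Suc r)} // conn (graph_of (cycles_perm r ms)) = cycle_block ms ` {1..r}"
  proof (intro equalityI subsetI)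
    fix X assume "X \<in> {1..offset ms (Suc r)} // conn (graph_of (cycles_perm r ms))"
    then obtain a where a: "a \<in> {1..offset ms (Suc r)}" "X = conn (graph_of (cycles_perm r ms)) `` {a}"
      unfolding quotient_eq_image by blast
    then obtain k where "k \<in> {1..r}" "a \<in> cycle_block ms k"
      unfolding Union_cycle_blocks[symmetric] by auto
    then show "X \<in> cycle_block ms ` {1..r}" using conn_cycles_perm_class a(2) by simp
  next
    fix X assume "X \<in> cycle_block ms ` {1..r}"
    then obtain k where k: "k \<in> {1..r}" "X = cycle_block ms k" by auto
    then obtain a where a: "a \<in> cycle_block ms k" using ne by auto
    then have "a \<in> {1..offset ms (Suc r)}" using k unfolding Union_cycle_blocks[symmetric] by auto
    then show "X \<in> {1..offset ms (Suc r)} // conn (graph_of (cycles_perm r ms))"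
      unfolding quotient_eq_image
      by (rule rev_image_eqI) (simp only: conn_cycles_perm_class[OF k(1) a] k(2))
  qed
  then show ?thesis unfolding ncomp_def
    using card_image[OF inj_on_cycle_block[of "{1..r}" ms, OF ne]] by simp
qed

text \<open>\<open>orbit\<close> collects proper iterates, but a permutation of a finite set returns
  to its starting point, so cycles of length 1 give blocks too.\<close>

lemma cycle_partition_cycles_perm:
  assumes "\<And>k. k \<in> {1..r} \<Longrightarrow> ms k \<ge> 1"
  shows "cycle_partition (offset ms (Suc r)) (cycles_perm r ms) = cycle_block ms ` {1..r}"
proof -
  let ?\<gamma> = "cycles_perm r ms"
  have perm: "permutation ?\<gamma>" using cycles_perm_permutes permutation_permutes by blast
  have orb: "orbit ?\<gamma> a = cycle_block ms k" if k: "k \<in> {1..r}" and a: "a \<in> cycle_block ms k" for a k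
  proof
    show "orbit ?\<gamma> a \<subseteq> cycle_block ms k"
    proof
      fix y assume "y \<in> orbit ?\<gamma> a"
      then show "y \<in> cycle_block ms k"
        by induction (use cycles_perm_in_block[OF k] a in auto)
    qed
    have "conn (graph_of ?\<gamma>) \<subseteq> {(a, b). orbit ?\<gamma> a = orbit ?\<gamma> b}"
      by (rule conn_least) (auto simp: graph_of_def permutation_orbit_step[OF perm])
    then have "orbit ?\<gamma> a = orbit ?\<gamma> b" if "b \<in> cycle_block ms k" for b
      using conn_cycles_perm_block[OF k a that] by auto
    then show "cycle_block ms k \<subseteq> orbit ?\<gamma> a"
      using permutation_self_in_orbit[OF perm] by blast
  qed
  show ?thesis
  proof (intro equalityI subsetI)
    fix X assume "X \<in> cycle_partition (offset ms (Suc r)) ?\<gamma>"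
    then obtain a where a: "a \<in> {1..offset ms (Suc r)}" "X = orbit ?\<gamma> a"
      unfolding cycle_partition_def by blast
    then obtain k where "k \<in> {1..r}" "a \<in> cycle_block ms k"
      unfolding Union_cycle_blocks[symmetric] by auto
    then show "X \<in> cycle_block ms ` {1..r}" using orb a(2) by simp
  next
    fix X assume "X \<in> cycle_block ms ` {1..r}"
    then obtain k where k: "k \<in> {1..r}" "X = cycle_block ms k" by auto
    then obtain a where a: "a \<in> cycle_block ms k" using cycle_block_nonempty assms by fastforce
    then have "a \<in> {1..offset ms (Suc r)}" using k unfolding Union_cycle_blocks[symmetric] by auto
    moreover have "X = orbit ?\<gamma> a" using orb[OF k(1) a] k(2) by simp
    ultimately show "X \<in> cycle_partition (offset ms (Suc r)) ?\<gamma>"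
      unfolding cycle_partition_def by (rule rev_image_eqI)
  qed
qed

lemma partition_on_cycle_blocks:
  assumes "\<And>k. k \<in> {1..r} \<Longrightarrow> ms k \<ge> 1"
  shows "partition_on {1..offset ms (Suc r)} (cycle_block ms ` {1..r})"
proof (rule partition_onI)
  show "\<Union>(cycle_block ms ` {1..r}) = {1..offset ms (Suc r)}" by (rule Union_cycle_blocks)
  show "{} \<notin> cycle_block ms ` {1..r}" using cycle_block_nonempty assms by fastforce
  show "disjnt p q" if pq: "p \<in> cycle_block ms ` {1..r}" "q \<in> cycle_block ms ` {1..r}" "p \<noteq> q" for p q
  proof -
    obtain j k where "p = cycle_block ms j" "q = cycle_block ms k" using pq by auto
    moreover from this have "j \<noteq> k" using pq(3) by auto
    ultimately show ?thesis using disjoint_cycle_blocks[of ms UNIV]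
      by (simp add: disjoint_family_on_def disjnt_def)
  qed
qed

section \<open>Joins and linking partitions\<close>

text \<open>A saturated proper part \<open>X\<close> yields the upper bound
  \<open>{X, A - X}\<close>, which rules out the top as the join. Conversely, each block of the join
  is a union of sets \<open>W k\<close> and of blocks of \<open>\<tau>\<close>, so linking makes it
  all of \<open>A\<close>.\<close>

lemma partition_join_eq_top_iff:
  assumes A: "A \<noteq> {}" and \<tau>: "partition_on A \<tau>" and W: "partition_on A (W ` K)"
    and disj: "disjoint_family_on W K"
  shows "partition_join A \<tau> (W ` K) = {A} \<longleftrightarrow> links W K \<tau>"
proof
  have J: "is_partition_join A \<tau> (W ` K) (partition_join A \<tau> (W ` K))"
    by (rule is_partition_join_partition_join[OF \<tau> W])
  have UW: "\<Union>(W ` K) = A" and Wne: "\<And>k. k \<in> K \<Longrightarrow> W k \<noteq> {}"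
    using partition_onD1[OF W] partition_onD3[OF W] by auto
  {
    assume top: "partition_join A \<tau> (W ` K) = {A}"
    show "links W K \<tau>" unfolding links_def
    proof (intro allI impI, rule ccontr)
      fix T assume T: "T \<subseteq> K" and sat: "\<forall>B\<in>\<tau>. B \<subseteq> \<Union>(W ` T) \<or> B \<inter> \<Union>(W ` T) = {}"
        and neg: "\<not> (T = {} \<or> T = K)"
      define X where "X = \<Union>(W ` T)"
      have XA: "X \<subseteq> A" using T UW by (auto simp: X_def)
      obtain t where t: "t \<in> T" using neg by auto
      have Xne: "X \<noteq> {}" using t T Wne[of t] by (auto simp: X_def)
      obtain k where k: "k \<in> K" "k \<notin> T" using neg T by auto
      have WX: "W k' \<inter> X = {}" if "k' \<in> K" "k' \<notin> T" for k'
      proof -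
        have "W k' \<inter> W t = {}" if "t \<in> T" for t
        proof -
          have "k' \<noteq> t" "t \<in> K" using \<open>k' \<notin> T\<close> that T by auto
          then show ?thesis using disj \<open>k' \<in> K\<close> by (simp add: disjoint_family_on_def)
        qed
        then show ?thesis by (auto simp: X_def)
      qed
      have AX: "A - X \<noteq> {}" using WX[OF k] Wne[OF k(1)] k(1) UW by auto
      have P: "partition_on A {X, A - X}"
        by (rule partition_onI) (use XA Xne AX in \<open>auto simp: disjnt_def\<close>)
      have "refines A \<tau> {X, A - X}"
        unfolding refines_def
      proof (intro conjI ballI \<tau> P)
        fix B assume B: "B \<in> \<tau>"
        have "B \<subseteq> A" using partition_on_block_subset[OF \<tau> B] .
        moreover have "B \<subseteq> X \<or> B \<inter> X = {}" using sat B by (simp add: X_def)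
        ultimately show "\<exists>Y\<in>{X, A - X}. B \<subseteq> Y" by auto
      qed
      moreover have "refines A (W ` K) {X, A - X}"
        unfolding refines_def
      proof (intro conjI ballI W P)
        fix B assume "B \<in> W ` K"
        then obtain k' where k': "k' \<in> K" "B = W k'" by auto
        show "\<exists>Y\<in>{X, A - X}. B \<subseteq> Y"
        proof (cases "k' \<in> T")
          case True
          then show ?thesis using k' by (auto simp: X_def)
        next
          case False
          then have "B \<subseteq> A - X" using WX[OF k'(1)] k' UW by auto
          then show ?thesis by simp
        qed
      qed
      ultimately have "refines A {A} {X, A - X}"
        using J top unfolding is_partition_join_def by simp
      then have "A \<subseteq> X \<or> A \<subseteq> A - X" unfolding refines_def by simp
      then show False using Xne AX XA by auto
    qed
  next
    assume links: "links W K \<tau>"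
    define S where "S = partition_join A \<tau> (W ` K)"
    have r: "refines A \<tau> S" "refines A (W ` K) S" using J by (simp_all add: is_partition_join_def S_def)
    have pS: "partition_on A S" using r(1) by (simp add: refines_def)
    have all: "Y = A" if Y: "Y \<in> S" for Y
    proof -
      define T where "T = {k \<in> K. W k \<subseteq> Y}"
      have WY: "W k \<subseteq> Y" if k: "k \<in> K" and a: "a \<in> W k" "a \<in> Y" for k a
      proof -
        obtain Z where Z: "Z \<in> S" "W k \<subseteq> Z" using r(2) k unfolding refines_def by auto
        then have "Z = Y" using partition_on_block_unique[OF pS Z(1) Y] a by auto
        then show ?thesis using Z by simp
      qed
      have UT: "\<Union>(W ` T) = Y"
      proof
        show "Y \<subseteq> \<Union>(W ` T)"
        proof
          fix a assume a: "a \<in> Y"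
          then have "a \<in> A" using partition_on_block_subset[OF pS Y] by auto
          then obtain k where "k \<in> K" "a \<in> W k" using UW by auto
          then show "a \<in> \<Union>(W ` T)" using WY[of k a] a by (auto simp: T_def)
        qed
      qed (auto simp: T_def)
      have "\<forall>B\<in>\<tau>. B \<subseteq> \<Union>(W ` T) \<or> B \<inter> \<Union>(W ` T) = {}"
      proof
        fix B assume "B \<in> \<tau>"
        then obtain Z where Z: "Z \<in> S" "B \<subseteq> Z" using r(1) unfolding refines_def by auto
        have "Z = Y \<or> Z \<inter> Y = {}" using partition_on_block_unique[OF pS Z(1) Y] by auto
        then show "B \<subseteq> \<Union>(W ` T) \<or> B \<inter> \<Union>(W ` T) = {}" using Z(2) UT by auto
      qed
      moreover have "T \<subseteq> K" by (auto simp: T_def)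
      ultimately have "T = {} \<or> T = K" using links unfolding links_def by simp
      moreover have "Y \<noteq> {}" using partition_onD3[OF pS] Y by auto
      ultimately show "Y = A" using UT UW by auto
    qed
    moreover have "S \<noteq> {}" using partition_onD1[OF pS] A by auto
    ultimately show "partition_join A \<tau> (W ` K) = {A}" unfolding S_def[symmetric] by auto
  }
qed

text \<open>The points connected to \<open>a\<close> form a union of sets \<open>W k\<close> that no
  block of \<open>\<tau>\<close> leaves, and linking makes this union all of
  \<open>A\<close>.\<close>

lemma links_connected:
  assumes links: "links W K \<tau>" and UW: "\<Union>(W ` K) = A"
    and E: "\<And>k a b. k \<in> K \<Longrightarrow> a \<in> W k \<Longrightarrow> b \<in> W k \<Longrightarrow> (a, b) \<in> conn E"
    and ab: "a \<in> A" "b \<in> A" and \<tau>: "partition_on A \<tau>"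
  shows "(a, b) \<in> conn (E \<union> {(a, b). \<exists>C\<in>\<tau>. a \<in> C \<and> b \<in> C})"
proof -
  let ?r = "conn (E \<union> {(a, b). \<exists>C\<in>\<tau>. a \<in> C \<and> b \<in> C})"
  have Er: "conn E \<subseteq> ?r" by (rule conn_mono) auto
  define Y where "Y = {c \<in> A. (a, c) \<in> ?r}"
  define T where "T = {k \<in> K. W k \<subseteq> Y}"
  have WY: "W k \<subseteq> Y" if k: "k \<in> K" and c: "c \<in> W k" "c \<in> Y" for k c
  proof
    fix d assume d: "d \<in> W k"
    have "(c, d) \<in> ?r" using E[OF k c(1) d] Er by auto
    then have "(a, d) \<in> ?r" using c(2) conn_trans[of a c] by (simp add: Y_def)
    then show "d \<in> Y" using d k UW by (auto simp: Y_def)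
  qed
  have UT: "\<Union>(W ` T) = Y"
  proof
    show "Y \<subseteq> \<Union>(W ` T)"
    proof
      fix c assume c: "c \<in> Y"
      then have "c \<in> A" by (simp add: Y_def)
      then obtain k where "k \<in> K" "c \<in> W k" using UW by auto
      then show "c \<in> \<Union>(W ` T)" using WY[of k c] c by (auto simp: T_def)
    qed
  qed (auto simp: T_def)
  have "\<forall>B\<in>\<tau>. B \<subseteq> \<Union>(W ` T) \<or> B \<inter> \<Union>(W ` T) = {}"
  proof
    fix B assume B: "B \<in> \<tau>"
    have "B \<subseteq> Y" if c: "c \<in> B" "c \<in> Y" for c
    proof
      fix d assume d: "d \<in> B"
      have "(c, d) \<in> ?r" using B c d by (intro conn_incl) auto
      then have "(a, d) \<in> ?r" using c(2) conn_trans[of a c] by (simp add: Y_def)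
      moreover have "d \<in> A" using partition_on_block_subset[OF \<tau> B] d by auto
      ultimately show "d \<in> Y" by (simp add: Y_def)
    qed
    then show "B \<subseteq> \<Union>(W ` T) \<or> B \<inter> \<Union>(W ` T) = {}" unfolding UT by auto
  qed
  moreover have "T \<subseteq> K" by (auto simp: T_def)
  ultimately have "T = {} \<or> T = K" using links unfolding links_def by simp
  moreover have "a \<in> Y" using ab conn_refl by (simp add: Y_def)
  ultimately have "b \<in> Y" using UT UW ab by auto
  then show ?thesis by (simp add: Y_def)
qed

section \<open>Traces of powers as sums over closed walks\<close>

lemma sum_PiE_insert:
  fixes G :: "('a \<Rightarrow> 'b) \<Rightarrow> 'c::comm_monoid_add"
  assumes a: "a \<notin> A"
  shows "(\<Sum>i \<in> PiE (insert a A) (\<lambda>_. I). G i) = (\<Sum>i \<in> PiE A (\<lambda>_. I). \<Sum>b\<in>I. G (i(a := b)))"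
proof -
  have "(\<Sum>i \<in> PiE (insert a A) (\<lambda>_. I). G i) = (\<Sum>(b, i) \<in> I \<times> PiE A (\<lambda>_. I). G (i(a := b)))"
    unfolding PiE_insert_eq
    by (subst sum.reindex[OF inj_combinator[OF a]]) (simp add: split_def)
  also have "\<dots> = (\<Sum>b\<in>I. \<Sum>i \<in> PiE A (\<lambda>_. I). G (i(a := b)))"
    by (rule sum.cartesian_product[symmetric])
  also have "\<dots> = (\<Sum>i \<in> PiE A (\<lambda>_. I). \<Sum>b\<in>I. G (i(a := b)))"
    by (rule sum.swap)
  finally show ?thesis .
qed

text \<open>Bridges the indices of matrices, which start at 0, and the values of index functions,
  which start at 1.\<close>

lemma sum_pred_lessThan: "(\<Sum>u<N. f u) = (\<Sum>u\<in>{1..N}. f (u - 1))" for N :: nat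
  by (rule sum.reindex_bij_witness[of _ "\<lambda>u. u - 1" Suc]) auto

lemma mat_mult_entry:
  assumes A: "A \<in> carrier_mat N N" "B \<in> carrier_mat N N" and uv: "u < N" "v < N"
  shows "(A * B) $$ (u, v) = (\<Sum>w\<in>{1..N}. A $$ (u, w - 1) * B $$ (w - 1, v))"
proof -
  have "(A * B) $$ (u, v) = (\<Sum>w<N. A $$ (u, w) * B $$ (w, v))"
    using A uv by (simp add: scalar_prod_def atLeast0LessThan)
  then show ?thesis by (simp add: sum_pred_lessThan)
qed

text \<open>The arbitrary weight \<open>g\<close> of the two end points makes the induction work:
  the last step of the walk is absorbed into a new weight \<open>g'\<close>. Choosing for
  \<open>g\<close> the matrix entry from the end back to the start closes the walk.\<close>

lemma sum_walks_eq_power: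
  fixes A :: "complex mat"
  assumes A: "A \<in> carrier_mat N N"
  shows "(\<Sum>i \<in> PiE {s..s + n} (\<lambda>_. {1..N}). (\<Prod>l\<in>{s..<s + n}. A $$ (i l - 1, i (Suc l) - 1)) * g (i s) (i (s + n))) =
    (\<Sum>u\<in>{1..N}. \<Sum>v\<in>{1..N}. (A ^\<^sub>m n) $$ (u - 1, v - 1) * g u v)"
proof (induction n arbitrary: g)
  case 0
  have "(\<Sum>i \<in> PiE {s..s + 0} (\<lambda>_. {1..N}). (\<Prod>l\<in>{s..<s + 0}. A $$ (i l - 1, i (Suc l) - 1)) * g (i s) (i (s + 0))) =
      (\<Sum>u\<in>{1..N}. g u u)"
    using sum_PiE_insert[where a=s and A="{}" and I="{1..N}" and G="\<lambda>i. g (i s) (i s)"] by simp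
  also have "\<dots> = (\<Sum>u\<in>{1..N}. \<Sum>v\<in>{1..N}. (A ^\<^sub>m 0) $$ (u - 1, v - 1) * g u v)"
  proof (rule sum.cong[OF refl])
    fix u assume u: "u \<in> {1..N}"
    have "(\<Sum>v\<in>{1..N}. (A ^\<^sub>m 0) $$ (u - 1, v - 1) * g u v) = (\<Sum>v\<in>{1..N}. if v = u then g u u else 0)"
      by (rule sum.cong[OF refl]) (use u A in auto)
    then show "g u u = (\<Sum>v\<in>{1..N}. (A ^\<^sub>m 0) $$ (u - 1, v - 1) * g u v)" using u by simp
  qed
  finally show ?case .
next
  case (Suc n)
  have An: "A ^\<^sub>m n \<in> carrier_mat N N" using A by simp
  define g' where "g' u w = (\<Sum>v\<in>{1..N}. A $$ (w - 1, v - 1) * g u v)" for u w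
  have ins: "{s..s + Suc n} = insert (s + Suc n) {s..s + n}" by auto
  have "(\<Sum>i \<in> PiE {s..s + Suc n} (\<lambda>_. {1..N}). (\<Prod>l\<in>{s..<s + Suc n}. A $$ (i l - 1, i (Suc l) - 1)) * g (i s) (i (s + Suc n))) =
      (\<Sum>i \<in> PiE {s..s + n} (\<lambda>_. {1..N}). \<Sum>v\<in>{1..N}.
         (\<Prod>l\<in>{s..<s + n}. A $$ (i l - 1, i (Suc l) - 1)) * (A $$ (i (s + n) - 1, v - 1) * g (i s) v))"
    unfolding ins
  proof (subst sum_PiE_insert, simp, intro sum.cong refl, goal_cases)
    case (1 i v)
    have "(\<Prod>l\<in>{s..<s + n}. A $$ ((i(s + Suc n := v)) l - 1, (i(s + Suc n := v)) (Suc l) - 1)) =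
        (\<Prod>l\<in>{s..<s + n}. A $$ (i l - 1, i (Suc l) - 1))"
      by (rule prod.cong[OF refl]) auto
    then show ?case by (simp add: mult_ac)
  qed
  also have "\<dots> = (\<Sum>i \<in> PiE {s..s + n} (\<lambda>_. {1..N}). (\<Prod>l\<in>{s..<s + n}. A $$ (i l - 1, i (Suc l) - 1)) * g' (i s) (i (s + n)))"
    by (simp add: g'_def sum_distrib_left)
  also have "\<dots> = (\<Sum>u\<in>{1..N}. \<Sum>w\<in>{1..N}. (A ^\<^sub>m n) $$ (u - 1, w - 1) * g' u w)"
    by (rule Suc.IH)
  also have "\<dots> = (\<Sum>u\<in>{1..N}. \<Sum>v\<in>{1..N}. (A ^\<^sub>m Suc n) $$ (u - 1, v - 1) * g u v)"
  proof (rule sum.cong[OF refl])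
    fix u assume u: "u \<in> {1..N}"
    have "(\<Sum>w\<in>{1..N}. (A ^\<^sub>m n) $$ (u - 1, w - 1) * g' u w) =
        (\<Sum>w\<in>{1..N}. \<Sum>v\<in>{1..N}. (A ^\<^sub>m n) $$ (u - 1, w - 1) * A $$ (w - 1, v - 1) * g u v)"
      by (simp add: g'_def sum_distrib_left mult.assoc)
    also have "\<dots> = (\<Sum>v\<in>{1..N}. \<Sum>w\<in>{1..N}. (A ^\<^sub>m n) $$ (u - 1, w - 1) * A $$ (w - 1, v - 1) * g u v)"
      by (rule sum.swap)
    also have "\<dots> = (\<Sum>v\<in>{1..N}. (A ^\<^sub>m Suc n) $$ (u - 1, v - 1) * g u v)"
    proof (rule sum.cong[OF refl])
      fix v assume v: "v \<in> {1..N}"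
      have "(A ^\<^sub>m Suc n) $$ (u - 1, v - 1) = (\<Sum>w\<in>{1..N}. (A ^\<^sub>m n) $$ (u - 1, w - 1) * A $$ (w - 1, v - 1))"
        using mat_mult_entry[OF An A, of "u - 1" "v - 1"] u v by auto
      then show "(\<Sum>w\<in>{1..N}. (A ^\<^sub>m n) $$ (u - 1, w - 1) * A $$ (w - 1, v - 1) * g u v) =
          (A ^\<^sub>m Suc n) $$ (u - 1, v - 1) * g u v"
        by (simp only: sum_distrib_right)
    qed
    finally show "(\<Sum>w\<in>{1..N}. (A ^\<^sub>m n) $$ (u - 1, w - 1) * g' u w) =
        (\<Sum>v\<in>{1..N}. (A ^\<^sub>m Suc n) $$ (u - 1, v - 1) * g u v)" .
  qed
  finally show ?case .
qed

lemma mat_trace_power: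
  assumes A: "A \<in> carrier_mat N N" and k: "k \<in> {1..r}" and ms: "ms k \<ge> 1"
  shows "mat_trace (A ^\<^sub>m ms k) =
    (\<Sum>i \<in> PiE (cycle_block ms k) (\<lambda>_. {1..N}).
       \<Prod>l\<in>cycle_block ms k. A $$ (i l - 1, i (cycles_perm r ms l) - 1))"
proof -
  let ?\<gamma> = "cycles_perm r ms"
  \<comment> \<open>One factor of the power is set aside as the closing edge, at which
    \<open>\<gamma>\<close> jumps from the last point of the cycle back to the first.\<close>
  obtain n where n: "ms k = Suc n" using ms by (cases "ms k") auto
  define s where "s = Suc (offset ms k)"
  have An: "A ^\<^sub>m n \<in> carrier_mat N N" using A by simp
  have end': "offset ms (Suc k) = s + n" using k n by (simp add: s_def offset_Suc)
  have W: "cycle_block ms k = {s..s + n}" unfolding cycle_block_def end' by (auto simp: s_def)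
  have \<gamma>: "?\<gamma> l = (if l = s + n then s else Suc l)" if "l \<in> {s..s + n}" for l
    using cycles_perm_eq[OF k, of l ms] that unfolding W end' s_def[symmetric] by simp
  have "mat_trace (A ^\<^sub>m ms k) = (\<Sum>u<N. (A ^\<^sub>m n * A) $$ (u, u))"
    using A by (simp add: mat_trace_def n)
  also have "\<dots> = (\<Sum>u\<in>{1..N}. (A ^\<^sub>m n * A) $$ (u - 1, u - 1))" by (rule sum_pred_lessThan)
  also have "\<dots> = (\<Sum>u\<in>{1..N}. \<Sum>v\<in>{1..N}. (A ^\<^sub>m n) $$ (u - 1, v - 1) * A $$ (v - 1, u - 1))"
    by (rule sum.cong[OF refl], rule mat_mult_entry[OF An A]) auto
  also have "\<dots> = (\<Sum>i \<in> PiE {s..s + n} (\<lambda>_. {1..N}).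
      (\<Prod>l\<in>{s..<s + n}. A $$ (i l - 1, i (Suc l) - 1)) * A $$ (i (s + n) - 1, i s - 1))"
    by (rule sum_walks_eq_power[OF A, symmetric])
  also have "\<dots> = (\<Sum>i \<in> PiE {s..s + n} (\<lambda>_. {1..N}). \<Prod>l\<in>{s..s + n}. A $$ (i l - 1, i (?\<gamma> l) - 1))"
  proof (rule sum.cong[OF refl])
    fix i
    have eq: "{s..s + n} = insert (s + n) {s..<s + n}" by auto
    have "(\<Prod>l\<in>{s..<s + n}. A $$ (i l - 1, i (Suc l) - 1)) = (\<Prod>l\<in>{s..<s + n}. A $$ (i l - 1, i (?\<gamma> l) - 1))"
      by (rule prod.cong[OF refl]) (simp add: \<gamma>)
    moreover have "A $$ (i (s + n) - 1, i s - 1) = A $$ (i (s + n) - 1, i (?\<gamma> (s + n)) - 1)"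
      using \<gamma>[of "s + n"] by simp
    ultimately show "(\<Prod>l\<in>{s..<s + n}. A $$ (i l - 1, i (Suc l) - 1)) * A $$ (i (s + n) - 1, i s - 1) =
        (\<Prod>l\<in>{s..s + n}. A $$ (i l - 1, i (?\<gamma> l) - 1))"
      unfolding eq by (subst prod.insert) (auto simp: mult_ac)
  qed
  finally show ?thesis unfolding W .
qed

lemma trace_wigner_power:
  assumes k: "k \<in> {1..r}" and ms: "ms k \<ge> 1"
  shows "mat_trace (wigner_mat N x \<omega> ^\<^sub>m ms k) =
    (1 / complex_of_real (sqrt (real N))) ^ ms k *
    (\<Sum>i \<in> PiE (cycle_block ms k) (\<lambda>_. {1..N}). \<Prod>l\<in>cycle_block ms k. x (i l) (i (cycles_perm r ms l)) \<omega>)"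
proof -
  let ?\<gamma> = "cycles_perm r ms" and ?W = "cycle_block ms k"
  define c where "c = 1 / complex_of_real (sqrt (real N))"
  have A: "wigner_mat N x \<omega> \<in> carrier_mat N N" by (simp add: wigner_mat_def)
  have "mat_trace (wigner_mat N x \<omega> ^\<^sub>m ms k) =
      (\<Sum>i \<in> PiE ?W (\<lambda>_. {1..N}). \<Prod>l\<in>?W. wigner_mat N x \<omega> $$ (i l - 1, i (?\<gamma> l) - 1))"
    by (rule mat_trace_power[where ms=ms and k=k and r=r, OF A k ms])
  also have "\<dots> = (\<Sum>i \<in> PiE ?W (\<lambda>_. {1..N}). \<Prod>l\<in>?W. c * x (i l) (i (?\<gamma> l)) \<omega>)"
  proof (intro sum.cong refl prod.cong, goal_cases)
    case (1 i l)
    have "i l \<in> {1..N}" "i (?\<gamma> l) \<in> {1..N}"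
      using 1 cycles_perm_in_block[OF k] by (auto simp: PiE_iff)
    then have "i l - 1 < N" "i (?\<gamma> l) - 1 < N" "Suc (i l - 1) = i l" "Suc (i (?\<gamma> l) - 1) = i (?\<gamma> l)"
      by auto
    then show ?case by (simp add: wigner_mat_def c_def del: One_nat_def)
  qed
  also have "\<dots> = (\<Sum>i \<in> PiE ?W (\<lambda>_. {1..N}). c ^ ms k * (\<Prod>l\<in>?W. x (i l) (i (?\<gamma> l)) \<omega>))"
    using card_cycle_block[of k ms] k by (simp add: prod.distrib)
  finally show ?thesis by (simp only: sum_distrib_left c_def)
qed

section \<open>The cumulant of traces as a sum over index functions\<close>

text \<open>The contribution of one index function to the cumulant of the unnormalized traces.
  Written with \<open>\<beta>\<close> and \<open>balanced_block\<close>, it involves neither N nor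
  the random variables and makes sense for index functions with arbitrary values.\<close>

definition index_weight :: "(nat \<Rightarrow> real) \<Rightarrow> nat \<Rightarrow> (nat \<Rightarrow> nat) \<Rightarrow> (nat \<Rightarrow> nat) \<Rightarrow> complex" where
  "index_weight \<beta> r ms i =
     (\<Sum>\<tau> | partition_on {1..offset ms (Suc r)} \<tau> \<and> links (cycle_block ms) {1..r} \<tau>.
        \<Prod>B\<in>\<tau>. if balanced_block (cycles_perm r ms) i B then complex_of_real (\<beta> (card B)) else 0)"

lemma (in complex_wigner_matrix) cumulant_partition_entries:
  assumes \<beta>: "\<beta> 2 \<ge> 0" and m: "m = offset ms (Suc r)"
    and i: "\<And>l. l \<in> {1..m} \<Longrightarrow> i l \<in> {1..N}" and \<tau>: "partition_on {1..m} \<tau>"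
  shows "cumulant_partition M \<tau> (\<lambda>l. x (i l) (i (cycles_perm r ms l))) =
    (\<Prod>B\<in>\<tau>. if balanced_block (cycles_perm r ms) i B then complex_of_real (\<beta> (card B)) else 0)"
  unfolding cumulant_partition_def
proof (rule prod.cong[OF refl])
  fix B assume B: "B \<in> \<tau>"
  have sub: "B \<subseteq> {1..m}" by (rule partition_on_block_subset[OF \<tau> B])
  show "cumulant M B (\<lambda>l. x (i l) (i (cycles_perm r ms l))) =
      (if balanced_block (cycles_perm r ms) i B then complex_of_real (\<beta> (card B)) else 0)"
  proof (rule cumulant_entries[OF \<beta>])
    show "finite B" using finite_subset[OF sub] by simp
    show "B \<noteq> {}" using partition_onD3[OF \<tau>] B by auto
    fix l assume "l \<in> B"
    then have l: "l \<in> {1..m}" using sub by auto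
    then have "cycles_perm r ms l \<in> {1..m}"
      using permutes_in_image[OF cycles_perm_permutes[of r ms], of l] m by simp
    then show "i l \<in> {1..N} \<and> i (cycles_perm r ms l) \<in> {1..N}" using i l by simp
  qed
qed

lemma (in complex_wigner_matrix) cumulant_traces:
  assumes \<beta>: "\<beta> 2 \<ge> 0" and r: "r \<ge> 1" and ms: "\<And>k. k \<in> {1..r} \<Longrightarrow> ms k \<ge> 1"
    and m: "m = offset ms (Suc r)"
  shows "cumulant M {1..r} (\<lambda>k \<omega>. mat_trace (wigner_mat N x \<omega> ^\<^sub>m ms k)) =
    (1 / complex_of_real (sqrt (real N))) ^ m * (\<Sum>i \<in> PiE {1..m} (\<lambda>_. {1..N}). index_weight \<beta> r ms i)"
proof -
  define \<gamma> where "\<gamma> = cycles_perm r ms"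
  define c where "c = 1 / complex_of_real (sqrt (real N))"
  define W where "W = cycle_block ms"
  define F where "F C i = (\<integral>\<omega>. (\<Prod>l\<in>C. x (i l) (i (\<gamma> l)) \<omega>) \<partial>M)" for C i
  define g where "g S = (\<Sum>i \<in> PiE (\<Union>(W ` S)) (\<lambda>_. {1..N}). F (\<Union>(W ` S)) i)" for S
  have disj: "disjoint_family_on W K" for K unfolding W_def by (rule disjoint_cycle_blocks)
  have finW: "finite (W k)" for k unfolding W_def by (rule finite_cycle_block)
  have \<gamma>W: "\<gamma> l \<in> W k" if "k \<in> {1..r}" "l \<in> W k" for k l
    using cycles_perm_in_block that by (simp add: \<gamma>_def W_def)
  have UW: "\<Union>(W ` {1..r}) = {1..m}" unfolding W_def m by (rule Union_cycle_blocks)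
  \<comment> \<open>Up to scaling, the moment of the traces in \<open>S\<close> is a sum over index
    functions of a moment at the positions of \<open>S\<close>, which is the form required by
    multilinearity.\<close>
  have moment: "(\<integral>\<omega>. (\<Prod>k\<in>S. mat_trace (wigner_mat N x \<omega> ^\<^sub>m ms k)) \<partial>M) = (\<Prod>k\<in>S. c ^ ms k) * g S"
    if S: "S \<subseteq> {1..r}" for S
  proof -
    have finS: "finite S" using finite_subset[OF S] by simp
    have *: "(\<Prod>k\<in>S. mat_trace (wigner_mat N x \<omega> ^\<^sub>m ms k)) =
        (\<Prod>k\<in>S. c ^ ms k) * (\<Sum>i \<in> PiE (\<Union>(W ` S)) (\<lambda>_. {1..N}). \<Prod>l\<in>\<Union>(W ` S). x (i l) (i (\<gamma> l)) \<omega>)" for \<omega>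
    proof -
      have "(\<Prod>k\<in>S. mat_trace (wigner_mat N x \<omega> ^\<^sub>m ms k)) =
          (\<Prod>k\<in>S. c ^ ms k * (\<Sum>i \<in> PiE (W k) (\<lambda>_. {1..N}). \<Prod>l\<in>W k. x (i l) (i (\<gamma> l)) \<omega>))"
        unfolding c_def W_def \<gamma>_def
        by (rule prod.cong[OF refl], rule trace_wigner_power) (use S ms in auto)
      also have "\<dots> = (\<Prod>k\<in>S. c ^ ms k) *
          (\<Prod>k\<in>S. \<Sum>i \<in> PiE (W k) (\<lambda>_. {1..N}). \<Prod>l\<in>W k. x (i l) (i (\<gamma> l)) \<omega>)"
        by (rule prod.distrib)
      also have "(\<Prod>k\<in>S. \<Sum>i \<in> PiE (W k) (\<lambda>_. {1..N}). \<Prod>l\<in>W k. x (i l) (i (\<gamma> l)) \<omega>) =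
          (\<Sum>i \<in> PiE (\<Union>(W ` S)) (\<lambda>_. {1..N}). \<Prod>k\<in>S. \<Prod>l\<in>W k. x (i l) (i (\<gamma> l)) \<omega>)"
      proof (rule prod_sum_PiE_disjoint[OF finS disj])
        fix k and i j :: "nat \<Rightarrow> nat"
        assume k: "k \<in> S" and ij: "\<And>a. a \<in> W k \<Longrightarrow> i a = j a"
        show "(\<Prod>l\<in>W k. x (i l) (i (\<gamma> l)) \<omega>) = (\<Prod>l\<in>W k. x (j l) (j (\<gamma> l)) \<omega>)"
        proof (rule prod.cong[OF refl])
          fix l assume l: "l \<in> W k"
          have "\<gamma> l \<in> W k" using \<gamma>W[of k l] S k l by auto
          then show "x (i l) (i (\<gamma> l)) \<omega> = x (j l) (j (\<gamma> l)) \<omega>" using ij[OF l] ij[of "\<gamma> l"] by simp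
        qed
      qed
      also have "\<dots> = (\<Sum>i \<in> PiE (\<Union>(W ` S)) (\<lambda>_. {1..N}). \<Prod>l\<in>\<Union>(W ` S). x (i l) (i (\<gamma> l)) \<omega>)"
      proof (rule sum.cong[OF refl], rule prod.UNION_disjoint[symmetric])
        show "\<forall>i\<in>S. \<forall>j\<in>S. i \<noteq> j \<longrightarrow> W i \<inter> W j = {}" using disj[of S] by (simp add: disjoint_family_on_def)
      qed (use finS finW in auto)
      finally show ?thesis .
    qed
    \<comment> \<open>Exchanging the sum with the Bochner integral requires every summand to be
      integrable.\<close>
    have int: "integrable M (\<lambda>\<omega>. \<Prod>l\<in>\<Union>(W ` S). x (i l) (i (\<gamma> l)) \<omega>)"
      if i: "i \<in> PiE (\<Union>(W ` S)) (\<lambda>_. {1..N})" for i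
    proof (rule moment_prod_keys(2)[OF \<beta>])
      show "finite (\<Union>(W ` S))" using finS finW by simp
      fix l assume l: "l \<in> \<Union>(W ` S)"
      then obtain k where k: "k \<in> S" "l \<in> W k" by auto
      then have "\<gamma> l \<in> W k" using \<gamma>W[of k l] S by (meson subsetD)
      then have "\<gamma> l \<in> \<Union>(W ` S)" using k by blast
      then show "i l \<in> {1..N} \<and> i (\<gamma> l) \<in> {1..N}" using PiE_mem[OF i] l by blast
    qed
    show ?thesis unfolding * g_def F_def
      by (subst integral_mult_right_zero) (simp add: Bochner_Integration.integral_sum int)
  qed
  have "cumulant M {1..r} (\<lambda>k \<omega>. mat_trace (wigner_mat N x \<omega> ^\<^sub>m ms k)) =
      set_cumulant (\<lambda>S. (\<Prod>k\<in>S. c ^ ms k) * g S) {1..r}"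
    unfolding cumulant_eq_set_cumulant by (rule set_cumulant_cong[OF moment])
  also have "\<dots> = (\<Prod>k\<in>{1..r}. c ^ ms k) * set_cumulant g {1..r}"
    by (rule set_cumulant_scale) simp
  also have "(\<Prod>k\<in>{1..r}. c ^ ms k) = c ^ m"
    unfolding m offset_Suc' by (rule power_sum[symmetric])
  also have "set_cumulant g {1..r} = (\<Sum>i \<in> PiE {1..m} (\<lambda>_. {1..N}). set_cumulant (\<lambda>S. F (\<Union>(W ` S)) i) {1..r})"
    unfolding g_def[abs_def] UW[symmetric]
  proof (rule set_cumulant_sum_PiE[OF _ disj])
    fix S and i j :: "nat \<Rightarrow> nat"
    assume S: "S \<subseteq> {1..r}" and ij: "\<And>a. a \<in> \<Union>(W ` S) \<Longrightarrow> i a = j a"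
    have "(\<Prod>l\<in>\<Union>(W ` S). x (i l) (i (\<gamma> l)) \<omega>) = (\<Prod>l\<in>\<Union>(W ` S). x (j l) (j (\<gamma> l)) \<omega>)" for \<omega>
    proof (rule prod.cong[OF refl])
      fix l assume l: "l \<in> \<Union>(W ` S)"
      then obtain k where k: "k \<in> S" "l \<in> W k" by auto
      then have "\<gamma> l \<in> W k" using \<gamma>W[of k l] S by (meson subsetD)
      then have "\<gamma> l \<in> \<Union>(W ` S)" using k by blast
      then show "x (i l) (i (\<gamma> l)) \<omega> = x (j l) (j (\<gamma> l)) \<omega>" using ij[OF l] ij[of "\<gamma> l"] by simp
    qed
    then show "F (\<Union>(W ` S)) i = F (\<Union>(W ` S)) j" unfolding F_def by (simp only:)
  qed simp
  also have "\<dots> = (\<Sum>i \<in> PiE {1..m} (\<lambda>_. {1..N}). index_weight \<beta> r ms i)"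
  proof (rule sum.cong[OF refl])
    fix i assume i: "i \<in> PiE {1..m} (\<lambda>_. {1..N})"
    have "set_cumulant (\<lambda>S. F (\<Union>(W ` S)) i) {1..r} =
        (\<Sum>\<tau> | partition_on (\<Union>(W ` {1..r})) \<tau> \<and> links W {1..r} \<tau>. \<Prod>B\<in>\<tau>. set_cumulant (\<lambda>C. F C i) B)"
      by (rule set_cumulant_Union[where f="\<lambda>C. F C i"]) (use r finW disj in \<open>auto simp: F_def prob_space\<close>)
    also have "\<dots> = index_weight \<beta> r ms i"
      unfolding index_weight_def UW W_def[symmetric] m[symmetric]
    proof (rule sum.cong[OF refl])
      fix \<tau> assume "\<tau> \<in> {\<tau>. partition_on {1..m} \<tau> \<and> links W {1..r} \<tau>}"
      then have \<tau>: "partition_on {1..m} \<tau>" by simp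
      have "i l \<in> {1..N}" if "l \<in> {1..m}" for l using i that by (rule PiE_mem)
      from cumulant_partition_entries[OF \<beta> m this \<tau>]
      show "(\<Prod>B\<in>\<tau>. set_cumulant (\<lambda>C. F C i) B) =
          (\<Prod>B\<in>\<tau>. if balanced_block (cycles_perm r ms) i B then complex_of_real (\<beta> (card B)) else 0)"
        by (simp only: cumulant_partition_def cumulant_eq_set_cumulant F_def \<gamma>_def)
    qed
    finally show "set_cumulant (\<lambda>S. F (\<Union>(W ` S)) i) {1..r} = index_weight \<beta> r ms i" .
  qed
  finally show ?thesis unfolding c_def .
qed

section \<open>Grouping index functions by their kernels\<close>

text \<open>For some \<open>f \<in> F\<close>, the vertices \<open>j f\<close> and
  \<open>j (\<gamma> f)\<close> take the place of \<open>u\<close> and \<open>v\<close>. Such an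
  \<open>f\<close> exists because \<open>F\<close> is half of a nonempty block.\<close>

lemma balanced_block_cong:
  assumes C: "finite C" "C \<noteq> {}" "C \<subseteq> A" "\<And>l. l \<in> C \<Longrightarrow> \<gamma> l \<in> A"
    and ij: "\<And>a b. a \<in> A \<Longrightarrow> b \<in> A \<Longrightarrow> i a = i b \<longleftrightarrow> j a = j b"
    and bal: "balanced_block \<gamma> i C"
  shows "balanced_block \<gamma> j C"
proof -
  obtain F G u v where FG: "F \<inter> G = {}" "F \<union> G = C" "card F = card G"
    and F: "\<And>l. l \<in> F \<Longrightarrow> i l = u \<and> i (\<gamma> l) = v" and G: "\<And>l. l \<in> G \<Longrightarrow> i l = v \<and> i (\<gamma> l) = u"
    and uv: "u = v \<longrightarrow> card C = 2"
    using bal unfolding balanced_block_def by metis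
  have fin: "finite F" "finite G" using C(1) FG(2) by auto
  have "F \<noteq> {}"
  proof
    assume "F = {}"
    then have "G = {}" using FG(3) fin by simp
    then show False using \<open>F = {}\<close> FG(2) C(2) by simp
  qed
  then obtain f where f: "f \<in> F" by auto
  have mem: "l \<in> A" "\<gamma> l \<in> A" if "l \<in> F \<union> G" for l using that C(3,4) FG(2) by auto
  have fA: "f \<in> A" "\<gamma> f \<in> A" using mem[of f] f by auto
  have iff: "a \<in> A \<Longrightarrow> b \<in> A \<Longrightarrow> i a = i b \<Longrightarrow> j a = j b" for a b using ij by simp
  have F': "j l = j f \<and> j (\<gamma> l) = j (\<gamma> f)" if "l \<in> F" for l
    using iff[of l f] iff[of "\<gamma> l" "\<gamma> f"] mem[of l] fA F[OF that] F[OF f] that by simp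
  have G': "j l = j (\<gamma> f) \<and> j (\<gamma> l) = j f" if "l \<in> G" for l
    using iff[of l "\<gamma> f"] iff[of "\<gamma> l" f] mem[of l] fA G[OF that] F[OF f] that by simp
  have "j f = j (\<gamma> f) \<longrightarrow> card C = 2"
    using ij[OF fA] F[OF f] uv by simp
  moreover have "\<forall>l\<in>F. j l = j f \<and> j (\<gamma> l) = j (\<gamma> f)" by (rule ballI) (rule F')
  moreover have "\<forall>l\<in>G. j l = j (\<gamma> f) \<and> j (\<gamma> l) = j f" by (rule ballI) (rule G')
  ultimately have "F \<inter> G = {} \<and> F \<union> G = C \<and> card F = card G \<and> (\<forall>l\<in>F. j l = j f \<and> j (\<gamma> l) = j (\<gamma> f)) \<and>
      (\<forall>l\<in>G. j l = j (\<gamma> f) \<and> j (\<gamma> l) = j f) \<and> (j f = j (\<gamma> f) \<longrightarrow> card C = 2)"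
    by (intro conjI FG)
  then show ?thesis unfolding balanced_block_def by (intro exI)
qed

lemma index_weight_cong:
  assumes ij: "\<And>a b. a \<in> {1..offset ms (Suc r)} \<Longrightarrow> b \<in> {1..offset ms (Suc r)} \<Longrightarrow> i a = i b \<longleftrightarrow> j a = j b"
  shows "index_weight \<beta> r ms i = index_weight \<beta> r ms j"
  unfolding index_weight_def
proof (intro sum.cong refl prod.cong, goal_cases)
  case (1 \<tau> B)
  let ?A = "{1..offset ms (Suc r)}" and ?\<gamma> = "cycles_perm r ms"
  have \<tau>: "partition_on ?A \<tau>" using 1 by simp
  have sub: "B \<subseteq> ?A" by (rule partition_on_block_subset[OF \<tau> 1(2)])
  have fin: "finite B" using finite_subset[OF sub] by simp
  have ne: "B \<noteq> {}" using partition_onD3[OF \<tau>] 1(2) by auto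
  have \<gamma>: "?\<gamma> l \<in> ?A" if "l \<in> B" for l
    using permutes_in_image[OF cycles_perm_permutes[of r ms], of l] sub that by auto
  have "balanced_block ?\<gamma> i B \<longleftrightarrow> balanced_block ?\<gamma> j B"
  proof
    show "balanced_block ?\<gamma> i B \<Longrightarrow> balanced_block ?\<gamma> j B"
      by (rule balanced_block_cong[OF fin ne sub \<gamma> ij])
    show "balanced_block ?\<gamma> j B \<Longrightarrow> balanced_block ?\<gamma> i B"
      by (rule balanced_block_cong[OF fin ne sub \<gamma> ij[symmetric]])
  qed
  then show ?case by simp
qed

text \<open>If all blocks of a linking \<open>\<tau>\<close> were balanced,
  \<open>card_vertices_le\<close> with \<open>r\<close> faces would contradict the number of
  vertices. So each product has a factor 0.\<close>

lemma index_weight_eq_0: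
  assumes ms: "\<And>k. k \<in> {1..r} \<Longrightarrow> ms k \<ge> 1"
    and large: "2 * card (i ` {1..offset ms (Suc r)}) + 2 * r > offset ms (Suc r) + 4"
  shows "index_weight \<beta> r ms i = 0"
  unfolding index_weight_def
proof (rule sum.neutral, rule ballI)
  let ?A = "{1..offset ms (Suc r)}" and ?\<gamma> = "cycles_perm r ms"
  fix \<tau> assume "\<tau> \<in> {\<tau>. partition_on ?A \<tau> \<and> links (cycle_block ms) {1..r} \<tau>}"
  then have \<tau>: "partition_on ?A \<tau>" and links: "links (cycle_block ms) {1..r} \<tau>" by auto
  have "\<exists>B\<in>\<tau>. \<not> balanced_block ?\<gamma> i B"
  proof (rule ccontr)
    assume "\<not> (\<exists>B\<in>\<tau>. \<not> balanced_block ?\<gamma> i B)"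
    then have bal: "balanced_block ?\<gamma> i B" if "B \<in> \<tau>" for B using that by auto
    have "2 * card (i ` ?A) + 2 * ncomp ?A (graph_of ?\<gamma>) \<le> card ?A + 4"
      by (rule card_vertices_le[OF _ cycles_perm_permutes \<tau> bal])
        (auto intro!: links_connected[OF links Union_cycle_blocks conn_cycles_perm_block _ _ \<tau>])
    then show False using large ncomp_cycles_perm[of r ms, OF ms] by simp
  qed
  moreover have "finite \<tau>" by (rule finite_elements[OF _ \<tau>]) simp
  ultimately show "(\<Prod>B\<in>\<tau>. if balanced_block ?\<gamma> i B then complex_of_real (\<beta> (card B)) else 0) = 0"
    by (auto simp: prod_zero_iff)
qed

lemma card_image_eq_of_same_kernel:
  assumes A: "finite A" and fg: "\<And>a b. a \<in> A \<Longrightarrow> b \<in> A \<Longrightarrow> f a = f b \<longleftrightarrow> g a = g b"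
  shows "card (f ` A) = card (g ` A)"
proof -
  have le: "card (g ` A) \<le> card (f ` A)"
    if fg: "\<And>a b. a \<in> A \<Longrightarrow> b \<in> A \<Longrightarrow> f a = f b \<Longrightarrow> g a = g b" for f :: "'a \<Rightarrow> 'x" and g :: "'a \<Rightarrow> 'y"
  proof -
    have "g a = g (inv_into A f (f a))" if "a \<in> A" for a
      by (rule fg) (use that in \<open>auto simp: f_inv_into_f inv_into_into\<close>)
    then have "g ` A \<subseteq> (\<lambda>v. g (inv_into A f v)) ` (f ` A)" by auto
    then show ?thesis using A by (meson card_image_le card_mono finite_imageI le_trans)
  qed
  show ?thesis by (rule antisym; rule le) (use fg in auto)
qed

definition kernel_partition :: "'a set \<Rightarrow> ('a \<Rightarrow> 'b) \<Rightarrow> 'a set set" where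
  "kernel_partition A i = (\<lambda>a. {b \<in> A. i b = i a}) ` A"

lemma partition_on_kernel: "partition_on A (kernel_partition A i)"
proof (rule partition_onI)
  show "\<Union>(kernel_partition A i) = A" by (auto simp: kernel_partition_def)
  show "{} \<notin> kernel_partition A i" by (auto simp: kernel_partition_def)
  show "disjnt p q" if pq: "p \<in> kernel_partition A i" "q \<in> kernel_partition A i" "p \<noteq> q" for p q
  proof -
    obtain a b where ab: "p = {c \<in> A. i c = i a}" "q = {c \<in> A. i c = i b}"
      using pq unfolding kernel_partition_def by auto
    then have "i a \<noteq> i b" using pq(3) by auto
    then show ?thesis unfolding ab disjnt_def by auto
  qed
qed

lemma block_of_kernel:
  assumes a: "a \<in> A" shows "block_of (kernel_partition A i) a = {b \<in> A. i b = i a}"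
proof (rule block_of_eq[OF partition_on_kernel])
  show "{b \<in> A. i b = i a} \<in> kernel_partition A i" unfolding kernel_partition_def by (rule imageI[OF a])
  show "a \<in> {b \<in> A. i b = i a}" using a by simp
qed

lemma image_block_of:
  assumes \<pi>: "partition_on A \<pi>"
  shows "block_of \<pi> ` A = \<pi>"
proof (intro equalityI subsetI)
  fix B assume "B \<in> block_of \<pi> ` A"
  then show "B \<in> \<pi>" using block_of_mem(1)[OF \<pi>] by auto
next
  fix B assume B: "B \<in> \<pi>"
  then obtain b where b: "b \<in> B" using partition_onD3[OF \<pi>] by fastforce
  then have "block_of \<pi> b = B" "b \<in> A"
    using block_of_eq[OF \<pi> B b] partition_on_block_subset[OF \<pi> B] by auto
  then show "B \<in> block_of \<pi> ` A" by auto
qed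

lemma kernel_partition_eqI:
  assumes \<pi>: "partition_on A \<pi>"
    and i: "\<And>a b. a \<in> A \<Longrightarrow> b \<in> A \<Longrightarrow> i a = i b \<longleftrightarrow> block_of \<pi> a = block_of \<pi> b"
  shows "kernel_partition A i = \<pi>"
proof -
  have "{b \<in> A. i b = i a} = block_of \<pi> a" if a: "a \<in> A" for a
  proof (intro equalityI subsetI)
    fix b assume "b \<in> {b \<in> A. i b = i a}"
    then have "b \<in> A" "block_of \<pi> b = block_of \<pi> a" using i[of b a] a by auto
    then show "b \<in> block_of \<pi> a" using block_of_mem(2)[OF \<pi>, of b] by simp
  next
    fix b assume b: "b \<in> block_of \<pi> a"
    have B: "block_of \<pi> a \<in> \<pi>" by (rule block_of_mem(1)[OF \<pi> a])
    have "b \<in> A" using partition_on_block_subset[OF \<pi> B] b by auto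
    moreover have "block_of \<pi> b = block_of \<pi> a" by (rule block_of_eq[OF \<pi> B b])
    ultimately show "b \<in> {b \<in> A. i b = i a}" using i[of b a] a by simp
  qed
  then have "kernel_partition A i = block_of \<pi> ` A" unfolding kernel_partition_def by auto
  then show ?thesis using image_block_of[OF \<pi>] by simp
qed

text \<open>Functions with kernel \<open>\<pi>\<close> are the injections of its blocks into
  \<open>I\<close>. The truncated differences make the product 0 when \<open>I\<close> has fewer
  elements than \<open>\<pi>\<close> has blocks.\<close>

lemma card_functions_with_kernel:
  assumes A: "finite A" and I: "finite I" and \<pi>: "partition_on A \<pi>"
  shows "card {i \<in> PiE A (\<lambda>_. I). kernel_partition A i = \<pi>} = (\<Prod>k<card \<pi>. card I - k)"
proof -
  have fin: "finite \<pi>" by (rule finite_elements[OF A \<pi>])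
  define \<Psi> where "\<Psi> f = (\<lambda>a\<in>A. f (block_of \<pi> a))" for f :: "'a set \<Rightarrow> 'b"
  define rep where "rep B = (SOME a. a \<in> B)" for B :: "'a set"
  have rep: "rep B \<in> B" "rep B \<in> A" "block_of \<pi> (rep B) = B" if B: "B \<in> \<pi>" for B
  proof -
    have "B \<noteq> {}" using partition_onD3[OF \<pi>] B by auto
    then show r: "rep B \<in> B" unfolding rep_def by (simp add: some_in_eq)
    then show "rep B \<in> A" using partition_on_block_subset[OF \<pi> B] by auto
    show "block_of \<pi> (rep B) = B" by (rule block_of_eq[OF \<pi> B r])
  qed
  have "bij_betw \<Psi> {f \<in> PiE \<pi> (\<lambda>_. I). inj_on f \<pi>} {i \<in> PiE A (\<lambda>_. I). kernel_partition A i = \<pi>}"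
  proof (rule bij_betw_byWitness[where f'="\<lambda>i. \<lambda>B\<in>\<pi>. i (rep B)"])
    show "\<forall>f\<in>{f \<in> PiE \<pi> (\<lambda>_. I). inj_on f \<pi>}. (\<lambda>B\<in>\<pi>. \<Psi> f (rep B)) = f"
    proof
      fix f assume "f \<in> {f \<in> PiE \<pi> (\<lambda>_. I). inj_on f \<pi>}"
      then have f: "f \<in> PiE \<pi> (\<lambda>_. I)" by simp
      show "(\<lambda>B\<in>\<pi>. \<Psi> f (rep B)) = f"
      proof
        fix B show "(\<lambda>B\<in>\<pi>. \<Psi> f (rep B)) B = f B"
          using rep[of B] PiE_arb[OF f, of B] by (cases "B \<in> \<pi>") (simp_all add: \<Psi>_def)
      qed
    qed
    show "\<forall>i\<in>{i \<in> PiE A (\<lambda>_. I). kernel_partition A i = \<pi>}. \<Psi> (\<lambda>B\<in>\<pi>. i (rep B)) = i"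
    proof
      fix i assume i: "i \<in> {i \<in> PiE A (\<lambda>_. I). kernel_partition A i = \<pi>}"
      then have i': "i \<in> PiE A (\<lambda>_. I)" and k: "kernel_partition A i = \<pi>" by auto
      show "\<Psi> (\<lambda>B\<in>\<pi>. i (rep B)) = i"
      proof
        fix a show "\<Psi> (\<lambda>B\<in>\<pi>. i (rep B)) a = i a"
        proof (cases "a \<in> A")
          case True
          have B: "block_of \<pi> a \<in> \<pi>" by (rule block_of_mem(1)[OF \<pi> True])
          have "rep (block_of \<pi> a) \<in> {b \<in> A. i b = i a}"
            using rep(1)[OF B] block_of_kernel[OF True, of i] k by simp
          then show ?thesis using True B by (simp add: \<Psi>_def)
        next
          case False
          then show ?thesis using PiE_arb[OF i' False] by (simp add: \<Psi>_def)
        qed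
      qed
    qed
    show "\<Psi> ` {f \<in> PiE \<pi> (\<lambda>_. I). inj_on f \<pi>} \<subseteq> {i \<in> PiE A (\<lambda>_. I). kernel_partition A i = \<pi>}"
    proof (rule image_subsetI)
      fix f assume "f \<in> {f \<in> PiE \<pi> (\<lambda>_. I). inj_on f \<pi>}"
      then have f: "f \<in> PiE \<pi> (\<lambda>_. I)" and inj: "inj_on f \<pi>" by auto
      have "\<Psi> f \<in> PiE A (\<lambda>_. I)"
        unfolding \<Psi>_def by (rule restrict_PiE_iff[THEN iffD2]) (use PiE_mem[OF f] block_of_mem(1)[OF \<pi>] in blast)
      moreover have "kernel_partition A (\<Psi> f) = \<pi>"
      proof (rule kernel_partition_eqI[OF \<pi>])
        fix a b assume ab: "a \<in> A" "b \<in> A"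
        then show "\<Psi> f a = \<Psi> f b \<longleftrightarrow> block_of \<pi> a = block_of \<pi> b"
          using inj_on_eq_iff[OF inj block_of_mem(1)[OF \<pi> ab(1)] block_of_mem(1)[OF \<pi> ab(2)]]
          by (simp add: \<Psi>_def)
      qed
      ultimately show "\<Psi> f \<in> {i \<in> PiE A (\<lambda>_. I). kernel_partition A i = \<pi>}" by simp
    qed
    show "(\<lambda>i. \<lambda>B\<in>\<pi>. i (rep B)) ` {i \<in> PiE A (\<lambda>_. I). kernel_partition A i = \<pi>} \<subseteq>
        {f \<in> PiE \<pi> (\<lambda>_. I). inj_on f \<pi>}"
    proof (rule image_subsetI)
      fix i assume "i \<in> {i \<in> PiE A (\<lambda>_. I). kernel_partition A i = \<pi>}"
      then have i: "i \<in> PiE A (\<lambda>_. I)" and k: "kernel_partition A i = \<pi>" by auto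
      have "(\<lambda>B\<in>\<pi>. i (rep B)) \<in> PiE \<pi> (\<lambda>_. I)"
        by (rule restrict_PiE_iff[THEN iffD2]) (use PiE_mem[OF i] rep(2) in blast)
      moreover have "inj_on (\<lambda>B\<in>\<pi>. i (rep B)) \<pi>"
      proof (rule inj_onI)
        fix B C assume BC: "B \<in> \<pi>" "C \<in> \<pi>" "(\<lambda>B\<in>\<pi>. i (rep B)) B = (\<lambda>B\<in>\<pi>. i (rep B)) C"
        then have "i (rep B) = i (rep C)" by simp
        then have "block_of \<pi> (rep B) = block_of \<pi> (rep C)"
          using block_of_kernel[OF rep(2)[OF BC(1)], of i] block_of_kernel[OF rep(2)[OF BC(2)], of i] k by simp
        then show "B = C" using rep(3) BC by simp
      qed
      ultimately show "(\<lambda>B\<in>\<pi>. i (rep B)) \<in> {f \<in> PiE \<pi> (\<lambda>_. I). inj_on f \<pi>}" by simp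
    qed
  qed
  then have "card {i \<in> PiE A (\<lambda>_. I). kernel_partition A i = \<pi>} = card {f \<in> PiE \<pi> (\<lambda>_. I). inj_on f \<pi>}"
    by (rule bij_betw_same_card[symmetric])
  also have "\<dots> = (\<Prod>k<card \<pi>. card I - k)"
    using card_inj_on_subset_funcset[OF fin I, of \<pi>] by (simp add: atLeast0LessThan)
  finally show ?thesis .
qed

text \<open>\<open>rep \<pi>\<close> must have kernel \<open>\<pi>\<close>, but its values may leave
  \<open>I\<close>. So \<open>block_index\<close> can be used even for partitions with more blocks
  than \<open>I\<close> has elements, where the factor in front is 0.\<close>

lemma sum_group_kernel:
  fixes w :: "('a \<Rightarrow> 'b) \<Rightarrow> complex"
  assumes A: "finite A" and I: "finite I"
    and w: "\<And>i j. (\<And>a b. a \<in> A \<Longrightarrow> b \<in> A \<Longrightarrow> i a = i b \<longleftrightarrow> j a = j b) \<Longrightarrow> w i = w j"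
    and rep: "\<And>\<pi> a b. partition_on A \<pi> \<Longrightarrow> a \<in> A \<Longrightarrow> b \<in> A \<Longrightarrow> rep \<pi> a = rep \<pi> b \<longleftrightarrow> block_of \<pi> a = block_of \<pi> b"
  shows "(\<Sum>i \<in> PiE A (\<lambda>_. I). w i) =
    (\<Sum>\<pi> | partition_on A \<pi>. of_nat (\<Prod>k<card \<pi>. card I - k) * w (rep \<pi>))"
proof -
  have "(\<Sum>i \<in> PiE A (\<lambda>_. I). w i) =
      (\<Sum>\<pi> | partition_on A \<pi>. \<Sum>i | i \<in> PiE A (\<lambda>_. I) \<and> kernel_partition A i = \<pi>. w i)"
    by (rule sum.group[symmetric])
      (use A I finitely_many_partition_on[OF A] in \<open>auto intro: finite_PiE partition_on_kernel\<close>)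
  also have "\<dots> = (\<Sum>\<pi> | partition_on A \<pi>. of_nat (\<Prod>k<card \<pi>. card I - k) * w (rep \<pi>))"
  proof (rule sum.cong[OF refl])
    fix \<pi> assume "\<pi> \<in> {\<pi>. partition_on A \<pi>}"
    then have \<pi>: "partition_on A \<pi>" by simp
    have "w i = w (rep \<pi>)" if k: "kernel_partition A i = \<pi>" for i
    proof (rule w)
      fix a b assume ab: "a \<in> A" "b \<in> A"
      have "block_of \<pi> a = {c \<in> A. i c = i a}" "block_of \<pi> b = {c \<in> A. i c = i b}"
        using block_of_kernel[OF ab(1), of i] block_of_kernel[OF ab(2), of i] k by auto
      then have "block_of \<pi> a = block_of \<pi> b \<longleftrightarrow> i a = i b" using ab by auto
      then show "i a = i b \<longleftrightarrow> rep \<pi> a = rep \<pi> b" using rep[OF \<pi> ab] by simp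
    qed
    then have "(\<Sum>i | i \<in> PiE A (\<lambda>_. I) \<and> kernel_partition A i = \<pi>. w i) =
        (\<Sum>i | i \<in> PiE A (\<lambda>_. I) \<and> kernel_partition A i = \<pi>. w (rep \<pi>))"
      by (intro sum.cong refl) simp
    also have "\<dots> = of_nat (card {i \<in> PiE A (\<lambda>_. I). kernel_partition A i = \<pi>}) * w (rep \<pi>)"
      by simp
    finally show "(\<Sum>i | i \<in> PiE A (\<lambda>_. I) \<and> kernel_partition A i = \<pi>. w i) =
        of_nat (\<Prod>k<card \<pi>. card I - k) * w (rep \<pi>)"
      by (simp only: card_functions_with_kernel[OF A I \<pi>])
  qed
  finally show ?thesis .
qed

text \<open>Distinct blocks have distinct minima, and the number of minima up to a given one
  strictly increases with it.\<close>

lemma block_index_eq_iff: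
  assumes A: "finite A" and \<pi>: "partition_on A \<pi>" and ab: "a \<in> A" "b \<in> A"
  shows "block_index \<pi> a = block_index \<pi> b \<longleftrightarrow> block_of \<pi> a = block_of \<pi> b"
proof
  have fin: "finite \<pi>" by (rule finite_elements[OF A \<pi>])
  have Min_mem: "Min B \<in> B" if B: "B \<in> \<pi>" for B
  proof (rule Min_in)
    show "finite B" by (rule finite_subset[OF partition_on_block_subset[OF \<pi> B] A])
    show "B \<noteq> {}" using partition_onD3[OF \<pi>] B by auto
  qed
  have less: "block_index \<pi> a < block_index \<pi> b"
    if "a \<in> A" "b \<in> A" "Min (block_of \<pi> a) < Min (block_of \<pi> b)" for a b
    unfolding block_index_def
  proof (rule psubset_card_mono)
    show "finite {C \<in> \<pi>. Min C \<le> Min (block_of \<pi> b)}" using fin by simp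
    have "block_of \<pi> b \<in> {C \<in> \<pi>. Min C \<le> Min (block_of \<pi> b)}"
      using block_of_mem(1)[OF \<pi> that(2)] by simp
    moreover have "block_of \<pi> b \<notin> {C \<in> \<pi>. Min C \<le> Min (block_of \<pi> a)}" using that(3) by simp
    moreover have "{C \<in> \<pi>. Min C \<le> Min (block_of \<pi> a)} \<subseteq> {C \<in> \<pi>. Min C \<le> Min (block_of \<pi> b)}"
      using that(3) by auto
    ultimately show "{C \<in> \<pi>. Min C \<le> Min (block_of \<pi> a)} \<subset> {C \<in> \<pi>. Min C \<le> Min (block_of \<pi> b)}"
      by blast
  qed
  note B = block_of_mem(1)[OF \<pi> ab(1)] block_of_mem(1)[OF \<pi> ab(2)]
  {
    assume "block_index \<pi> a = block_index \<pi> b"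
    then have "Min (block_of \<pi> a) = Min (block_of \<pi> b)"
      using less[of a b] less[of b a] ab by (metis less_irrefl nat_neq_iff)
    then show "block_of \<pi> a = block_of \<pi> b"
      using partition_on_block_unique[OF \<pi> B Min_mem[OF B(1)]] Min_mem[OF B(2)] by simp
  next
    assume "block_of \<pi> a = block_of \<pi> b"
    then show "block_index \<pi> a = block_index \<pi> b" by (simp add: block_index_def)
  }
qed

lemma block_index_mem:
  assumes A: "finite A" and \<pi>: "partition_on A \<pi>" and a: "a \<in> A"
  shows "block_index \<pi> a \<in> {1..card \<pi>}"
proof -
  have fin: "finite \<pi>" by (rule finite_elements[OF A \<pi>])
  have "block_of \<pi> a \<in> {C \<in> \<pi>. Min C \<le> Min (block_of \<pi> a)}"
    using block_of_mem(1)[OF \<pi> a] by simp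
  then have "block_index \<pi> a > 0" unfolding block_index_def using fin by (simp add: card_gt_0_iff) blast
  moreover have "block_index \<pi> a \<le> card \<pi>"
    unfolding block_index_def by (rule card_mono[OF fin]) auto
  ultimately show ?thesis by simp
qed

lemma card_image_block_index:
  assumes A: "finite A" and \<pi>: "partition_on A \<pi>"
  shows "card (block_index \<pi> ` A) = card \<pi>"
proof -
  have "card (block_index \<pi> ` A) = card (block_of \<pi> ` A)"
    by (rule card_image_eq_of_same_kernel[OF A block_index_eq_iff[OF A \<pi>]])
  then show ?thesis by (simp only: image_block_of[OF \<pi>])
qed

section \<open>The limit\<close>

lemma falling_factorial_ratio_tendsto:
  "(\<lambda>N. real (\<Prod>k<p. N - k) / real N ^ p) \<longlonglongrightarrow> 1"
proof -
  have "(\<lambda>N. real (N - k) / real N) \<longlonglongrightarrow> 1" for k :: nat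
  proof -
    have "(\<lambda>N. 1 - real k / real N) \<longlonglongrightarrow> 1 - 0"
      by (intro tendsto_diff tendsto_const lim_const_over_n)
    moreover have "\<forall>\<^sub>F N in sequentially. 1 - real k / real N = real (N - k) / real N"
      using eventually_ge_at_top[of "max 1 k"]
    proof eventually_elim
      case (elim N)
      then show ?case by (simp add: of_nat_diff diff_divide_distrib)
    qed
    ultimately show ?thesis by (simp add: tendsto_cong)
  qed
  then have "(\<lambda>N. \<Prod>k<p. real (N - k) / real N) \<longlonglongrightarrow> (\<Prod>k<p. 1)"
    by (intro tendsto_prod)
  then show ?thesis by (simp add: prod_dividef)
qed

text \<open>The total exponent of N is p + r - 2 - m/2, possibly a half-integer; as a power of the
  square root of N it stays integral.\<close>

lemma scaling_factor_eq:
  assumes N: "N \<ge> 1" and r: "r \<ge> 1"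
  shows "real N powi (int r - 2) * (1 / sqrt (real N)) ^ m * real N ^ p =
    sqrt (real N) powi (2 * int p + 2 * int r - int m - 4)"
proof -
  define s where "s = sqrt (real N)"
  have s: "s \<noteq> 0" "real N = s powi 2" using N by (simp_all add: s_def)
  have "real N powi (int r - 2) = s powi (2 * (int r - 2))"
    unfolding s(2) by (rule power_int_mult[symmetric])
  moreover have "(1 / s) ^ m = s powi (- int m)"
    by (simp add: power_int_minus power_one_over inverse_eq_divide)
  moreover have "real N ^ p = s powi (2 * int p)"
    using power_int_mult[of s 2 "int p"] unfolding s(2) by (simp only: power_int_of_nat)
  ultimately have "real N powi (int r - 2) * (1 / s) ^ m * real N ^ p =
      s powi (2 * (int r - 2)) * s powi (- int m) * s powi (2 * int p)"
    by (simp only:)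
  also have "\<dots> = s powi (2 * (int r - 2) + - int m + 2 * int p)"
    by (simp only: power_int_add[OF disjI1[OF s(1)]])
  also have "2 * (int r - 2) + - int m + 2 * int p = 2 * int p + 2 * int r - int m - 4" by simp
  finally show ?thesis by (simp only: s_def)
qed

text \<open>The falling factorial grows like N^p, so the product is of order N^(-d/2), where
  \<open>d\<close> measures twice the distance of \<open>p\<close> from the maximal number of
  vertices.\<close>

lemma scaling_factor_tendsto:
  assumes r: "r \<ge> 1" and le: "2 * p + 2 * r \<le> m + 4"
  shows "(\<lambda>N. of_nat N powi (int r - 2) * (1 / complex_of_real (sqrt (real N))) ^ m * of_nat (\<Prod>k<p. N - k))
    \<longlonglongrightarrow> (if 2 * p + 2 * r = m + 4 then 1 else 0)"
proof -
  define d where "d = m + 4 - (2 * p + 2 * r)"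
  have d: "2 * int p + 2 * int r - int m - 4 = - int d" using le by (simp add: d_def of_nat_diff)
  have "(\<lambda>N. (1 / sqrt (real N)) ^ d) \<longlonglongrightarrow> (if d = 0 then 1 else 0)"
  proof (cases "d = 0")
    case False
    have "(\<lambda>N. 1 / sqrt (real N)) \<longlonglongrightarrow> 0"
      by (rule tendsto_divide_0[OF tendsto_const filterlim_at_top_imp_at_infinity[OF
            filterlim_compose[OF sqrt_at_top filterlim_real_sequentially]]])
    then have "(\<lambda>N. (1 / sqrt (real N)) ^ d) \<longlonglongrightarrow> 0 ^ d" by (rule tendsto_power)
    then show ?thesis using False by (simp add: power_0_left)
  qed simp
  then have "(\<lambda>N. (1 / sqrt (real N)) ^ d * (real (\<Prod>k<p. N - k) / real N ^ p)) \<longlonglongrightarrow> (if d = 0 then 1 else 0) * 1"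
    by (intro tendsto_mult falling_factorial_ratio_tendsto)
  moreover have "\<forall>\<^sub>F N in sequentially. (1 / sqrt (real N)) ^ d * (real (\<Prod>k<p. N - k) / real N ^ p) =
      real N powi (int r - 2) * (1 / sqrt (real N)) ^ m * real (\<Prod>k<p. N - k)"
    using eventually_ge_at_top[of 1]
  proof eventually_elim
    case (elim N)
    have "real N powi (int r - 2) * (1 / sqrt (real N)) ^ m * real N ^ p = (1 / sqrt (real N)) ^ d"
      unfolding scaling_factor_eq[OF elim r] d by (simp add: power_int_minus power_one_over inverse_eq_divide)
    then show ?case using elim by (simp add: field_simps)
  qed
  ultimately have "(\<lambda>N. real N powi (int r - 2) * (1 / sqrt (real N)) ^ m * real (\<Prod>k<p. N - k)) \<longlonglongrightarrow>
      (if d = 0 then 1 else 0)"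
    by (simp add: tendsto_cong)
  then have "(\<lambda>N. complex_of_real (real N powi (int r - 2) * (1 / sqrt (real N)) ^ m * real (\<Prod>k<p. N - k))) \<longlonglongrightarrow>
      complex_of_real (if d = 0 then 1 else 0)"
    by (rule tendsto_of_real)
  moreover have "d = 0 \<longleftrightarrow> 2 * p + 2 * r = m + 4" using le by (auto simp: d_def)
  ultimately show ?thesis by (simp add: of_real_power_int if_distrib cong: if_cong)
qed

theorem corollary4p9:
  fixes r m :: nat and ms :: "nat \<Rightarrow> nat" and \<gamma> :: "nat \<Rightarrow> nat"
    and \<beta> :: "nat \<Rightarrow> real"
    and M :: "nat \<Rightarrow> 'a measure"
    and x :: "nat \<Rightarrow> nat \<Rightarrow> nat \<Rightarrow> 'a \<Rightarrow> complex"
    and \<alpha> \<Phi> :: "nat \<Rightarrow> complex"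
  assumes r: "r \<ge> 1"
    and ms: "\<And>i. 1 \<le> i \<Longrightarrow> i \<le> r \<Longrightarrow> ms i \<ge> 1"
    and m: "m = (\<Sum>i=1..r. ms i)"
    and \<gamma>: "\<gamma> = cycles_perm r ms"
    and wigner: "\<And>N. N \<ge> 1 \<Longrightarrow> complex_wigner N \<beta> (M N) (x N)"
    and \<alpha>: "\<And>N. \<alpha> N = scaled_trace_cumulant N r ms (M N) (x N)"
    and \<Phi>: "\<And>N. \<Phi> N =
      (\<Sum>\<pi> | partition_on {1..m} \<pi> \<and> real (card \<pi>) - real m / 2 + real r - 2 = 0.
         \<Sum>\<tau> | partition_on {1..m} \<tau> \<and> partition_join {1..m} \<tau> (cycle_partition m \<gamma>) = {{1..m}}.
           cumulant_partition (M N) \<tau> (\<lambda>l. x N (block_index \<pi> l) (block_index \<pi> (\<gamma> l))))"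
  shows "(\<exists>\<epsilon>. \<epsilon> \<in> o(\<lambda>_. 1) \<and>
            (\<forall>N\<ge>1. real N \<ge> real m / 2 - real r + 2 \<longrightarrow> \<alpha> N = \<Phi> N + \<epsilon> N)) \<and>
         (\<forall>N\<ge>1. real N \<ge> real m / 2 - real r + 2 \<longrightarrow> \<alpha> \<longlonglongrightarrow> \<Phi> N)"
proof -
  have m': "m = offset ms (Suc r)" by (simp only: m offset_Suc')
  have ms': "ms k \<ge> 1" if "k \<in> {1..r}" for k using ms that by simp
  have mat: "complex_wigner_matrix N \<beta> (M N) (x N)" if "N \<ge> 1" for N
    using wigner[OF that] by (simp add: complex_wigner_matrix_def)
  have \<beta>: "\<beta> 2 \<ge> 0" by (rule complex_wigner_matrix.\<beta>_2_nonneg[OF mat[of 2]]) simp_all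
  have fin: "finite {1..m}" by simp
  \<comment> \<open>The weight of a kernel is the same for all \<open>N\<close>, which enters only
    through the scalars \<open>c p N\<close>.\<close>
  define w where "w \<pi> = index_weight \<beta> r ms (block_index \<pi>)" for \<pi>
  define c where "c p N = of_nat N powi (int r - 2) * (1 / complex_of_real (sqrt (real N))) ^ m *
    of_nat (\<Prod>k<p. N - k)" for p N :: nat
  define P where "P = {\<pi>. partition_on {1..m} \<pi>}"
  have finP: "finite P" unfolding P_def by (rule finitely_many_partition_on[OF fin])
  have \<alpha>_eq: "\<alpha> N = (\<Sum>\<pi>\<in>P. c (card \<pi>) N * w \<pi>)" if N: "N \<ge> 1" for N
  proof -
    have "cumulant (M N) {1..r} (\<lambda>k \<omega>. mat_trace (wigner_mat N (x N) \<omega> ^\<^sub>m ms k)) =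
        (1 / complex_of_real (sqrt (real N))) ^ m * (\<Sum>i \<in> PiE {1..m} (\<lambda>_. {1..N}). index_weight \<beta> r ms i)"
      by (rule complex_wigner_matrix.cumulant_traces[OF mat[OF N] \<beta> r ms' m'])
    also have "(\<Sum>i \<in> PiE {1..m} (\<lambda>_. {1..N}). index_weight \<beta> r ms i) =
        (\<Sum>\<pi> | partition_on {1..m} \<pi>. of_nat (\<Prod>k<card \<pi>. card {1..N} - k) * w \<pi>)"
      unfolding w_def
    proof (rule sum_group_kernel[OF fin])
      fix i j :: "nat \<Rightarrow> nat"
      assume "\<And>a b. a \<in> {1..m} \<Longrightarrow> b \<in> {1..m} \<Longrightarrow> i a = i b \<longleftrightarrow> j a = j b"
      then show "index_weight \<beta> r ms i = index_weight \<beta> r ms j"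
        unfolding m' by (rule index_weight_cong)
    qed (simp, rule block_index_eq_iff[OF fin])
    finally show ?thesis
      unfolding \<alpha> scaled_trace_cumulant_def P_def c_def by (simp add: sum_distrib_left mult.assoc)
  qed
  \<comment> \<open>The scalars of these partitions grow without bound in \<open>N\<close>; the
    bound on the number of vertices removes their terms.\<close>
  have w0: "w \<pi> = 0" if "\<pi> \<in> P" "2 * card \<pi> + 2 * r > m + 4" for \<pi>
    unfolding w_def
  proof (rule index_weight_eq_0[OF ms'])
    show "2 * card (block_index \<pi> ` {1..offset ms (Suc r)}) + 2 * r > offset ms (Suc r) + 4"
      using that card_image_block_index[OF fin, of \<pi>] m' by (simp add: P_def)
  qed
  define L where "L = (\<Sum>\<pi>\<in>P. if 2 * card \<pi> + 2 * r = m + 4 then w \<pi> else 0)"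
  have "(\<lambda>N. \<Sum>\<pi>\<in>P. c (card \<pi>) N * w \<pi>) \<longlonglongrightarrow> L"
    unfolding L_def
  proof (rule tendsto_sum)
    fix \<pi> assume \<pi>: "\<pi> \<in> P"
    show "(\<lambda>N. c (card \<pi>) N * w \<pi>) \<longlonglongrightarrow> (if 2 * card \<pi> + 2 * r = m + 4 then w \<pi> else 0)"
    proof (cases "2 * card \<pi> + 2 * r \<le> m + 4")
      case True
      from tendsto_mult_right[OF scaling_factor_tendsto[OF r True], of "w \<pi>"]
      show ?thesis unfolding c_def by (simp split: if_splits)
    next
      case False
      then show ?thesis using w0[OF \<pi>] by simp
    qed
  qed
  moreover have "\<forall>\<^sub>F N in sequentially. \<alpha> N = (\<Sum>\<pi>\<in>P. c (card \<pi>) N * w \<pi>)"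
    using eventually_ge_at_top[of 1] by eventually_elim (rule \<alpha>_eq)
  ultimately have lim: "\<alpha> \<longlonglongrightarrow> L" by (simp add: tendsto_cong)
  \<comment> \<open>Although \<open>\<Phi> N\<close> is built from the matrix of size
    \<open>N\<close>, it equals the constant \<open>L\<close> for every admissible \<open>N\<close>,
    so both claims follow from the one limit.\<close>
  have \<Phi>_eq: "\<Phi> N = L" if N: "N \<ge> 1" "real N \<ge> real m / 2 - real r + 2" for N
  proof -
    have mne: "{1..m} \<noteq> {}" using cycle_block_nonempty[of 1 ms] ms'[of 1] r Union_cycle_blocks[of ms r] m' by auto
    have cp: "cycle_partition m \<gamma> = cycle_block ms ` {1..r}"
      unfolding \<gamma> m' by (rule cycle_partition_cycles_perm[OF ms'])
    have pc: "partition_on {1..m} (cycle_block ms ` {1..r})"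
      unfolding m' by (rule partition_on_cycle_blocks[OF ms'])
    have links_iff: "partition_join {1..m} \<tau> (cycle_partition m \<gamma>) = {{1..m}} \<longleftrightarrow> links (cycle_block ms) {1..r} \<tau>"
      if "partition_on {1..m} \<tau>" for \<tau>
      unfolding cp by (rule partition_join_eq_top_iff[OF mne that pc disjoint_cycle_blocks])
    have "\<Phi> N = (\<Sum>\<pi> | \<pi> \<in> P \<and> 2 * card \<pi> + 2 * r = m + 4. w \<pi>)"
      unfolding \<Phi>
    proof (rule sum.cong)
      show "{\<pi>. partition_on {1..m} \<pi> \<and> real (card \<pi>) - real m / 2 + real r - 2 = 0} =
          {\<pi>. \<pi> \<in> P \<and> 2 * card \<pi> + 2 * r = m + 4}"
      proof -
        have "real p - real m / 2 + real r - 2 = 0 \<longleftrightarrow> 2 * p + 2 * r = m + 4" for p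
          by linarith
        then show ?thesis by (simp add: P_def)
      qed
      fix \<pi> assume "\<pi> \<in> {\<pi>. \<pi> \<in> P \<and> 2 * card \<pi> + 2 * r = m + 4}"
      then have \<pi>: "partition_on {1..m} \<pi>" and card\<pi>: "2 * card \<pi> + 2 * r = m + 4" by (auto simp: P_def)
      \<comment> \<open>Here the threshold is used: \<open>card \<pi>\<close> is m/2 - r + 2, so all
        block numbers are indices of entries of the matrix of size \<open>N\<close>.\<close>
      have "card \<pi> \<le> N" using card\<pi> N(2) by linarith
      then have idx: "block_index \<pi> l \<in> {1..N}" if "l \<in> {1..m}" for l
        using block_index_mem[OF fin \<pi> that] by auto
      show "(\<Sum>\<tau> | partition_on {1..m} \<tau> \<and> partition_join {1..m} \<tau> (cycle_partition m \<gamma>) = {{1..m}}.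
           cumulant_partition (M N) \<tau> (\<lambda>l. x N (block_index \<pi> l) (block_index \<pi> (\<gamma> l)))) = w \<pi>"
        unfolding w_def index_weight_def m'[symmetric]
      proof (rule sum.cong)
        show "{\<tau>. partition_on {1..m} \<tau> \<and> partition_join {1..m} \<tau> (cycle_partition m \<gamma>) = {{1..m}}} =
            {\<tau>. partition_on {1..m} \<tau> \<and> links (cycle_block ms) {1..r} \<tau>}"
          using links_iff by blast
        fix \<tau> assume "\<tau> \<in> {\<tau>. partition_on {1..m} \<tau> \<and> links (cycle_block ms) {1..r} \<tau>}"
        then have \<tau>: "partition_on {1..m} \<tau>" by simp
        show "cumulant_partition (M N) \<tau> (\<lambda>l. x N (block_index \<pi> l) (block_index \<pi> (\<gamma> l))) =
          (\<Prod>B\<in>\<tau>. if balanced_block (cycles_perm r ms) (block_index \<pi>) B then complex_of_real (\<beta> (card B)) else 0)"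
          unfolding \<gamma>
          by (rule complex_wigner_matrix.cumulant_partition_entries[OF mat[OF N(1)] \<beta> m' idx \<tau>])
      qed
    qed
    also have "\<dots> = L" unfolding L_def using finP by (simp add: sum.inter_filter)
    finally show ?thesis .
  qed
  \<comment> \<open>The error is defined as \<open>\<alpha> N - L\<close> for every
    \<open>N\<close>, also below the threshold, where nothing is claimed about
    \<open>\<Phi> N\<close>.\<close>
  have "(\<lambda>N. \<alpha> N - L) \<longlonglongrightarrow> L - L" by (intro tendsto_diff lim tendsto_const)
  then have "(\<lambda>N. \<alpha> N - L) \<in> o(\<lambda>_. 1)" by (intro smalloI_tendsto) simp_all
  moreover have "\<forall>N\<ge>1. real N \<ge> real m / 2 - real r + 2 \<longrightarrow> \<alpha> N = \<Phi> N + (\<alpha> N - L)"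
    by (simp add: \<Phi>_eq)
  ultimately show ?thesis using lim \<Phi>_eq by (intro conjI exI[of _ "\<lambda>N. \<alpha> N - L"]) simp_all
qed

end
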